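(* Let $H,G$ be countable groups and $X$ a subset of the standard wreath product $H\wr G$ (whose underlying set is identified with $H^{(G)}\times G$). The following statements are equivalent: (i) $(H\wr G,X)$ has relative Property T; (ii) there exist subsets $Y\subset H$ and $Z\subset G$ with $X\subset Y^{(Z)}\times Z$, the pairs $(H,Y)$ and $(G,Z)$ have relative Property T, and the following additional condition is satisfied: the function $X\to\mathbf{N}$, $(w,g)\mapsto \#\,\mathrm{Supp}(w)$ is bounded.
   Context: The standard wreath product is $H\wr G=H^{(G)}\rtimes G$, where $H^{(G)}=\bigoplus_{g\in G}H$ is the group of finitely supported functions $G\to H$ and $G$ acts by shifting the copies of $H$. For $w\in H^{(G)}$, $\mathrm{Supp}(w)=\{g\in G: w(g)\neq 1\}$. For $Y\subset H$ and $Z\subset G$, $Y^{(Z)}$ denotes the set of $w\in H^{(G)}$ with $\mathrm{Supp}(w)\subset Z$ and $w(z)\in Y$ for all $z\in Z$. For a countable group $\Gamma$ and a subset $S\subset \Gamma$, the pair $(\Gamma,S)$ has relative Property T if for every isometric action of $\Gamma$ on a Hilbert space, the set $\{\gamma\cdot 0:\gamma\in S\}$ is bounded. *)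

theory Defs
  imports
    "HOL-Analysis.Abstract_Metric_Spaces"
    "HOL-Algebra.Group_Action"
    "HOL-Algebra.Module"
    "HOL-Algebra.Product_Groups"
begin

section \<open>Real Hilbert spaces with explicit carriers\<close>

text \<open>The notion ``for every Hilbert space'' occurs inside a definition, so Hilbert spaces
  are structures with explicit carriers that can be quantified over.  The fields mult and
  one inherited from module records play no role.\<close>

definition real_ring :: "real ring"
  where "real_ring =
    \<lparr>carrier = UNIV, monoid.mult = (*), one = 1, ring.zero = 0, add = (+)\<rparr>"

lemma cring_real_ring: "cring real_ring"
proof -
  have "\<exists>y. y + x = 0" for x :: real by (rule exI[of _ "- x"]) simp
  then show ?thesis
    by (intro cringI abelian_groupI comm_monoidI) (auto simp: real_ring_def algebra_simps)
qed

record 'v inner_space = "(real, 'v) module" +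
  iprod :: "'v \<Rightarrow> 'v \<Rightarrow> real"

locale inner_product_space = module real_ring V
  for V :: "('v, 'm) inner_space_scheme" (structure) +
  assumes iprod_commute: "\<lbrakk>x \<in> carrier V; y \<in> carrier V\<rbrakk> \<Longrightarrow> iprod V x y = iprod V y x"
    and iprod_add_left:
      "\<lbrakk>x \<in> carrier V; y \<in> carrier V; z \<in> carrier V\<rbrakk>
        \<Longrightarrow> iprod V (x \<oplus> y) z = iprod V x z + iprod V y z"
    and iprod_smult_left:
      "\<lbrakk>x \<in> carrier V; y \<in> carrier V\<rbrakk> \<Longrightarrow> iprod V (a \<odot> x) y = a * iprod V x y"
    and iprod_nonneg: "x \<in> carrier V \<Longrightarrow> 0 \<le> iprod V x x"
    and iprod_definite: "\<lbrakk>x \<in> carrier V; iprod V x x = 0\<rbrakk> \<Longrightarrow> x = \<zero>"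

definition inorm :: "('v, 'm) inner_space_scheme \<Rightarrow> 'v \<Rightarrow> real"
  where "inorm V x = sqrt (iprod V x x)"

text \<open>The locale \<^locale>\<open>Metric_space\<close> demands nonnegativity and symmetry also off the carrier.\<close>

definition idist :: "('v, 'm) inner_space_scheme \<Rightarrow> 'v \<Rightarrow> 'v \<Rightarrow> real"
  where "idist V x y =
    (if x \<in> carrier V \<and> y \<in> carrier V then inorm V (x \<ominus>\<^bsub>V\<^esub> y) else 0)"

context inner_product_space
begin

lemma smult_in [simp, intro]: "x \<in> carrier V \<Longrightarrow> a \<odot> x \<in> carrier V"
  by (rule smult_closed) (simp_all add: real_ring_def)

lemma iprod_add_right:
  "\<lbrakk>x \<in> carrier V; y \<in> carrier V; z \<in> carrier V\<rbrakk>
    \<Longrightarrow> iprod V z (x \<oplus> y) = iprod V z x + iprod V z y"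
  by (metis iprod_commute iprod_add_left M.a_closed)

lemma iprod_smult_right:
  "\<lbrakk>x \<in> carrier V; y \<in> carrier V\<rbrakk> \<Longrightarrow> iprod V y (a \<odot> x) = a * iprod V y x"
  by (metis iprod_commute iprod_smult_left smult_in)

lemma iprod_zero_left [simp]: "x \<in> carrier V \<Longrightarrow> iprod V \<zero> x = 0"
  using iprod_add_left[of "\<zero>" "\<zero>" x] by simp

lemma iprod_zero_right [simp]: "x \<in> carrier V \<Longrightarrow> iprod V x \<zero> = 0"
  using iprod_add_right[of "\<zero>" "\<zero>" x] by simp

lemma iprod_uminus_left: "\<lbrakk>x \<in> carrier V; y \<in> carrier V\<rbrakk> \<Longrightarrow> iprod V (\<ominus> x) y = - iprod V x y"
  using iprod_add_left[of x "\<ominus> x" y] by (simp add: M.r_neg)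

lemma iprod_uminus_right: "\<lbrakk>x \<in> carrier V; y \<in> carrier V\<rbrakk> \<Longrightarrow> iprod V y (\<ominus> x) = - iprod V y x"
  using iprod_add_right[of x "\<ominus> x" y] by (simp add: M.r_neg)

lemma iprod_minus_left:
  "\<lbrakk>x \<in> carrier V; y \<in> carrier V; z \<in> carrier V\<rbrakk>
    \<Longrightarrow> iprod V (x \<ominus> y) z = iprod V x z - iprod V y z"
  by (simp add: a_minus_def iprod_add_left iprod_uminus_left)

lemma iprod_minus_right:
  "\<lbrakk>x \<in> carrier V; y \<in> carrier V; z \<in> carrier V\<rbrakk>
    \<Longrightarrow> iprod V z (x \<ominus> y) = iprod V z x - iprod V z y"
  by (simp add: a_minus_def iprod_add_right iprod_uminus_right)

lemmas iprod_simps = iprod_add_left iprod_add_right iprod_smult_left iprod_smult_right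
  iprod_minus_left iprod_minus_right

lemma inorm_nonneg: "x \<in> carrier V \<Longrightarrow> 0 \<le> inorm V x"
  by (simp add: inorm_def iprod_nonneg)

lemma inorm_sq: "x \<in> carrier V \<Longrightarrow> (inorm V x)\<^sup>2 = iprod V x x"
  by (simp add: inorm_def iprod_nonneg)

lemma inorm_smult: "x \<in> carrier V \<Longrightarrow> inorm V (a \<odot> x) = \<bar>a\<bar> * inorm V x"
  by (simp add: inorm_def iprod_simps real_sqrt_mult flip: power2_eq_square mult.assoc)

lemma Cauchy_Schwarz:
  assumes [simp]: "x \<in> carrier V" "y \<in> carrier V"
  shows "iprod V x y \<le> inorm V x * inorm V y"
proof -
  define a where "a = inorm V x"
  define b where "b = inorm V y"
  have ab: "0 \<le> a" "0 \<le> b" "a\<^sup>2 = iprod V x x" "b\<^sup>2 = iprod V y y"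
    by (simp_all add: a_def b_def inorm_nonneg inorm_sq)
  have "0 \<le> iprod V (b \<odot> x \<ominus> a \<odot> y) (b \<odot> x \<ominus> a \<odot> y)"
    by (simp add: iprod_nonneg)
  also have "\<dots> = b\<^sup>2 * iprod V x x - 2 * a * b * iprod V x y + a\<^sup>2 * iprod V y y"
    by (simp add: iprod_simps iprod_commute[of y x] algebra_simps power2_eq_square)
  also have "\<dots> = b\<^sup>2 * a\<^sup>2 - 2 * a * b * iprod V x y + a\<^sup>2 * b\<^sup>2"
    by (simp only: ab)
  finally have *: "(a * b) * iprod V x y \<le> (a * b) * (a * b)"
    by (simp add: algebra_simps power2_eq_square)
  show ?thesis
  proof (cases "a * b = 0")
    case True
    then have "x = \<zero> \<or> y = \<zero>"
      using ab by (metis assms iprod_definite mult_eq_0_iff power2_eq_square)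
    then have "iprod V x y = 0" by auto
    then show ?thesis using ab unfolding a_def b_def by simp
  next
    case False
    then have "0 < a * b" using ab by (simp add: less_le)
    then have "iprod V x y \<le> a * b" using * mult_le_cancel_left_pos by blast
    then show ?thesis by (simp add: a_def b_def)
  qed
qed

lemma inorm_triangle:
  assumes [simp]: "x \<in> carrier V" "y \<in> carrier V"
  shows "inorm V (x \<oplus> y) \<le> inorm V x + inorm V y"
proof (rule power2_le_imp_le)
  show "(inorm V (x \<oplus> y))\<^sup>2 \<le> (inorm V x + inorm V y)\<^sup>2"
    using Cauchy_Schwarz[of x y]
    by (simp add: inorm_sq power2_sum iprod_simps iprod_commute[of y x])
qed (simp add: inorm_nonneg)

lemma idist_sq:
  "\<lbrakk>x \<in> carrier V; y \<in> carrier V\<rbrakk>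
    \<Longrightarrow> (idist V x y)\<^sup>2 = iprod V x x - 2 * iprod V x y + iprod V y y"
  by (simp add: idist_def inorm_sq iprod_simps iprod_commute[of y x])

lemma Metric_space_idist: "Metric_space (carrier V) (idist V)"
proof
  fix x y z
  show nn: "0 \<le> idist V x y" for x y by (simp add: idist_def inorm_nonneg)
  show "idist V x y = idist V y x"
  proof (cases "x \<in> carrier V \<and> y \<in> carrier V")
    case True
    then have "(idist V x y)\<^sup>2 = (idist V y x)\<^sup>2"
      by (simp add: idist_sq iprod_commute[of y x])
    then show ?thesis using nn by (metis power2_eq_iff_nonneg)
  qed (auto simp: idist_def)
  {
    assume x: "x \<in> carrier V" and y: "y \<in> carrier V"
    show "idist V x y = 0 \<longleftrightarrow> x = y"
    proof
      assume "idist V x y = 0"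
      then have "iprod V (x \<ominus> y) (x \<ominus> y) = 0"
        using x y by (simp add: idist_def inorm_def)
      then have "x \<ominus> y = \<zero>" using x y by (simp add: iprod_definite)
      moreover have "(x \<ominus> y) \<oplus> y = x"
        using x y by (simp add: a_minus_def M.a_assoc M.l_neg)
      ultimately show "x = y" using y by simp
    next
      assume "x = y"
      then show "idist V x y = 0" using x y by (simp add: idist_def inorm_def iprod_minus_left)
    qed
    assume z: "z \<in> carrier V"
    have "x \<ominus> z = (x \<ominus> y) \<oplus> (y \<ominus> z)"
    proof -
      have "(x \<ominus> y) \<oplus> (y \<ominus> z) = x \<oplus> ((\<ominus> y \<oplus> y) \<oplus> \<ominus> z)"
        using x y z by (simp add: a_minus_def M.a_assoc)
      then show ?thesis using x y z by (simp add: M.l_neg a_minus_def)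
    qed
    then show "idist V x z \<le> idist V x y + idist V y z"
      using x y z inorm_triangle[of "x \<ominus> y" "y \<ominus> z"] by (simp add: idist_def)
  }
qed

end

sublocale inner_product_space \<subseteq> ms: Metric_space "carrier V" "idist V"
  by (rule Metric_space_idist)

locale hilbert_space = inner_product_space +
  assumes complete: "ms.mcomplete"

section \<open>Relative Property T\<close>

text \<open>An action by isometries; linearity or affineness is not required.\<close>

definition isometric_action ::
    "('a, 'n) monoid_scheme \<Rightarrow> ('v, 'm) inner_space_scheme \<Rightarrow> ('a \<Rightarrow> 'v \<Rightarrow> 'v) \<Rightarrow> bool"
  where "isometric_action \<Gamma> V \<alpha> \<longleftrightarrow>
    group_action \<Gamma> (carrier V) \<alpha> \<and>
    (\<forall>\<gamma>\<in>carrier \<Gamma>. \<forall>x\<in>carrier V. \<forall>y\<in>carrier V. idist V (\<alpha> \<gamma> x) (\<alpha> \<gamma> y) = idist V x y)"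

definition rel_property_T_on ::
    "'v itself \<Rightarrow> ('a, 'n) monoid_scheme \<Rightarrow> 'a set \<Rightarrow> bool"
  where "rel_property_T_on _ \<Gamma> S \<longleftrightarrow>
    (\<forall>(V :: 'v inner_space) \<alpha>. hilbert_space V \<and> isometric_action \<Gamma> V \<alpha> \<longrightarrow>
      Metric_space.mbounded (carrier V) (idist V) {\<alpha> \<gamma> \<zero>\<^bsub>V\<^esub> | \<gamma>. \<gamma> \<in> S})"

text \<open>HOL cannot quantify over all types inside a definition, so the Hilbert spaces range over
  those with points of type \<^typ>\<open>nat \<Rightarrow> real\<close> (arbitrary carrier and operations), which
  include isomorphic copies of all separable ones.  For countable groups this loses nothing:
  the theorem \<open>rel_property_T_all_hilbert_spaces\<close> below shows that the same boundedness then
  holds for Hilbert spaces with points of any type.\<close>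

definition rel_property_T :: "('a, 'n) monoid_scheme \<Rightarrow> 'a set \<Rightarrow> bool"
  where "rel_property_T \<Gamma> S \<longleftrightarrow> rel_property_T_on TYPE(nat \<Rightarrow> real) \<Gamma> S"

context inner_product_space
begin

lemma minus_add_cancel: "\<lbrakk>x \<in> carrier V; y \<in> carrier V\<rbrakk> \<Longrightarrow> y \<oplus> (x \<ominus> y) = x"
  by (simp add: a_minus_def M.a_lcomm[of y x] M.r_neg)

lemma isometry_affine:
  assumes f: "\<And>x. x \<in> carrier V \<Longrightarrow> f x \<in> carrier V"
    and iso: "\<And>x y. \<lbrakk>x \<in> carrier V; y \<in> carrier V\<rbrakk> \<Longrightarrow> idist V (f x) (f y) = idist V x y"
    and [simp]: "x \<in> carrier V" "y \<in> carrier V"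
  shows "f (a \<odot> x \<oplus> b \<odot> y) = f \<zero> \<oplus> (a \<odot> (f x \<ominus> f \<zero>) \<oplus> b \<odot> (f y \<ominus> f \<zero>))"
proof -
  note [simp] = f
  define u where "u z = f z \<ominus> f \<zero>" for z
  have u [simp]: "u z \<in> carrier V" if "z \<in> carrier V" for z
    using that by (simp add: u_def)
  have ip: "iprod V (u z) (u w) = iprod V z w"
    if [simp]: "z \<in> carrier V" "w \<in> carrier V" for z w
  proof -
    have "(idist V (f z) (f w))\<^sup>2 = (idist V z w)\<^sup>2" "(idist V (f z) (f \<zero>))\<^sup>2 = (idist V z \<zero>)\<^sup>2"
      "(idist V (f w) (f \<zero>))\<^sup>2 = (idist V w \<zero>)\<^sup>2"
      by (simp_all add: iso)
    then show ?thesis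
      by (simp add: idist_sq u_def iprod_simps iprod_commute[of "f \<zero>" "f w"])
  qed
  define z where "z = a \<odot> x \<oplus> b \<odot> y"
  have z [simp]: "z \<in> carrier V" by (simp add: z_def)
  have ipz: "iprod V z w = a * iprod V x w + b * iprod V y w"
      "iprod V w z = a * iprod V w x + b * iprod V w y" if "w \<in> carrier V" for w
    using that by (simp_all add: z_def iprod_simps)
  define r where "r = a \<odot> u x \<oplus> b \<odot> u y"
  have r [simp]: "r \<in> carrier V" by (simp add: r_def)
  have "iprod V (u z \<ominus> r) (u z \<ominus> r) = 0"
    by (simp add: r_def iprod_simps ip ipz algebra_simps)
  then have "u z \<ominus> r = \<zero>" by (simp add: iprod_definite)
  then have "u z = r" using minus_add_cancel[of "u z" r] by simp
  then have "f z = f \<zero> \<oplus> r" using minus_add_cancel[of "f z" "f \<zero>"] by (simp add: u_def)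
  then show ?thesis by (simp add: z_def r_def u_def)
qed

lemma idist_add:
  assumes [simp]: "x \<in> carrier V" "y \<in> carrier V" "x' \<in> carrier V" "y' \<in> carrier V"
  shows "idist V (x \<oplus> y) (x' \<oplus> y') \<le> idist V x x' + idist V y y'"
proof -
  have "(x \<oplus> y) \<ominus> (x' \<oplus> y') = (x \<ominus> x') \<oplus> (y \<ominus> y')"
    by (simp add: a_minus_def M.minus_add M.a_ac)
  then show ?thesis
    using inorm_triangle[of "x \<ominus> x'" "y \<ominus> y'"] by (simp add: idist_def)
qed

lemma idist_smult:
  assumes [simp]: "x \<in> carrier V" "x' \<in> carrier V"
  shows "idist V (a \<odot> x) (a \<odot> x') = \<bar>a\<bar> * idist V x x'"
proof -
  have "(idist V (a \<odot> x) (a \<odot> x'))\<^sup>2 = (\<bar>a\<bar> * idist V x x')\<^sup>2"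
    by (simp add: idist_sq power_mult_distrib iprod_simps) (simp add: algebra_simps power2_eq_square)
  then show ?thesis by (simp add: power2_eq_iff_nonneg)
qed

lemma idist_smult_coeff:
  assumes [simp]: "x \<in> carrier V"
  shows "idist V (a \<odot> x) (b \<odot> x) = \<bar>a - b\<bar> * inorm V x"
proof -
  have "(idist V (a \<odot> x) (b \<odot> x))\<^sup>2 = (\<bar>a - b\<bar> * inorm V x)\<^sup>2"
    by (simp add: idist_sq power_mult_distrib iprod_simps inorm_sq)
       (simp add: algebra_simps power2_eq_square)
  then show ?thesis by (simp add: power2_eq_iff_nonneg inorm_nonneg)
qed

end

text \<open>The structure carried over to \<open>f ` W\<close> along an injection \<open>f\<close>, for a
  subspace \<open>W\<close> of \<open>V\<close>.\<close>

definition transport_space ::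
    "('v, 'm) inner_space_scheme \<Rightarrow> 'v set \<Rightarrow> ('v \<Rightarrow> 'u) \<Rightarrow> 'u inner_space"
  where "transport_space V W f = (let g = inv_into W f in
    \<lparr>carrier = f ` W, monoid.mult = (\<lambda>_ _. undefined), one = undefined,
     zero = f \<zero>\<^bsub>V\<^esub>, add = (\<lambda>p q. f (g p \<oplus>\<^bsub>V\<^esub> g q)),
     module.smult = (\<lambda>a p. f (a \<odot>\<^bsub>V\<^esub> g p)), iprod = (\<lambda>p q. iprod V (g p) (g q))\<rparr>)"

lemma (in hilbert_space) transport_space:
  fixes f :: "'a \<Rightarrow> 'u"
  assumes W: "W \<subseteq> carrier V" and W0: "\<zero> \<in> W"
    and Wadd: "\<And>x y. \<lbrakk>x \<in> W; y \<in> W\<rbrakk> \<Longrightarrow> x \<oplus> y \<in> W"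
    and Wsmult: "\<And>a x. x \<in> W \<Longrightarrow> a \<odot> x \<in> W"
    and Wclosed: "\<And>x. \<lbrakk>x \<in> carrier V; \<And>e. 0 < e \<Longrightarrow> \<exists>y\<in>W. idist V x y < e\<rbrakk> \<Longrightarrow> x \<in> W"
    and inj: "inj_on f W"
  shows "hilbert_space (transport_space V W f)"
    and "\<And>x y. \<lbrakk>x \<in> W; y \<in> W\<rbrakk> \<Longrightarrow> idist (transport_space V W f) (f x) (f y) = idist V x y"
proof -
  let ?V = "transport_space V W f"
  have g [simp]: "inv_into W f (f x) = x" if "x \<in> W" for x
    using that inj by simp
  have Wc [simp]: "x \<in> carrier V" if "x \<in> W" for x using that W by auto
  note [simp] = W0 Wadd Wsmult
  have [simp]: "carrier ?V = f ` W" "zero ?V = f \<zero>"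
    by (simp_all add: transport_space_def Let_def)
  have [simp]: "f x \<oplus>\<^bsub>?V\<^esub> f y = f (x \<oplus> y)" "a \<odot>\<^bsub>?V\<^esub> f x = f (a \<odot> x)"
    "iprod ?V (f x) (f y) = iprod V x y" if "x \<in> W" "y \<in> W" for x y a
    using that by (simp_all add: transport_space_def Let_def)
  have neg: "(-1) \<odot> x \<oplus> x = \<zero>" if "x \<in> W" for x
    using that smult_l_distr[of "-1" 1 x] smult_one[of x] smult_l_null[of x]
    by (simp add: real_ring_def)
  have ag: "abelian_group ?V"
  proof (rule abelian_groupI)
    fix p assume "p \<in> carrier ?V"
    then obtain x where "x \<in> W" "p = f x" by auto
    then show "\<exists>q\<in>carrier ?V. q \<oplus>\<^bsub>?V\<^esub> p = \<zero>\<^bsub>?V\<^esub>"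
      by (intro bexI[of _ "f ((-1) \<odot> x)"]) (auto simp: neg)
  qed (auto simp: M.a_ac)
  have mod: "module real_ring ?V"
  proof (rule moduleI)
    show "cring real_ring" by (rule cring_real_ring)
  qed (use ag in \<open>auto simp: smult_l_distr smult_r_distr smult_assoc1\<close>)
  interpret I: inner_product_space ?V
    by (intro inner_product_space.intro mod inner_product_space_axioms.intro)
       (auto simp: iprod_simps iprod_nonneg iprod_commute intro!: arg_cong[of _ _ f] iprod_definite)
  show dist: "idist ?V (f x) (f y) = idist V x y" if "x \<in> W" "y \<in> W" for x y
  proof -
    have "(idist ?V (f x) (f y))\<^sup>2 = (idist V x y)\<^sup>2"
      using that by (subst I.idist_sq) (auto simp: idist_sq)
    then show ?thesis by (simp add: power2_eq_iff_nonneg)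
  qed
  have "I.ms.mcomplete"
    unfolding I.ms.mcomplete_def
  proof (intro allI impI)
    fix \<sigma> assume \<sigma>: "I.ms.MCauchy \<sigma>"
    then have "\<forall>n. \<exists>x\<in>W. \<sigma> n = f x" unfolding I.ms.MCauchy_def
      by (auto simp: image_subset_iff image_iff)
    then obtain \<tau> where \<tau>: "\<And>n. \<tau> n \<in> W" "\<And>n. \<sigma> n = f (\<tau> n)" by metis
    have "ms.MCauchy \<tau>"
      using \<sigma> \<tau> unfolding ms.MCauchy_def I.ms.MCauchy_def by (auto simp: dist)
    then obtain x where "limitin ms.mtopology \<tau> x sequentially"
      using complete ms.mcomplete_def by blast
    then have x: "x \<in> carrier V" and
      lim: "\<And>e. 0 < e \<Longrightarrow> \<forall>\<^sub>F n in sequentially. idist V (\<tau> n) x < e"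
      unfolding ms.limitin_metric by (auto elim: eventually_mono)
    have "x \<in> W"
    proof (rule Wclosed[OF x])
      fix e :: real assume "0 < e"
      then obtain n where "idist V (\<tau> n) x < e"
        using lim eventually_happens[OF lim] by fastforce
      then show "\<exists>y\<in>W. idist V x y < e" using \<tau> by (metis ms.commute)
    qed
    then show "\<exists>p. limitin I.ms.mtopology \<sigma> p sequentially"
      unfolding I.ms.limitin_metric using lim \<tau> by (intro exI[of _ "f x"]) (auto simp: dist)
  qed
  then show "hilbert_space ?V"
    by (intro hilbert_space.intro hilbert_space_axioms.intro I.inner_product_space_axioms)
qed

theorem rel_property_T_all_hilbert_spaces:
  fixes \<Gamma> :: "('a, 'n) monoid_scheme"
  assumes \<Gamma>: "group \<Gamma>" "countable (carrier \<Gamma>)" and S: "S \<subseteq> carrier \<Gamma>"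
    and T: "rel_property_T \<Gamma> S"
  shows "rel_property_T_on TYPE('v) \<Gamma> S"
  unfolding rel_property_T_on_def
proof (intro allI impI, elim conjE)
  fix V :: "'v inner_space" and \<alpha>
  assume "hilbert_space V" and \<alpha>: "isometric_action \<Gamma> V \<alpha>"
  then interpret hilbert_space V by simp
  interpret \<Gamma>: group \<Gamma> by fact
  interpret act: group_action \<Gamma> "carrier V" \<alpha>
    using \<alpha> by (simp add: isometric_action_def)
  have act [simp]: "\<alpha> \<gamma> x \<in> carrier V" if "\<gamma> \<in> carrier \<Gamma>" "x \<in> carrier V" for \<gamma> x
    using act.element_image that by blast
  have iso: "idist V (\<alpha> \<gamma> x) (\<alpha> \<gamma> y) = idist V x y"
    if "\<gamma> \<in> carrier \<Gamma>" "x \<in> carrier V" "y \<in> carrier V" for \<gamma> x y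
    using \<alpha> that by (simp add: isometric_action_def)

  define E where "E = rec_nat ((\<lambda>\<gamma>. \<alpha> \<gamma> \<zero>\<^bsub>V\<^esub>) ` carrier \<Gamma>)
    (\<lambda>_ A. (\<lambda>(q, r, x, y). of_rat q \<odot>\<^bsub>V\<^esub> x \<oplus>\<^bsub>V\<^esub> of_rat r \<odot>\<^bsub>V\<^esub> y) ` (UNIV \<times> UNIV \<times> A \<times> A))"
  have E0: "E 0 = (\<lambda>\<gamma>. \<alpha> \<gamma> \<zero>\<^bsub>V\<^esub>) ` carrier \<Gamma>" by (simp add: E_def)
  have ES: "E (Suc n) = (\<lambda>(q, r, x, y). of_rat q \<odot>\<^bsub>V\<^esub> x \<oplus>\<^bsub>V\<^esub> of_rat r \<odot>\<^bsub>V\<^esub> y)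
    ` (UNIV \<times> UNIV \<times> E n \<times> E n)" for n by (simp add: E_def)
  define D where "D = (\<Union>n. E n)"
  have "countable (E n)" for n
    by (induction n) (auto simp: E0 ES \<Gamma> intro!: countable_image countable_SIGMA)
  then have cD: "countable D" by (simp add: D_def)
  have Ec: "E n \<subseteq> carrier V" for n
    by (induction n) (auto simp: E0 ES)
  then have Dc: "x \<in> carrier V" if "x \<in> D" for x
    using that by (auto simp: D_def)
  have one_smult [simp]: "1 \<odot>\<^bsub>V\<^esub> x = x" if "x \<in> carrier V" for x
    using that smult_one[of x] by (simp add: real_ring_def)
  have zero_smult [simp]: "0 \<odot>\<^bsub>V\<^esub> x = \<zero>\<^bsub>V\<^esub>" if "x \<in> carrier V" for x
    using that smult_l_null[of x] by (simp add: real_ring_def)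
  have neg_smult: "(-1) \<odot>\<^bsub>V\<^esub> x = \<ominus>\<^bsub>V\<^esub> x" if "x \<in> carrier V" for x
    using that smult_l_minus[of 1 x] cring_real_ring
      smult_l_distr[of "-1" 1 x]
    by (intro M.minus_equality[symmetric]) (simp_all add: real_ring_def)
  have Estep: "of_rat q \<odot>\<^bsub>V\<^esub> x \<oplus>\<^bsub>V\<^esub> of_rat r \<odot>\<^bsub>V\<^esub> y \<in> E (Suc n)"
    if "x \<in> E n" "y \<in> E n" for q r x y n
    unfolding ES using that by force
  have Emono: "E n \<subseteq> E (Suc n)" for n
  proof
    fix x assume "x \<in> E n"
    then show "x \<in> E (Suc n)"
      using Estep[of x n x 1 0] Ec[of n] by (auto simp: subset_iff)
  qed
  have Dcomb: "of_rat q \<odot>\<^bsub>V\<^esub> x \<oplus>\<^bsub>V\<^esub> of_rat r \<odot>\<^bsub>V\<^esub> y \<in> D" if "x \<in> D" "y \<in> D" for q r x y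
  proof -
    obtain m n where "x \<in> E m" "y \<in> E n" using \<open>x \<in> D\<close> \<open>y \<in> D\<close> by (auto simp: D_def)
    then have "x \<in> E (max m n)" "y \<in> E (max m n)"
      using lift_Suc_mono_le[of E, OF Emono] by (meson max.cobounded1 max.cobounded2 subsetD)+
    then show ?thesis unfolding D_def using Estep by blast
  qed
  have Dadd: "x \<oplus>\<^bsub>V\<^esub> y \<in> D" if "x \<in> D" "y \<in> D" for x y
    using Dcomb[OF that, of 1 1] that by (simp add: Dc)
  have Dminus: "x \<ominus>\<^bsub>V\<^esub> y \<in> D" if "x \<in> D" "y \<in> D" for x y
    using Dcomb[OF that, of 1 "-1"] that by (simp add: Dc neg_smult a_minus_def of_rat_minus)
  have Dsmult: "of_rat q \<odot>\<^bsub>V\<^esub> x \<in> D" if "x \<in> D" for x q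
    using Dcomb[OF that that, of q 0] that by (simp add: Dc)
  have orbD: "\<alpha> \<gamma> \<zero>\<^bsub>V\<^esub> \<in> D" if "\<gamma> \<in> carrier \<Gamma>" for \<gamma>
    using that unfolding D_def by (intro UN_I[of 0]) (auto simp: E0)
  have D0: "\<zero>\<^bsub>V\<^esub> \<in> D"
    using Dsmult[OF orbD[OF \<Gamma>.one_closed], of 0] by simp
  have Dinv: "\<alpha> \<gamma> x \<in> D" if \<gamma>: "\<gamma> \<in> carrier \<Gamma>" and "x \<in> D" for \<gamma> x
  proof -
    have "\<alpha> \<gamma> x \<in> D" if "x \<in> E n" for n x
      using that
    proof (induction n arbitrary: x)
      case 0
      then obtain \<delta> where \<delta>: "\<delta> \<in> carrier \<Gamma>" "x = \<alpha> \<delta> \<zero>\<^bsub>V\<^esub>" by (auto simp: E0)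
      then have "\<alpha> \<gamma> x = \<alpha> (\<gamma> \<otimes>\<^bsub>\<Gamma>\<^esub> \<delta>) \<zero>\<^bsub>V\<^esub>"
        using \<gamma> by (simp add: act.composition_rule)
      then show ?case using \<gamma> \<delta> orbD by simp
    next
      case (Suc n)
      then obtain q r y z where yz: "y \<in> E n" "z \<in> E n"
        and x: "x = of_rat q \<odot>\<^bsub>V\<^esub> y \<oplus>\<^bsub>V\<^esub> of_rat r \<odot>\<^bsub>V\<^esub> z" by (auto simp: ES)
      have "y \<in> carrier V" "z \<in> carrier V" using yz Ec by auto
      then have "\<alpha> \<gamma> x = \<alpha> \<gamma> \<zero>\<^bsub>V\<^esub> \<oplus>\<^bsub>V\<^esub> (of_rat q \<odot>\<^bsub>V\<^esub> (\<alpha> \<gamma> y \<ominus>\<^bsub>V\<^esub> \<alpha> \<gamma> \<zero>\<^bsub>V\<^esub>)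
          \<oplus>\<^bsub>V\<^esub> of_rat r \<odot>\<^bsub>V\<^esub> (\<alpha> \<gamma> z \<ominus>\<^bsub>V\<^esub> \<alpha> \<gamma> \<zero>\<^bsub>V\<^esub>))"
        unfolding x using \<gamma> by (intro isometry_affine) (auto simp: iso)
      then show ?case
        using Suc.IH yz \<gamma> orbD by (simp add: Dadd Dcomb Dminus)
    qed
    then show ?thesis using \<open>x \<in> D\<close> by (auto simp: D_def)
  qed

  define W where "W = {x \<in> carrier V. \<forall>e>0. \<exists>d\<in>D. idist V x d < e}"
  have Wc: "x \<in> carrier V" if "x \<in> W" for x using that by (simp add: W_def)
  have WD: "\<exists>d\<in>D. idist V x d < e" if "x \<in> W" "0 < e" for x e
    using that by (simp add: W_def)
  have DW: "x \<in> W" if "x \<in> D" for x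
    using that Dc by (auto simp: W_def intro!: bexI[of _ x])
  have Wadd: "x \<oplus>\<^bsub>V\<^esub> y \<in> W" if "x \<in> W" "y \<in> W" for x y
    unfolding W_def
  proof (intro CollectI conjI allI impI)
    fix e :: real assume "0 < e"
    then have "0 < e / 2" by simp
    then obtain d d' where "d \<in> D" "idist V x d < e / 2" "d' \<in> D" "idist V y d' < e / 2"
      using WD \<open>x \<in> W\<close> \<open>y \<in> W\<close> by meson
    then show "\<exists>d\<in>D. idist V (x \<oplus>\<^bsub>V\<^esub> y) d < e"
      using idist_add[of x y d d'] that
      by (intro bexI[of _ "d \<oplus>\<^bsub>V\<^esub> d'"]) (auto simp: Dc Wc Dadd)
  qed (use that Wc in simp)
  have Wsmult: "a \<odot>\<^bsub>V\<^esub> x \<in> W" if "x \<in> W" for a x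
    unfolding W_def
  proof (intro CollectI conjI allI impI)
    have x [simp]: "x \<in> carrier V" using that Wc by simp
    fix e :: real assume "0 < e"
    define N where "N = inorm V x + 1"
    have N: "0 < N" using inorm_nonneg[OF x] by (simp add: N_def)
    define \<delta> where "\<delta> = min 1 (e / (2 * N))"
    have \<delta>: "0 < \<delta>" using N \<open>0 < e\<close> by (simp add: \<delta>_def)
    obtain q where q: "a < of_rat q" "of_rat q < a + \<delta>"
      using of_rat_dense[of a "a + \<delta>"] \<delta> by auto
    have "0 < e / (2 * (\<bar>a\<bar> + 1))" using \<open>0 < e\<close> by simp
    then obtain d where d: "d \<in> D" "idist V x d < e / (2 * (\<bar>a\<bar> + 1))"
      using WD[OF \<open>x \<in> W\<close>] by blast
    have dc [simp]: "d \<in> carrier V" using d Dc by simp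
    have "idist V (a \<odot>\<^bsub>V\<^esub> x) (of_rat q \<odot>\<^bsub>V\<^esub> d)
      \<le> idist V (a \<odot>\<^bsub>V\<^esub> x) (of_rat q \<odot>\<^bsub>V\<^esub> x) + idist V (of_rat q \<odot>\<^bsub>V\<^esub> x) (of_rat q \<odot>\<^bsub>V\<^esub> d)"
      by (rule ms.triangle) auto
    also have "\<dots> = \<bar>a - of_rat q\<bar> * inorm V x + \<bar>of_rat q\<bar> * idist V x d"
      by (simp add: idist_smult idist_smult_coeff)
    also have "\<bar>a - of_rat q\<bar> * inorm V x \<le> (e / (2 * N)) * N"
      using q N inorm_nonneg[OF x] \<open>0 < e\<close> by (intro mult_mono) (auto simp: \<delta>_def N_def)
    also have "\<dots> = e / 2" using N by simp
    also have "\<bar>of_rat q\<bar> * idist V x d \<le> (\<bar>a\<bar> + 1) * idist V x d"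
    proof (rule mult_right_mono)
      have "\<delta> \<le> 1" by (simp add: \<delta>_def)
      then show "\<bar>of_rat q\<bar> \<le> \<bar>a\<bar> + 1" using q by linarith
    qed simp
    also have "(\<bar>a\<bar> + 1) * idist V x d < e / 2"
      using d(2) by (simp add: field_simps)
    finally have "idist V (a \<odot>\<^bsub>V\<^esub> x) (of_rat q \<odot>\<^bsub>V\<^esub> d) < e" by simp
    then show "\<exists>d\<in>D. idist V (a \<odot>\<^bsub>V\<^esub> x) d < e"
      using Dsmult[OF d(1)] by blast
  qed (use that Wc in simp)
  have Wclosed: "x \<in> W" if x: "x \<in> carrier V" "\<And>e. 0 < e \<Longrightarrow> \<exists>y\<in>W. idist V x y < e" for x
    unfolding W_def
  proof (intro CollectI conjI allI impI)
    fix e :: real assume "0 < e"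
    then have e: "0 < e / 2" by simp
    obtain y where y: "y \<in> W" "idist V x y < e / 2" using x(2)[OF e] by blast
    obtain d where "d \<in> D" "idist V y d < e / 2" using WD[OF y(1) e] by blast
    then show "\<exists>d\<in>D. idist V x d < e"
      using y ms.triangle[of x y d] x(1) by (intro bexI[of _ d]) (auto simp: Dc Wc)
  qed (use x in simp)
  have Winv: "\<alpha> \<gamma> x \<in> W" if "\<gamma> \<in> carrier \<Gamma>" "x \<in> W" for \<gamma> x
    unfolding W_def
  proof (intro CollectI conjI allI impI)
    fix e :: real assume "0 < e"
    then obtain d where "d \<in> D" "idist V x d < e" using WD[OF \<open>x \<in> W\<close>] by blast
    then show "\<exists>d\<in>D. idist V (\<alpha> \<gamma> x) d < e"
      using that by (intro bexI[of _ "\<alpha> \<gamma> d"]) (auto simp: iso Dinv Dc Wc)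
  qed (use that Wc in simp)

  define f :: "'v \<Rightarrow> nat \<Rightarrow> real" where "f x n = idist V x (from_nat_into D n)" for x n
  have inj: "inj_on f W"
  proof (rule inj_onI)
    fix x y assume xy: "x \<in> W" "y \<in> W" "f x = f y"
    have "idist V x y < e" if "0 < e" for e
    proof -
      from that obtain d where d: "d \<in> D" "idist V x d < e / 2"
        using WD[OF xy(1), of "e / 2"] by auto
      then obtain n where "d = from_nat_into D n"
        using cD from_nat_into_surj by metis
      then have "idist V y d < e / 2" using d fun_cong[OF xy(3), of n] by (simp add: f_def)
      then show ?thesis
        using d ms.triangle'[of x d y] xy Wc Dc by force
    qed
    then have "idist V x y = 0"
      by (metis ms.nonneg less_irrefl less_le)
    then show "x = y" using xy Wc by simp
  qed
  define V' where "V' = transport_space V W f"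
  have V': "hilbert_space V'" and
    dist: "\<And>x y. \<lbrakk>x \<in> W; y \<in> W\<rbrakk> \<Longrightarrow> idist V' (f x) (f y) = idist V x y"
    unfolding V'_def
    by (rule transport_space; use Wc DW D0 Wadd Wsmult Wclosed inj in blast)+
  interpret V': hilbert_space V' by (rule V')
  have cV': "carrier V' = f ` W" and zV': "zero V' = f \<zero>\<^bsub>V\<^esub>"
    by (simp_all add: V'_def transport_space_def Let_def)
  define \<beta> where "\<beta> \<gamma> = (\<lambda>p\<in>f ` W. f (\<alpha> \<gamma> (inv_into W f p)))" for \<gamma>
  have \<beta>: "\<beta> \<gamma> (f x) = f (\<alpha> \<gamma> x)" if "x \<in> W" for \<gamma> x
    using that inj by (simp add: \<beta>_def)
  have comp: "\<beta> (\<gamma> \<otimes>\<^bsub>\<Gamma>\<^esub> \<delta>) p = \<beta> \<gamma> (\<beta> \<delta> p)"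
    if "\<gamma> \<in> carrier \<Gamma>" "\<delta> \<in> carrier \<Gamma>" "p \<in> f ` W" for \<gamma> \<delta> p
    using that by (auto simp: \<beta> Winv Wc act.composition_rule)
  have \<beta>1: "\<beta> \<one>\<^bsub>\<Gamma>\<^esub> p = p" if "p \<in> f ` W" for p
    using that act.id_eq_one by (auto simp: \<beta> Wc simp flip: act.id_eq_one)
  have \<beta>W: "\<beta> \<gamma> p \<in> f ` W" if "\<gamma> \<in> carrier \<Gamma>" "p \<in> f ` W" for \<gamma> p
    using that by (auto simp: \<beta> Winv)
  have Bij: "\<beta> \<gamma> \<in> Bij (f ` W)" if \<gamma>: "\<gamma> \<in> carrier \<Gamma>" for \<gamma>
  proof -
    have "bij_betw (\<beta> \<gamma>) (f ` W) (f ` W)"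
      using \<gamma> comp[of "inv\<^bsub>\<Gamma>\<^esub> \<gamma>" \<gamma>] comp[of \<gamma> "inv\<^bsub>\<Gamma>\<^esub> \<gamma>"] \<beta>1 \<beta>W
      by (intro bij_betw_byWitness[where f' = "\<beta> (inv\<^bsub>\<Gamma>\<^esub> \<gamma>)"]) auto
    then show ?thesis by (simp add: Bij_def \<beta>_def)
  qed
  have "\<beta> (\<gamma> \<otimes>\<^bsub>\<Gamma>\<^esub> \<delta>) = compose (f ` W) (\<beta> \<gamma>) (\<beta> \<delta>)"
    if "\<gamma> \<in> carrier \<Gamma>" "\<delta> \<in> carrier \<Gamma>" for \<gamma> \<delta>
  proof
    fix p show "\<beta> (\<gamma> \<otimes>\<^bsub>\<Gamma>\<^esub> \<delta>) p = compose (f ` W) (\<beta> \<gamma>) (\<beta> \<delta>) p"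
      by (cases "p \<in> f ` W") (use that comp in \<open>auto simp: compose_def \<beta>_def\<close>)
  qed
  then have "group_hom \<Gamma> (BijGroup (f ` W)) \<beta>"
    using Bij
    by (intro group_hom.intro \<Gamma> group_BijGroup group_hom_axioms.intro homI)
       (auto simp: BijGroup_def)
  then have "group_action \<Gamma> (carrier V') \<beta>"
    by (simp add: group_action_def cV')
  then have "isometric_action \<Gamma> V' \<beta>"
    by (auto simp: isometric_action_def cV' \<beta> dist Winv iso Wc)
  then have "V'.ms.mbounded {\<beta> \<gamma> \<zero>\<^bsub>V'\<^esub> | \<gamma>. \<gamma> \<in> S}"
    using T V' unfolding rel_property_T_def rel_property_T_on_def by blast
  then obtain B where B: "\<And>\<gamma> \<delta>. \<lbrakk>\<gamma> \<in> S; \<delta> \<in> S\<rbrakk> \<Longrightarrow> idist V' (\<beta> \<gamma> \<zero>\<^bsub>V'\<^esub>) (\<beta> \<delta> \<zero>\<^bsub>V'\<^esub>) \<le> B"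
    unfolding V'.ms.mbounded_alt by blast
  have "idist V (\<alpha> \<gamma> \<zero>\<^bsub>V\<^esub>) (\<alpha> \<delta> \<zero>\<^bsub>V\<^esub>) \<le> B" if "\<gamma> \<in> S" "\<delta> \<in> S" for \<gamma> \<delta>
    using B[OF that] that S DW[OF D0] DW[OF orbD] by (simp add: zV' \<beta> dist subset_iff)
  then show "ms.mbounded {\<alpha> \<gamma> \<zero>\<^bsub>V\<^esub> | \<gamma>. \<gamma> \<in> S}"
    unfolding ms.mbounded_alt using S by (auto simp: subset_iff intro!: exI[of _ B])
qed

section \<open>Standard wreath products\<close>

text \<open>The group of finitely supported functions from G to H.\<close>

abbreviation base_group ::
    "('h, 'm) monoid_scheme \<Rightarrow> ('g, 'n) monoid_scheme \<Rightarrow> ('g \<Rightarrow> 'h) monoid"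
  where "base_group H G \<equiv> sum_group (carrier G) (\<lambda>_. H)"

definition shift :: "('g, 'n) monoid_scheme \<Rightarrow> 'g \<Rightarrow> ('g \<Rightarrow> 'h) \<Rightarrow> 'g \<Rightarrow> 'h"
  where "shift G g w = (\<lambda>x\<in>carrier G. w (inv\<^bsub>G\<^esub> g \<otimes>\<^bsub>G\<^esub> x))"

definition wreath_product ::
    "('h, 'm) monoid_scheme \<Rightarrow> ('g, 'n) monoid_scheme \<Rightarrow> (('g \<Rightarrow> 'h) \<times> 'g) monoid"
  where "wreath_product H G =
    \<lparr>carrier = carrier (base_group H G) \<times> carrier G,
     monoid.mult = (\<lambda>(w, g) (w', g').
       (w \<otimes>\<^bsub>base_group H G\<^esub> shift G g w', g \<otimes>\<^bsub>G\<^esub> g')),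
     one = (\<one>\<^bsub>base_group H G\<^esub>, \<one>\<^bsub>G\<^esub>)\<rparr>"

definition Supp ::
    "('h, 'm) monoid_scheme \<Rightarrow> ('g, 'n) monoid_scheme \<Rightarrow> ('g \<Rightarrow> 'h) \<Rightarrow> 'g set"
  where "Supp H G w = {g \<in> carrier G. w g \<noteq> \<one>\<^bsub>H\<^esub>}"

definition supported_power ::
    "('h, 'm) monoid_scheme \<Rightarrow> ('g, 'n) monoid_scheme \<Rightarrow> 'h set \<Rightarrow> 'g set \<Rightarrow> ('g \<Rightarrow> 'h) set"
  where "supported_power H G Y Z =
    {w \<in> carrier (base_group H G). Supp H G w \<subseteq> Z \<and> (\<forall>z\<in>Z. w z \<in> Y)}"

lemma carrier_base_group:
  assumes "group H"
  shows "w \<in> carrier (base_group H G) \<longleftrightarrow> w \<in> carrier G \<rightarrow>\<^sub>E carrier H \<and> finite (Supp H G w)"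
  using assms by (simp add: carrier_sum_group Supp_def)

lemma shift_base_group:
  assumes "group H" "group G" and w: "w \<in> carrier (base_group H G)" and g: "g \<in> carrier G"
  shows "shift G g w \<in> carrier (base_group H G)"
proof -
  interpret G: group G by fact
  have "Supp H G (shift G g w) \<subseteq> (\<lambda>x. g \<otimes>\<^bsub>G\<^esub> x) ` Supp H G w"
  proof
    fix x assume "x \<in> Supp H G (shift G g w)"
    then have x: "x \<in> carrier G" "inv\<^bsub>G\<^esub> g \<otimes>\<^bsub>G\<^esub> x \<in> Supp H G w"
      using g by (auto simp: Supp_def shift_def)
    moreover have "x = g \<otimes>\<^bsub>G\<^esub> (inv\<^bsub>G\<^esub> g \<otimes>\<^bsub>G\<^esub> x)" using x g by (simp flip: G.m_assoc)
    ultimately show "x \<in> (\<lambda>x. g \<otimes>\<^bsub>G\<^esub> x) ` Supp H G w" by blast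
  qed
  then have "finite (Supp H G (shift G g w))"
    using w by (auto simp: carrier_base_group[OF \<open>group H\<close>] intro: finite_subset)
  then show ?thesis
    using w g by (auto simp: carrier_base_group[OF \<open>group H\<close>] shift_def PiE_iff)
qed

lemma group_wreath_product:
  assumes H: "group H" and G: "group G"
  shows "group (wreath_product H G)"
proof -
  interpret G: group G by fact
  interpret H: group H by fact
  interpret B: group "base_group H G" by (simp add: H)
  note [simp] = shift_base_group[OF H G]
  have shift_mult: "shift G g (w \<otimes>\<^bsub>base_group H G\<^esub> w')
      = shift G g w \<otimes>\<^bsub>base_group H G\<^esub> shift G g w'" if "g \<in> carrier G" for g w w'
    using that by (auto simp: shift_def)
  have shift_shift: "shift G g (shift G g' w) = shift G (g \<otimes>\<^bsub>G\<^esub> g') w"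
    if "g \<in> carrier G" "g' \<in> carrier G" for g g' w
    using that by (auto simp: shift_def G.inv_mult_group G.m_assoc)
  have shift_one: "shift G \<one>\<^bsub>G\<^esub> w = w" if "w \<in> carrier (base_group H G)" for w
    using that by (auto simp: carrier_base_group[OF H] shift_def PiE_iff extensional_def)
  show ?thesis
  proof (rule groupI)
    fix p assume "p \<in> carrier (wreath_product H G)"
    then obtain w g where p: "p = (w, g)" "w \<in> carrier (base_group H G)" "g \<in> carrier G"
      by (auto simp: wreath_product_def)
    define w' where "w' = inv\<^bsub>base_group H G\<^esub> (shift G (inv\<^bsub>G\<^esub> g) w)"
    have "w' \<in> carrier (base_group H G)" unfolding w'_def using p by (intro B.inv_closed) simp
    moreover have "w' \<otimes>\<^bsub>base_group H G\<^esub> shift G (inv\<^bsub>G\<^esub> g) w = \<one>\<^bsub>base_group H G\<^esub>"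
      unfolding w'_def using p by (intro B.l_inv) simp
    ultimately show "\<exists>q\<in>carrier (wreath_product H G).
        q \<otimes>\<^bsub>wreath_product H G\<^esub> p = \<one>\<^bsub>wreath_product H G\<^esub>"
      using p by (intro bexI[of _ "(w', inv\<^bsub>G\<^esub> g)"])
        (simp_all add: wreath_product_def del: mult_sum_group one_sum_group)
  qed (auto simp: wreath_product_def B.m_assoc G.m_assoc shift_mult shift_shift shift_one
      simp del: mult_sum_group one_sum_group)
qed

end

theory Submission
  imports Defs "HOL-Library.Multiset"
begin

text \<open>Relative Property T of \<open>(\<Gamma>, S)\<close> means that every left-invariant conditionally negative
  definite kernel \<open>\<psi>\<close> on \<open>\<Gamma>\<close> has \<open>\<psi> 1\<close> bounded on \<open>S\<close>: squared distances in orbits are such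
  kernels, and conversely each such kernel comes from an affine isometric action on a reproducing
  kernel Hilbert space.  So the theorem amounts to transferring kernels between \<open>H\<close>, \<open>G\<close> and
  \<open>H \<wr> G\<close>.  Summing a kernel of \<open>H\<close> over all lamps detects the lamp values and, for the discrete
  kernel on \<open>H\<close>, the number of lit lamps.  To detect the positions of the lit lamps by a kernel
  \<open>q = \<parallel>b(x) - b(y)\<parallel>\<^sup>2\<close> on \<open>G\<close>, consider the Gaussian field \<open>\<zeta> x = U + \<surd>t \<langle>b x, \<xi>\<rangle>\<close>, with \<open>U\<close>
  uniform modulo \<open>2\<pi>\<close>, and let a lit lamp at \<open>x\<close> act by \<open>cos\<^sup>2 (\<zeta> x / 2)\<close>.  The state
  concentrated on \<open>\<zeta> 1\<close> close to 0 is almost invariant as \<open>t\<close> tends to 0, but not uniformly on the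
  elements lighting a lamp at some \<open>z\<close> with \<open>q 1 z\<close> large.  As the expectations of trigonometric
  polynomials in \<open>\<zeta>\<close> are combinations of values of \<open>exp (-t E)\<close>, where \<open>E\<close> is the energy distance of
  \<open>q\<close> between finite configurations, no probability theory is needed.  Conversely, an
  element of \<open>Y\<^sup>(\<^sup>Z\<^sup>) \<times> Z\<close> with few lit lamps is a short product of conjugates of
  elements of \<open>Y\<close> by elements of \<open>Z\<close>.\<close>

subsection \<open>Positive definite and conditionally negative definite kernels\<close>

text \<open>The kernel \<open>q\<close> comes from an affine action, so only differences of the
  points \<open>b x\<close> have a meaning: a translation rotates all \<open>b x\<close> and also
  adds a common vector. The uniform phase \<open>U\<close> is there to absorb that common shift. It
  makes the law of the field invariant under \<open>G\<close>, and it makes the characters of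
  configurations of different sizes orthogonal, so that the energy is evaluated only where it is a
  squared distance. A normalised positive definite function \<open>\<phi>\<close> is bounded, and so
  is \<open>1 - \<phi>\<close>. An unbounded kernel therefore has to be a series of such differences
  over finer and finer scales of \<open>t\<close>. A lit lamp acts by multiplication with a factor
  between 0 and 1, so the drop caused by one far lamp cannot be undone by the other lamps, whatever
  their number and positions. Hence one far lamp is seen by the term of the right scale, while a
  fixed element has only a small effect on the terms of fine scale.\<close>

definition pd_kernel :: "'a set \<Rightarrow> ('a \<Rightarrow> 'a \<Rightarrow> real) \<Rightarrow> bool"
  where "pd_kernel A k \<longleftrightarrow> (\<forall>x\<in>A. \<forall>y\<in>A. k x y = k y x) \<and>
    (\<forall>F c. finite F \<and> F \<subseteq> A \<longrightarrow> 0 \<le> (\<Sum>x\<in>F. \<Sum>y\<in>F. c x * c y * k x y))"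

definition cnd_kernel :: "'a set \<Rightarrow> ('a \<Rightarrow> 'a \<Rightarrow> real) \<Rightarrow> bool"
  where "cnd_kernel A \<psi> \<longleftrightarrow> (\<forall>x\<in>A. \<forall>y\<in>A. \<psi> x y = \<psi> y x) \<and> (\<forall>x\<in>A. \<psi> x x = 0) \<and>
    (\<forall>F c. finite F \<and> F \<subseteq> A \<and> sum c F = 0 \<longrightarrow> (\<Sum>x\<in>F. \<Sum>y\<in>F. c x * c y * \<psi> x y) \<le> 0)"

lemma sum_fibres:
  fixes a g :: "_ \<Rightarrow> real"
  assumes "finite I"
  shows "(\<Sum>i\<in>I. a i * g (x i)) = (\<Sum>u\<in>x ` I. (\<Sum>i\<in>{i\<in>I. x i = u}. a i) * g u)"
  by (subst sum.image_gen[OF assms, of _ x]) (simp add: sum_distrib_right)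

text \<open>The two kernel conditions speak of finite sets of distinct points, whereas applications
  produce indexed families in which points may repeat. Adding up the coefficients over the fibres of
  \<open>x\<close> turns the latter into the former.\<close>

lemma quadratic_form_fibres:
  fixes a :: "'i \<Rightarrow> real" and x :: "'i \<Rightarrow> 'a"
  assumes "finite I"
  defines "c \<equiv> \<lambda>u. \<Sum>i\<in>{i\<in>I. x i = u}. a i"
  shows "(\<Sum>i\<in>I. \<Sum>j\<in>I. a i * a j * k (x i) (x j)) = (\<Sum>u\<in>x ` I. \<Sum>v\<in>x ` I. c u * c v * k u v)"
proof -
  have "(\<Sum>i\<in>I. \<Sum>j\<in>I. a i * a j * k (x i) (x j)) = (\<Sum>i\<in>I. a i * (\<Sum>j\<in>I. a j * k (x i) (x j)))"
    by (simp add: sum_distrib_left mult.assoc)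
  also have "\<dots> = (\<Sum>i\<in>I. a i * (\<Sum>v\<in>x ` I. c v * k (x i) v))"
    unfolding c_def by (subst sum_fibres[OF assms(1)]) simp
  also have "\<dots> = (\<Sum>u\<in>x ` I. c u * (\<Sum>v\<in>x ` I. c v * k u v))"
    unfolding c_def by (rule sum_fibres[OF assms(1)])
  finally show ?thesis by (simp add: sum_distrib_left mult.assoc)
qed

lemma pd_kernel_sym: "pd_kernel A k \<Longrightarrow> x \<in> A \<Longrightarrow> y \<in> A \<Longrightarrow> k x y = k y x"
  by (auto simp: pd_kernel_def)

lemma cnd_kernel_sym: "cnd_kernel A \<psi> \<Longrightarrow> x \<in> A \<Longrightarrow> y \<in> A \<Longrightarrow> \<psi> x y = \<psi> y x"
  by (auto simp: cnd_kernel_def)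

lemma cnd_kernel_diag: "cnd_kernel A \<psi> \<Longrightarrow> x \<in> A \<Longrightarrow> \<psi> x x = 0"
  by (auto simp: cnd_kernel_def)

lemma pd_kernelD:
  "pd_kernel A k \<Longrightarrow> finite F \<Longrightarrow> F \<subseteq> A \<Longrightarrow> 0 \<le> (\<Sum>x\<in>F. \<Sum>y\<in>F. c x * c y * k x y)"
  by (simp add: pd_kernel_def)

lemma cnd_kernelD:
  "cnd_kernel A \<psi> \<Longrightarrow> finite F \<Longrightarrow> F \<subseteq> A \<Longrightarrow> sum c F = 0 \<Longrightarrow>
    (\<Sum>x\<in>F. \<Sum>y\<in>F. c x * c y * \<psi> x y) \<le> 0"
  by (simp add: cnd_kernel_def)

lemma pd_kernel_family:
  assumes "pd_kernel A k" "finite I" "\<And>i. i \<in> I \<Longrightarrow> x i \<in> A"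
  shows "0 \<le> (\<Sum>i\<in>I. \<Sum>j\<in>I. a i * a j * k (x i) (x j))"
proof -
  have "finite (x ` I)" "x ` I \<subseteq> A" using assms by auto
  then show ?thesis
    unfolding quadratic_form_fibres[OF assms(2)] by (rule pd_kernelD[OF assms(1)])
qed

lemma cnd_kernel_family:
  assumes "cnd_kernel A \<psi>" "finite I" "\<And>i. i \<in> I \<Longrightarrow> x i \<in> A" "sum a I = 0"
  shows "(\<Sum>i\<in>I. \<Sum>j\<in>I. a i * a j * \<psi> (x i) (x j)) \<le> 0"
proof -
  have "(\<Sum>u\<in>x ` I. \<Sum>i\<in>{i\<in>I. x i = u}. a i) = 0"
    using assms(4) sum.image_gen[OF assms(2), of a x] by simp
  moreover have "finite (x ` I)" "x ` I \<subseteq> A" using assms by auto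
  ultimately show ?thesis
    unfolding quadratic_form_fibres[OF assms(2)] by (intro cnd_kernelD[OF assms(1)])
qed

lemma pd_kernel_subset: "pd_kernel A k \<Longrightarrow> B \<subseteq> A \<Longrightarrow> pd_kernel B k"
  unfolding pd_kernel_def by (meson order_trans subsetD)

lemma pd_kernel_finite:
  assumes "\<And>F. finite F \<Longrightarrow> F \<subseteq> A \<Longrightarrow> pd_kernel F k"
  shows "pd_kernel A k"
  unfolding pd_kernel_def
proof (intro conjI ballI allI impI)
  fix x y assume "x \<in> A" "y \<in> A"
  then show "k x y = k y x" using pd_kernel_sym[OF assms[of "{x, y}"]] by simp
next
  fix F and c :: "'a \<Rightarrow> real" assume "finite F \<and> F \<subseteq> A"
  then show "0 \<le> (\<Sum>x\<in>F. \<Sum>y\<in>F. c x * c y * k x y)"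
    by (intro pd_kernelD[OF assms]) auto
qed

lemma pd_kernel_cong:
  assumes "\<And>x y. x \<in> A \<Longrightarrow> y \<in> A \<Longrightarrow> k x y = k' x y"
  shows "pd_kernel A k \<longleftrightarrow> pd_kernel A k'"
proof -
  have "(\<Sum>x\<in>F. \<Sum>y\<in>F. c x * c y * k x y) = (\<Sum>x\<in>F. \<Sum>y\<in>F. c x * c y * k' x y)"
    if "F \<subseteq> A" for F and c :: "'a \<Rightarrow> real"
    using that assms by (intro sum.cong refl) (auto simp: subset_iff)
  then show ?thesis using assms unfolding pd_kernel_def by auto
qed

lemma pd_kernel_nonneg:
  assumes "pd_kernel A k" "x \<in> A"
  shows "0 \<le> k x x"
  using pd_kernel_family[OF assms(1), of "{()}" "\<lambda>_. x" "\<lambda>_. 1"] assms(2) by simp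

lemma pd_kernel_pair:
  assumes "pd_kernel A k" "x \<in> A" "y \<in> A"
  shows "0 \<le> a\<^sup>2 * k x x + 2 * a * b * k x y + b\<^sup>2 * k y y"
proof -
  have "0 \<le> (\<Sum>i\<in>UNIV. \<Sum>j\<in>UNIV. (if i then a else b) * (if j then a else b) *
      k (if i then x else y) (if j then x else y))"
    using assms by (intro pd_kernel_family) auto
  also have "\<dots> = a\<^sup>2 * k x x + 2 * a * b * k x y + b\<^sup>2 * k y y"
    using pd_kernel_sym[OF assms] by (simp add: UNIV_bool algebra_simps power2_eq_square)
  finally show ?thesis .
qed

lemma pd_kernel_null:
  assumes "pd_kernel A k" "x \<in> A" "y \<in> A" "k x x = 0"
  shows "k x y = 0"
proof (rule ccontr)
  assume nz: "k x y \<noteq> 0"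
  \<comment> \<open>As \<open>k x x = 0\<close>, the form is affine in the coefficient of
    \<open>x\<close>; this coefficient gives it the value -1.\<close>
  have "0 \<le> 2 * (- (k y y + 1) / (2 * k x y)) * 1 * k x y + k y y"
    using pd_kernel_pair[OF assms(1-3), of "- (k y y + 1) / (2 * k x y)" 1] assms(4) by simp
  also have "\<dots> = -1" using nz by (simp add: field_simps)
  finally show False by simp
qed

lemma cnd_kernel_nonneg:
  assumes "cnd_kernel A \<psi>" "x \<in> A" "y \<in> A"
  shows "0 \<le> \<psi> x y"
proof -
  have "(\<Sum>i\<in>UNIV. \<Sum>j\<in>UNIV. (if i then 1 else -1) * (if j then 1 else -1) *
      \<psi> (if i then x else y) (if j then x else y)) \<le> 0"
    using assms by (intro cnd_kernel_family) (auto simp: UNIV_bool)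
  then show ?thesis
    using cnd_kernel_sym[OF assms] cnd_kernel_diag[OF assms(1)] assms by (simp add: UNIV_bool)
qed

text \<open>For \<open>\<psi> x y = |b x - b y|^2\<close> this is the parallelogram inequality. The
  coefficients 1, -2, 1 have sum 0 and belong to the vector
  \<open>b x - 2 b y + b z\<close>.\<close>

lemma cnd_kernel_triangle:
  assumes "cnd_kernel A \<psi>" "x \<in> A" "y \<in> A" "z \<in> A"
  shows "\<psi> x z \<le> 2 * \<psi> x y + 2 * \<psi> y z"
proof -
  have "(\<Sum>i<3. \<Sum>j<3. ([1, -2, 1] ! i) * ([1, -2, 1] ! j) *
      \<psi> ([x, y, z] ! i) ([x, y, z] ! j)) \<le> 0"
    using assms by (intro cnd_kernel_family) (auto simp: numeral_3_eq_3 less_Suc_eq)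
  then show ?thesis
    using cnd_kernel_sym[OF assms(1)] cnd_kernel_diag[OF assms(1)] assms
    by (simp add: numeral_3_eq_3)
qed

text \<open>If \<open>\<Phi>\<close> is a feature map of \<open>k\<close>, then the sum of
  \<open>w i\<close> times \<open>\<Phi> (T i s)\<close> is one of the new kernel. Pullbacks, the
  operators attached to lamps and the states spread over several configurations are all
  instances.\<close>

lemma pd_kernel_combination:
  fixes w :: "'j \<Rightarrow> real" and T :: "'j \<Rightarrow> 'b \<Rightarrow> 'a"
  assumes pd: "pd_kernel A k" and J: "finite J" and T: "\<And>i s. i \<in> J \<Longrightarrow> s \<in> B \<Longrightarrow> T i s \<in> A"
  shows "pd_kernel B (\<lambda>s s'. \<Sum>i\<in>J. \<Sum>j\<in>J. w i * w j * k (T i s) (T j s'))"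
  unfolding pd_kernel_def
proof (intro conjI ballI allI impI)
  fix s s' assume s: "s \<in> B" "s' \<in> B"
  show "(\<Sum>i\<in>J. \<Sum>j\<in>J. w i * w j * k (T i s) (T j s')) = (\<Sum>i\<in>J. \<Sum>j\<in>J. w i * w j * k (T i s') (T j s))"
    by (subst sum.swap, intro sum.cong refl) (use pd_kernel_sym[OF pd] T s in \<open>simp add: mult.commute\<close>)
next
  fix F and c :: "'b \<Rightarrow> real" assume F: "finite F \<and> F \<subseteq> B"
  have "0 \<le> (\<Sum>p\<in>F \<times> J. \<Sum>q\<in>F \<times> J. (c (fst p) * w (snd p)) * (c (fst q) * w (snd q)) *
      k (T (snd p) (fst p)) (T (snd q) (fst q)))"
    using F J T by (intro pd_kernel_family[OF pd]) auto
  also have "\<dots> = (\<Sum>s\<in>F. \<Sum>i\<in>J. \<Sum>s'\<in>F. \<Sum>j\<in>J. (c s * w i) * (c s' * w j) * k (T i s) (T j s'))"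
    by (simp add: sum.cartesian_product' case_prod_unfold)
  also have "\<dots> = (\<Sum>s\<in>F. \<Sum>s'\<in>F. c s * c s' * (\<Sum>i\<in>J. \<Sum>j\<in>J. w i * w j * k (T i s) (T j s')))"
    by (intro sum.cong refl, subst sum.swap) (simp add: sum_distrib_left mult_ac)
  finally show "0 \<le> (\<Sum>s\<in>F. \<Sum>s'\<in>F. c s * c s' * (\<Sum>i\<in>J. \<Sum>j\<in>J. w i * w j * k (T i s) (T j s')))" .
qed

section \<open>Closure properties of positive and conditionally negative definite kernels\<close>

lemma pd_kernel_pullback:
  assumes "pd_kernel A k" "\<And>x. x \<in> B \<Longrightarrow> f x \<in> A"
  shows "pd_kernel B (\<lambda>x y. k (f x) (f y))"
  using pd_kernel_combination[OF assms(1), of "{()}" B "\<lambda>_. f" "\<lambda>_. 1"] assms(2) by simp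

lemma pd_kernel_add:
  assumes "pd_kernel A k" "pd_kernel A l"
  shows "pd_kernel A (\<lambda>x y. k x y + l x y)"
  using assms unfolding pd_kernel_def by (auto simp: distrib_left sum.distrib intro!: add_nonneg_nonneg)

lemma pd_kernel_scale:
  assumes "pd_kernel A k" "0 \<le> (r::real)"
  shows "pd_kernel A (\<lambda>x y. r * k x y)"
proof -
  have "(\<Sum>x\<in>F. \<Sum>y\<in>F. c x * c y * (r * k x y)) = r * (\<Sum>x\<in>F. \<Sum>y\<in>F. c x * c y * k x y)" for F c
    by (simp add: sum_distrib_left mult_ac)
  then show ?thesis using assms unfolding pd_kernel_def by auto
qed

lemma pd_kernel_rank_one:
  assumes "pd_kernel A k"
  shows "pd_kernel A (\<lambda>x y. f x * f y * k x y)"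
proof -
  have "(\<Sum>x\<in>F. \<Sum>y\<in>F. c x * c y * (f x * f y * k x y)) =
      (\<Sum>x\<in>F. \<Sum>y\<in>F. (c x * f x) * (c y * f y) * k x y)" for F c
    by (simp add: mult_ac)
  then show ?thesis using assms unfolding pd_kernel_def by auto
qed

lemma pd_kernel_one: "pd_kernel A (\<lambda>_ _. 1)"
  by (auto simp: pd_kernel_def simp flip: sum_product)

lemma pd_kernel_sum:
  assumes "\<And>i. i \<in> I \<Longrightarrow> pd_kernel A (k i)"
  shows "pd_kernel A (\<lambda>x y. \<Sum>i\<in>I. k i x y)"
  using assms
proof (induction I rule: infinite_finite_induct)
  case (insert i I)
  then show ?case by (simp add: pd_kernel_add)
qed (auto simp: pd_kernel_def)

lemma pd_kernel_limit:
  assumes "\<And>n. pd_kernel A (k n)" "\<And>x y. x \<in> A \<Longrightarrow> y \<in> A \<Longrightarrow> (\<lambda>n. k n x y) \<longlonglongrightarrow> l x y"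
  shows "pd_kernel A l"
  unfolding pd_kernel_def
proof (intro conjI ballI allI impI)
  fix x y assume xy: "x \<in> A" "y \<in> A"
  then have "(\<lambda>n. k n x y) = (\<lambda>n. k n y x)" using pd_kernel_sym[OF assms(1)] by blast
  then show "l x y = l y x" using assms(2) xy by (metis LIMSEQ_unique)
next
  fix F and c :: "'a \<Rightarrow> real" assume F: "finite F \<and> F \<subseteq> A"
  have "(\<lambda>n. \<Sum>x\<in>F. \<Sum>y\<in>F. c x * c y * k n x y) \<longlonglongrightarrow> (\<Sum>x\<in>F. \<Sum>y\<in>F. c x * c y * l x y)"
    using F assms(2) by (intro tendsto_sum tendsto_mult tendsto_const) auto
  then show "0 \<le> (\<Sum>x\<in>F. \<Sum>y\<in>F. c x * c y * l x y)"
    using F assms(1) by (intro LIMSEQ_le_const) (auto simp: pd_kernel_def)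
qed

lemma cnd_kernel_limit:
  assumes "\<And>n. cnd_kernel A (k n)" "\<And>x y. x \<in> A \<Longrightarrow> y \<in> A \<Longrightarrow> (\<lambda>n. k n x y) \<longlonglongrightarrow> l x y"
  shows "cnd_kernel A l"
  unfolding cnd_kernel_def
proof (intro conjI ballI allI impI)
  fix x y assume xy: "x \<in> A" "y \<in> A"
  then have "(\<lambda>n. k n x y) = (\<lambda>n. k n y x)" using cnd_kernel_sym[OF assms(1)] by blast
  then show "l x y = l y x" using assms(2) xy by (metis LIMSEQ_unique)
next
  fix x assume x: "x \<in> A"
  have "(\<lambda>n. k n x x) = (\<lambda>n. 0)" using cnd_kernel_diag[OF assms(1) x] by simp
  then show "l x x = 0" using assms(2)[OF x x] by (simp add: LIMSEQ_const_iff)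
next
  fix F and c :: "'a \<Rightarrow> real" assume F: "finite F \<and> F \<subseteq> A \<and> sum c F = 0"
  have "(\<lambda>n. \<Sum>x\<in>F. \<Sum>y\<in>F. c x * c y * k n x y) \<longlonglongrightarrow> (\<Sum>x\<in>F. \<Sum>y\<in>F. c x * c y * l x y)"
    using F assms(2) by (intro tendsto_sum tendsto_mult tendsto_const) auto
  then show "(\<Sum>x\<in>F. \<Sum>y\<in>F. c x * c y * l x y) \<le> 0"
    using F assms(1) by (intro LIMSEQ_le_const2) (auto simp: cnd_kernel_def)
qed

text \<open>The matrix is block diagonal, so its quadratic form is the sum of the forms of the
  blocks. The blocks will be the configurations of a given size, or the states with a given value of
  one lamp.\<close>

lemma pd_kernel_classes:
  fixes f :: "'a \<Rightarrow> 'b"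
  assumes pd: "\<And>v. pd_kernel {x \<in> A. f x = v} k"
  shows "pd_kernel A (\<lambda>x y. if f x = f y then k x y else 0)"
  unfolding pd_kernel_def
proof (intro conjI ballI allI impI)
  fix x y assume "x \<in> A" "y \<in> A"
  then show "(if f x = f y then k x y else 0) = (if f y = f x then k y x else 0)"
    using pd_kernel_sym[OF pd[of "f x"], of x y] by auto
next
  fix F and c :: "'a \<Rightarrow> real" assume F: "finite F \<and> F \<subseteq> A"
  have cls: "(\<Sum>x\<in>F. if f x = v then \<Sum>y\<in>F. if f y = v then c x * c y * k x y else 0 else 0) =
      (\<Sum>x\<in>{x\<in>F. f x = v}. \<Sum>y\<in>{x\<in>F. f x = v}. c x * c y * k x y)" for v
    using F by (simp add: sum.inter_filter)
  have "0 \<le> (\<Sum>v\<in>f ` F. \<Sum>x\<in>{x\<in>F. f x = v}. \<Sum>y\<in>{x\<in>F. f x = v}. c x * c y * k x y)"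
    using F by (intro sum_nonneg pd_kernelD[OF pd]) auto
  also have "\<dots> = (\<Sum>x\<in>F. \<Sum>v\<in>f ` F. if f x = v then \<Sum>y\<in>F. if f y = v then c x * c y * k x y else 0 else 0)"
    unfolding cls[symmetric] by (rule sum.swap)
  also have "\<dots> = (\<Sum>x\<in>F. \<Sum>y\<in>F. c x * c y * (if f x = f y then k x y else 0))"
    using F by (intro sum.cong refl) (auto intro!: sum.cong)
  finally show "0 \<le> (\<Sum>x\<in>F. \<Sum>y\<in>F. c x * c y * (if f x = f y then k x y else 0))" .
qed

text \<open>Gaussian elimination: each step splits off the rank-one kernel of one point.\<close>

lemma pd_kernel_factorization:
  assumes "finite F" "pd_kernel F k"
  shows "\<exists>(m::nat) v. \<forall>x\<in>F. \<forall>y\<in>F. k x y = (\<Sum>r<m. v r x * v r y)"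
  using assms
proof (induction F arbitrary: k rule: finite_induct)
  case (insert a F)
  note pd = \<open>pd_kernel (insert a F) k\<close>
  note sym = pd_kernel_sym[OF pd]
  \<comment> \<open>The Schur complement of the entry at \<open>a\<close>. If
    \<open>k a a = 0\<close>, division by zero makes it equal to \<open>k\<close>.\<close>
  define k' where "k' x y = k x y - k x a * k a y / k a a" for x y
  have "pd_kernel F k'"
  proof (cases "k a a = 0")
    case True
    then show ?thesis
      using pd_kernel_subset[OF pd, of F] by (auto simp: k'_def[abs_def])
  next
    case False
    then have pos: "0 < k a a" using pd_kernel_nonneg[OF pd, of a] by auto
    show ?thesis unfolding pd_kernel_def
    proof (intro conjI ballI allI impI)
      fix x y assume "x \<in> F" "y \<in> F"
      then show "k' x y = k' y x" using sym[of x y] sym[of x a] sym[of y a] by (simp add: k'_def)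
    next
      fix E c assume E: "finite E \<and> E \<subseteq> F"
      define s where "s = (\<Sum>x\<in>E. c x * k x a)"
      \<comment> \<open>The coefficient at \<open>a\<close> is the one that minimises the form of
        \<open>k\<close> for given coefficients on \<open>E\<close>; the minimum is the form of
        \<open>k'\<close>.\<close>
      define d where "d x = (if x = a then - s / k a a else c x)" for x
      have aE: "a \<notin> E" using E insert by auto
      have dE: "(\<Sum>x\<in>E. d x * g x) = (\<Sum>x\<in>E. c x * g x)" for g
        using aE by (intro sum.cong refl) (auto simp: d_def)
      have s': "(\<Sum>y\<in>E. c y * k a y) = s"
        unfolding s_def using E sym by (intro sum.cong refl) (auto simp: subset_iff)
      have "0 \<le> (\<Sum>x\<in>insert a E. \<Sum>y\<in>insert a E. d x * d y * k x y)"
        using E by (intro pd_kernel_family[OF pd, of _ "\<lambda>x. x"]) auto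
      also have "\<dots> = (\<Sum>x\<in>insert a E. d x * (\<Sum>y\<in>insert a E. d y * k x y))"
        by (simp add: sum_distrib_left mult.assoc)
      also have "\<dots> = d a * (d a * k a a + s) + (\<Sum>x\<in>E. c x * (d a * k x a + (\<Sum>y\<in>E. c y * k x y)))"
        using E aE by (simp add: dE s')
      also have "\<dots> = d a * (d a * k a a + s) + d a * s + (\<Sum>x\<in>E. c x * (\<Sum>y\<in>E. c y * k x y))"
        by (simp add: s_def distrib_left sum.distrib sum_distrib_left mult_ac)
      also have "\<dots> = (\<Sum>x\<in>E. \<Sum>y\<in>E. c x * c y * k x y) - s * s / k a a"
        using pos by (simp add: d_def sum_distrib_left mult.assoc field_simps)
      also have "s * s / k a a = (\<Sum>x\<in>E. \<Sum>y\<in>E. c x * c y * (k x a * k a y / k a a))"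
      proof -
        have "s * s / k a a = (\<Sum>x\<in>E. c x * k x a) * (\<Sum>y\<in>E. c y * k a y) / k a a"
          by (simp add: s' s_def)
        then show ?thesis by (simp add: sum_product sum_divide_distrib mult_ac)
      qed
      finally show "0 \<le> (\<Sum>x\<in>E. \<Sum>y\<in>E. c x * c y * k' x y)"
        by (simp add: k'_def right_diff_distrib sum_subtractf)
    qed
  qed
  then obtain m v where v: "\<And>x y. x \<in> F \<Longrightarrow> y \<in> F \<Longrightarrow> k' x y = (\<Sum>r<(m::nat). v r x * v r y)"
    using insert.IH by blast
  \<comment> \<open>For \<open>k a a = 0\<close> the new coordinate is 0 by division by zero, which
    is right because the row of \<open>a\<close> then vanishes.\<close>
  define u where "u r x = (if r = m then k x a / sqrt (k a a) else if x = a then 0 else v r x)" for r x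
  have nn: "0 \<le> k a a" using pd_kernel_nonneg[OF pd, of a] by auto
  have null: "k a a = 0 \<Longrightarrow> x \<in> insert a F \<Longrightarrow> k a x = 0" for x
    using pd_kernel_null[OF pd, of a x] by simp
  have "k x y = (\<Sum>r<Suc m. u r x * u r y)" if xy: "x \<in> insert a F" "y \<in> insert a F" for x y
  proof -
    have top: "u m x * u m y = k x a * k a y / k a a"
      using nn sym[of a y] xy by (simp add: u_def)
    have "(\<Sum>r<m. u r x * u r y) = k x y - k x a * k a y / k a a"
    proof (cases "x = a \<or> y = a")
      case True
      then have "(\<Sum>r<m. u r x * u r y) = 0" by (intro sum.neutral) (auto simp: u_def)
      moreover have "k x y - k x a * k a y / k a a = 0"
        using True null[of x] null[of y] xy sym[of a x] by (cases "k a a = 0") auto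
      ultimately show ?thesis by simp
    next
      case False
      then have "(\<Sum>r<m. u r x * u r y) = (\<Sum>r<m. v r x * v r y)"
        by (intro sum.cong refl) (auto simp: u_def)
      then show ?thesis using v[of x y] xy False by (simp add: k'_def)
    qed
    then show ?thesis using top by simp
  qed
  then show ?case by blast
qed auto

text \<open>On a finite set \<open>k\<close> is a sum of kernels \<open>v r x * v r y\<close>, and
  multiplying \<open>l\<close> by one of these only rescales the coefficients.\<close>

lemma pd_kernel_Schur:
  assumes k: "pd_kernel A k" and l: "pd_kernel A l"
  shows "pd_kernel A (\<lambda>x y. k x y * l x y)"
  unfolding pd_kernel_def
proof (intro conjI ballI allI impI)
  fix F and c :: "'a \<Rightarrow> real" assume F: "finite F \<and> F \<subseteq> A"
  then obtain m v where v: "\<And>x y. x \<in> F \<Longrightarrow> y \<in> F \<Longrightarrow> k x y = (\<Sum>r<(m::nat). v r x * v r y)"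
    using pd_kernel_factorization[of F k] pd_kernel_subset[OF k] by blast
  have "0 \<le> (\<Sum>r<m. \<Sum>x\<in>F. \<Sum>y\<in>F. (c x * v r x) * (c y * v r y) * l x y)"
    using F by (intro sum_nonneg pd_kernel_family[OF l]) auto
  also have "\<dots> = (\<Sum>x\<in>F. \<Sum>y\<in>F. \<Sum>r<m. (c x * v r x) * (c y * v r y) * l x y)"
    by (subst sum.swap, intro sum.cong refl, rule sum.swap)
  also have "\<dots> = (\<Sum>x\<in>F. \<Sum>y\<in>F. c x * c y * ((\<Sum>r<m. v r x * v r y) * l x y))"
    by (simp add: sum_distrib_left sum_distrib_right mult_ac)
  also have "\<dots> = (\<Sum>x\<in>F. \<Sum>y\<in>F. c x * c y * (k x y * l x y))"
    using v by (intro sum.cong refl) auto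
  finally show "0 \<le> (\<Sum>x\<in>F. \<Sum>y\<in>F. c x * c y * (k x y * l x y))" .
qed (use pd_kernel_sym[OF k] pd_kernel_sym[OF l] in auto)

section \<open>Exponentials of kernels and Schoenberg's theorem\<close>

lemma pd_kernel_exp:
  assumes "pd_kernel A k"
  shows "pd_kernel A (\<lambda>x y. exp (k x y))"
proof (rule pd_kernel_limit)
  have pow: "pd_kernel A (\<lambda>x y. k x y ^ n)" for n
    by (induction n) (auto intro: pd_kernel_one pd_kernel_Schur assms)
  show "pd_kernel A (\<lambda>x y. \<Sum>i<n. inverse (fact i) * k x y ^ i)" for n
    by (intro pd_kernel_sum pd_kernel_scale pow) simp
  show "(\<lambda>n. \<Sum>i<n. inverse (fact i) * k x y ^ i) \<longlonglongrightarrow> exp (k x y)" for x y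
    using exp_converges[of "k x y"] by (simp add: sums_def)
qed

text \<open>For \<open>\<psi> x y = |b x - b y|^2\<close> the kernel is twice the inner product of
  \<open>b x - b a\<close> and \<open>b y - b a\<close>. Arbitrary coefficients on \<open>F\<close>
  become coefficients of sum 0 by giving \<open>a\<close> the weight
  \<open>- sum c F\<close>.\<close>

lemma cnd_kernel_Gromov_product:
  assumes \<psi>: "cnd_kernel A \<psi>" and a: "a \<in> A"
  shows "pd_kernel A (\<lambda>x y. \<psi> x a + \<psi> a y - \<psi> x y)"
  unfolding pd_kernel_def
proof (intro conjI ballI allI impI)
  fix F and c :: "'a \<Rightarrow> real" assume F: "finite F \<and> F \<subseteq> A"
  define s where "s = sum c F"
  define t where "t = (\<Sum>x\<in>F. c x * \<psi> x a)"
  \<comment> \<open>The base point may already lie in \<open>F\<close>, so the added occurrence gets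
    the separate index \<open>None\<close>.\<close>
  define X where "X = case_option a (\<lambda>x. x :: 'a)"
  define C where "C = case_option (- s) c"
  have t': "(\<Sum>x\<in>F. c x * \<psi> a x) = t"
    unfolding t_def using F cnd_kernel_sym[OF \<psi>] a by (intro sum.cong refl) (auto simp: subset_iff)
  have I: "(\<Sum>i\<in>insert None (Some ` F). g i) = g None + (\<Sum>x\<in>F. g (Some x))" for g :: "'a option \<Rightarrow> real"
    using F by (simp add: sum.reindex)
  have *: "(\<Sum>i\<in>insert None (Some ` F). \<Sum>j\<in>insert None (Some ` F). C i * C j * \<psi> (X i) (X j)) \<le> 0"
    using F a by (intro cnd_kernel_family[OF \<psi>]) (auto simp: X_def I C_def s_def)
  have "- s * t - s * t + (\<Sum>x\<in>F. \<Sum>y\<in>F. c x * c y * \<psi> x y) \<le> 0"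
  proof -
    have "(\<Sum>i\<in>insert None (Some ` F). \<Sum>j\<in>insert None (Some ` F). C i * C j * \<psi> (X i) (X j)) =
        - s * (\<Sum>x\<in>F. c x * \<psi> a x) + (\<Sum>x\<in>F. c x * (- s) * \<psi> x a) +
        (\<Sum>x\<in>F. \<Sum>y\<in>F. c x * c y * \<psi> x y)"
      unfolding I using a cnd_kernel_diag[OF \<psi>]
      by (simp add: C_def X_def sum.distrib sum_subtractf sum_negf sum_distrib_left mult.assoc)
    moreover have "(\<Sum>x\<in>F. c x * (- s) * \<psi> x a) = - s * t"
      unfolding t_def sum_distrib_left by (intro sum.cong refl) simp
    ultimately show ?thesis using * t' by simp
  qed
  moreover have "(\<Sum>x\<in>F. \<Sum>y\<in>F. c x * c y * \<psi> x a) = s * t"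
    unfolding s_def t_def sum_product by (subst sum.swap) (simp add: mult_ac)
  moreover have "(\<Sum>x\<in>F. \<Sum>y\<in>F. c x * c y * \<psi> a y) = s * t"
    unfolding s_def t'[symmetric] sum_product by (simp add: mult_ac)
  ultimately show "0 \<le> (\<Sum>x\<in>F. \<Sum>y\<in>F. c x * c y * (\<psi> x a + \<psi> a y - \<psi> x y))"
    by (simp add: algebra_simps sum.distrib sum_subtractf)
qed (use cnd_kernel_sym[OF \<psi>] a in auto)

text \<open>With a base point \<open>a\<close>, the kernel is the exponential of \<open>t\<close>
  times the Gromov product, multiplied by a function of \<open>x\<close> and the same function of
  \<open>y\<close>.\<close>

lemma Schoenberg:
  assumes \<psi>: "cnd_kernel A \<psi>" and t: "0 \<le> t"
  shows "pd_kernel A (\<lambda>x y. exp (- t * \<psi> x y))"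
proof (cases "A = {}")
  case True
  then show ?thesis by (auto simp: pd_kernel_def)
next
  case False
  then obtain a where a: "a \<in> A" by auto
  have "pd_kernel A (\<lambda>x y. exp (- t * \<psi> x a) * exp (- t * \<psi> y a) *
      exp (t * (\<psi> x a + \<psi> a y - \<psi> x y)))"
    by (intro pd_kernel_rank_one pd_kernel_exp pd_kernel_scale cnd_kernel_Gromov_product \<psi> a t)
  moreover have "exp (- t * \<psi> x a) * exp (- t * \<psi> y a) * exp (t * (\<psi> x a + \<psi> a y - \<psi> x y)) =
      exp (- t * \<psi> x y)" if "y \<in> A" for x y
    using cnd_kernel_sym[OF \<psi> that a] by (simp add: algebra_simps flip: exp_add)
  ultimately show ?thesis by (subst pd_kernel_cong) auto
qed

lemma cnd_kernel_one_minus_pd: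
  assumes "pd_kernel A k" "\<And>x. x \<in> A \<Longrightarrow> k x x = 1"
  shows "cnd_kernel A (\<lambda>x y. 1 - k x y)"
  using assms
  by (auto simp: cnd_kernel_def pd_kernel_def right_diff_distrib sum_subtractf simp flip: sum_product)

lemma cnd_kernel_scale:
  assumes "cnd_kernel A k" "0 \<le> (r::real)"
  shows "cnd_kernel A (\<lambda>x y. r * k x y)"
proof -
  have "(\<Sum>x\<in>F. \<Sum>y\<in>F. c x * c y * (r * k x y)) = r * (\<Sum>x\<in>F. \<Sum>y\<in>F. c x * c y * k x y)" for F c
    by (simp add: sum_distrib_left mult_ac)
  then show ?thesis using assms unfolding cnd_kernel_def by (auto simp: mult_nonneg_nonpos)
qed

lemma cnd_kernel_sum:
  assumes "\<And>i. i \<in> I \<Longrightarrow> cnd_kernel A (k i)"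
  shows "cnd_kernel A (\<lambda>x y. \<Sum>i\<in>I. k i x y)"
  using assms
proof (induction I rule: infinite_finite_induct)
  case (insert i I)
  then have "cnd_kernel A (k i)" "cnd_kernel A (\<lambda>x y. \<Sum>i\<in>I. k i x y)" by auto
  then show ?case using insert(1,2)
    by (auto simp: cnd_kernel_def distrib_left sum.distrib intro!: add_nonpos_nonpos)
qed (auto simp: cnd_kernel_def)

lemma cnd_kernel_pullback:
  fixes f :: "'b \<Rightarrow> 'a"
  assumes "cnd_kernel A \<psi>" "\<And>x. x \<in> B \<Longrightarrow> f x \<in> A"
  shows "cnd_kernel B (\<lambda>x y. \<psi> (f x) (f y))"
  unfolding cnd_kernel_def
proof (intro conjI ballI allI impI)
  fix F and c :: "'b \<Rightarrow> real" assume "finite F \<and> F \<subseteq> B \<and> sum c F = 0"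
  then show "(\<Sum>x\<in>F. \<Sum>y\<in>F. c x * c y * \<psi> (f x) (f y)) \<le> 0"
    using assms(2) by (intro cnd_kernel_family[OF assms(1)]) auto
qed (use assms cnd_kernel_sym cnd_kernel_diag in metis)+

subsection \<open>The Hilbert space of a positive definite kernel\<close>

text \<open>Formal linear combinations are lists of weighted points, so that addition is
  concatenation and no normal form is required; different lists may represent the same
  vector.\<close>

definition lincomb :: "(real \<times> 'a) list \<Rightarrow> ('a \<Rightarrow> real) \<Rightarrow> real"
  where "lincomb c f = (\<Sum>p\<leftarrow>c. fst p * f (snd p))"

definition scale :: "real \<Rightarrow> (real \<times> 'a) list \<Rightarrow> (real \<times> 'a) list"
  where "scale r c = map (map_prod ((*) r) id) c"

lemma lincomb_simps [simp]:
  "lincomb [] f = 0" "lincomb (p # c) f = fst p * f (snd p) + lincomb c f"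
  "lincomb (c @ d) f = lincomb c f + lincomb d f" "lincomb (scale r c) f = r * lincomb c f"
  by (simp_all add: lincomb_def scale_def sum_list_const_mult o_def mult.assoc)

lemma lincomb_fun [simp]:
  "lincomb c (\<lambda>x. f x + g x) = lincomb c f + lincomb c g"
  "lincomb c (\<lambda>x. f x - g x) = lincomb c f - lincomb c g"
  "lincomb c (\<lambda>x. r * f x) = r * lincomb c f" "lincomb c (\<lambda>x. 0) = 0"
  by (induction c) (auto simp: algebra_simps)

lemma lincomb_cong: "(\<And>p. p \<in> set c \<Longrightarrow> f (snd p) = g (snd p)) \<Longrightarrow> lincomb c f = lincomb c g"
  by (induction c) auto

lemma lincomb_swap: "lincomb c (\<lambda>x. lincomb d (h x)) = lincomb d (\<lambda>y. lincomb c (\<lambda>x. h x y))"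
  by (induction c) auto

lemma lincomb_nth: "lincomb c f = (\<Sum>i<length c. fst (c ! i) * f (snd (c ! i)))"
  by (simp add: lincomb_def sum_list_sum_nth atLeast0LessThan)

lemma tendsto_lincomb:
  "(\<And>p. p \<in> set c \<Longrightarrow> ((\<lambda>n. f n (snd p)) \<longlongrightarrow> g (snd p)) F) \<Longrightarrow> ((\<lambda>n. lincomb c (f n)) \<longlongrightarrow> lincomb c g) F"
  by (induction c) (auto intro!: tendsto_intros)

locale reproducing_kernel =
  fixes A :: "'a set" and k :: "'a \<Rightarrow> 'a \<Rightarrow> real"
  assumes pd: "pd_kernel A k"
begin

definition combs :: "(real \<times> 'a) list set"
  where "combs = {c. snd ` set c \<subseteq> A}"

definition form :: "(real \<times> 'a) list \<Rightarrow> (real \<times> 'a) list \<Rightarrow> real"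
  where "form c d = lincomb c (\<lambda>x. lincomb d (k x))"

definition seminorm :: "(real \<times> 'a) list \<Rightarrow> real"
  where "seminorm c = sqrt (form c c)"

text \<open>The value 0 off \<open>A\<close> makes the functions determined by their values on
  \<open>A\<close>.\<close>

definition fn :: "(real \<times> 'a) list \<Rightarrow> 'a \<Rightarrow> real"
  where "fn c x = (if x \<in> A then lincomb c (\<lambda>y. k y x) else 0)"

definition cauchy :: "(nat \<Rightarrow> (real \<times> 'a) list) \<Rightarrow> bool"
  where "cauchy f \<longleftrightarrow> (\<forall>e>0. \<exists>N. \<forall>m\<ge>N. \<forall>n\<ge>N. seminorm (f m @ scale (-1) (f n)) < e)"

text \<open>The completion is realised by genuine functions instead of classes of Cauchy sequences.
  Evaluation at a point of \<open>A\<close> is bounded by the seminorm, and a Cauchy sequence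
  tending to 0 pointwise tends to 0 in the seminorm, so the pointwise limit determines the
  class.\<close>

definition approximates :: "(nat \<Rightarrow> (real \<times> 'a) list) \<Rightarrow> ('a \<Rightarrow> real) \<Rightarrow> bool"
  where "approximates f \<phi> \<longleftrightarrow> (\<forall>n. f n \<in> combs) \<and> cauchy f \<and> (\<forall>x. (\<lambda>n. fn (f n) x) \<longlonglongrightarrow> \<phi> x)"

text \<open>The representatives are arbitrary choices; \<open>form_tendsto_inner\<close> shows that
  every choice gives the same limit.\<close>

definition inner :: "('a \<Rightarrow> real) \<Rightarrow> ('a \<Rightarrow> real) \<Rightarrow> real"
  where "inner \<phi> \<psi> =
    lim (\<lambda>n. form ((SOME f. approximates f \<phi>) n) ((SOME g. approximates g \<psi>) n))"

definition rkhs :: "('a \<Rightarrow> real) inner_space"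
  where "rkhs = \<lparr>carrier = {\<phi>. \<exists>f. approximates f \<phi>}, monoid.mult = (\<lambda>_ _. undefined), one = undefined,
     zero = (\<lambda>_. 0), add = (\<lambda>\<phi> \<psi> x. \<phi> x + \<psi> x),
     module.smult = (\<lambda>a \<phi> x. a * \<phi> x), iprod = inner\<rparr>"

lemma combs_simps [simp]:
  "[] \<in> combs" "p # c \<in> combs \<longleftrightarrow> snd p \<in> A \<and> c \<in> combs" "c @ d \<in> combs \<longleftrightarrow> c \<in> combs \<and> d \<in> combs"
  by (auto simp: combs_def)

lemma scale_in_combs [simp]: "c \<in> combs \<Longrightarrow> scale r c \<in> combs"
  by (induction c) (auto simp: scale_def)

lemma combsD: "c \<in> combs \<Longrightarrow> p \<in> set c \<Longrightarrow> snd p \<in> A"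
  by (auto simp: combs_def)

lemma form_simps [simp]:
  "form (c @ c') d = form c d + form c' d" "form d (c @ c') = form d c + form d c'"
  "form (scale r c) d = r * form c d" "form d (scale r c) = r * form d c"
  by (simp_all add: form_def)

lemma fn_simps [simp]:
  "fn (c @ d) x = fn c x + fn d x" "fn (scale r c) x = r * fn c x" "fn [] x = 0"
  by (simp_all add: fn_def)

lemma form_commute: "c \<in> combs \<Longrightarrow> d \<in> combs \<Longrightarrow> form c d = form d c"
  unfolding form_def
  by (subst lincomb_swap, intro lincomb_cong) (auto dest!: combsD intro!: pd_kernel_sym[OF pd])

lemma form_fn: "c \<in> combs \<Longrightarrow> d \<in> combs \<Longrightarrow> form c d = lincomb d (fn c)"
  unfolding form_def
  by (subst lincomb_swap, intro lincomb_cong) (auto simp: fn_def dest: combsD)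

lemma form_nonneg: "c \<in> combs \<Longrightarrow> 0 \<le> form c c"
  using pd_kernel_family[OF pd, of "{..<length c}" "\<lambda>i. snd (c ! i)" "\<lambda>i. fst (c ! i)"]
  unfolding form_def lincomb_nth
  by (simp add: sum_distrib_left mult.assoc combsD)

lemma seminorm_nonneg: "c \<in> combs \<Longrightarrow> 0 \<le> seminorm c"
  by (simp add: seminorm_def form_nonneg)

lemma seminorm_sq: "c \<in> combs \<Longrightarrow> (seminorm c)\<^sup>2 = form c c"
  by (simp add: seminorm_def form_nonneg)

lemma form_Cauchy_Schwarz:
  assumes c: "c \<in> combs" and d: "d \<in> combs"
  shows "\<bar>form c d\<bar> \<le> seminorm c * seminorm d"
proof -
  have q: "0 \<le> s\<^sup>2 * form c c + 2 * s * t * form c d + t\<^sup>2 * form d d" for s t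
    using form_nonneg[of "scale s c @ scale t d"] c d form_commute[OF c d]
    by (simp add: algebra_simps power2_eq_square)
  have "(form c d)\<^sup>2 \<le> form c c * form d d"
  proof (cases "form d d = 0")
    case True
    have "form c d = 0"
    proof (rule ccontr)
      assume "form c d \<noteq> 0"
      then show False using q[of 1 "- (form c c + 1) / (2 * form c d)"] True
        by (simp add: field_simps)
    qed
    then show ?thesis using True by simp
  next
    case False
    then have "0 < form d d" using form_nonneg[OF d] by simp
    moreover have "0 \<le> form d d * (form c c * form d d - (form c d)\<^sup>2)"
      using q[of "form d d" "- form c d"] by (simp add: algebra_simps power2_eq_square)
    ultimately show ?thesis by (simp add: zero_le_mult_iff)
  qed
  then show ?thesis
    unfolding seminorm_def real_sqrt_mult[symmetric] by (simp add: real_le_rsqrt power2_abs)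
qed

lemma seminorm_triangle:
  assumes c: "c \<in> combs" and d: "d \<in> combs"
  shows "seminorm (c @ d) \<le> seminorm c + seminorm d"
proof (rule power2_le_imp_le)
  show "(seminorm (c @ d))\<^sup>2 \<le> (seminorm c + seminorm d)\<^sup>2"
    using form_Cauchy_Schwarz[OF c d] c d form_commute[OF c d]
    by (simp add: seminorm_sq power2_sum)
qed (use c d in \<open>simp add: seminorm_nonneg\<close>)

lemma seminorm_scale: "c \<in> combs \<Longrightarrow> seminorm (scale r c) = \<bar>r\<bar> * seminorm c"
  by (simp add: seminorm_def real_sqrt_mult flip: mult.assoc power2_eq_square)

lemma seminorm_diff_commute:
  assumes "c \<in> combs" "d \<in> combs"
  shows "seminorm (c @ scale (-1) d) = seminorm (d @ scale (-1) c)"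
  using assms by (simp add: seminorm_def)

lemma abs_seminorm_diff:
  assumes c: "c \<in> combs" and d: "d \<in> combs"
  shows "\<bar>seminorm c - seminorm d\<bar> \<le> seminorm (c @ scale (-1) d)"
proof -
  have *: "seminorm c \<le> seminorm d + seminorm (c @ scale (-1) d)" if "c \<in> combs" "d \<in> combs" for c d
  proof -
    have "seminorm c = seminorm (d @ (c @ scale (-1) d))"
      using that by (simp add: seminorm_def)
    also have "\<dots> \<le> seminorm d + seminorm (c @ scale (-1) d)"
      using that by (intro seminorm_triangle) auto
    finally show ?thesis .
  qed
  show ?thesis using *[OF c d] *[OF d c] seminorm_diff_commute[OF c d] by linarith
qed

section \<open>Cauchy sequences of combinations and the inner product of their limits\<close>

lemma cauchy_append:
  assumes "cauchy f" "cauchy g" "\<And>n. f n \<in> combs" "\<And>n. g n \<in> combs"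
  shows "cauchy (\<lambda>n. f n @ g n)"
  unfolding cauchy_def
proof (intro allI impI)
  fix e :: real assume "0 < e"
  then have e: "0 < e / 2" by simp
  obtain M where M: "\<And>m n. M \<le> m \<Longrightarrow> M \<le> n \<Longrightarrow> seminorm (f m @ scale (-1) (f n)) < e / 2"
    using assms(1) e unfolding cauchy_def by blast
  obtain N where N: "\<And>m n. N \<le> m \<Longrightarrow> N \<le> n \<Longrightarrow> seminorm (g m @ scale (-1) (g n)) < e / 2"
    using assms(2) e unfolding cauchy_def by blast
  have "seminorm ((f m @ g m) @ scale (-1) (f n @ g n)) < e" if "max M N \<le> m" "max M N \<le> n" for m n
  proof -
    have fg: "f i \<in> combs" "g i \<in> combs" for i using assms by auto
    have "seminorm ((f m @ g m) @ scale (-1) (f n @ g n)) =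
        seminorm ((f m @ scale (-1) (f n)) @ (g m @ scale (-1) (g n)))"
      unfolding seminorm_def by (intro arg_cong[of _ _ sqrt]) (simp add: algebra_simps)
    also have "\<dots> \<le> seminorm (f m @ scale (-1) (f n)) + seminorm (g m @ scale (-1) (g n))"
      using fg by (intro seminorm_triangle) auto
    also have "\<dots> < e" using M[of m n] N[of m n] that by auto
    finally show ?thesis .
  qed
  then show "\<exists>N. \<forall>m\<ge>N. \<forall>n\<ge>N. seminorm ((f m @ g m) @ scale (-1) (f n @ g n)) < e" by blast
qed

lemma cauchy_scale:
  assumes "cauchy f" "\<And>n. f n \<in> combs"
  shows "cauchy (\<lambda>n. scale r (f n))"
  unfolding cauchy_def
proof (intro allI impI)
  fix e :: real assume "0 < e"
  then have e: "0 < e / (\<bar>r\<bar> + 1)" by simp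
  obtain N where N: "\<And>m n. N \<le> m \<Longrightarrow> N \<le> n \<Longrightarrow> seminorm (f m @ scale (-1) (f n)) < e / (\<bar>r\<bar> + 1)"
    using assms(1) e unfolding cauchy_def by blast
  have "seminorm (scale r (f m) @ scale (-1) (scale r (f n))) < e" if "N \<le> m" "N \<le> n" for m n
  proof -
    have f: "f m @ scale (-1) (f n) \<in> combs" using assms by auto
    have "seminorm (scale r (f m) @ scale (-1) (scale r (f n))) =
        seminorm (scale r (f m @ scale (-1) (f n)))"
      unfolding seminorm_def by (intro arg_cong[of _ _ sqrt]) (simp add: algebra_simps)
    also have "\<dots> = \<bar>r\<bar> * seminorm (f m @ scale (-1) (f n))" by (rule seminorm_scale[OF f])
    also have "\<dots> \<le> (\<bar>r\<bar> + 1) * seminorm (f m @ scale (-1) (f n))"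
      using seminorm_nonneg[OF f] by (intro mult_right_mono) auto
    also have "\<dots> < e" using N[OF that] by (simp add: field_simps)
    finally show ?thesis .
  qed
  then show "\<exists>N. \<forall>m\<ge>N. \<forall>n\<ge>N. seminorm (scale r (f m) @ scale (-1) (scale r (f n))) < e" by blast
qed

lemma approximatesD:
  assumes "approximates f \<phi>"
  shows "f n \<in> combs" "cauchy f" "(\<lambda>n. fn (f n) x) \<longlonglongrightarrow> \<phi> x"
  using assms by (auto simp: approximates_def)

lemma approximates_add:
  "approximates f \<phi> \<Longrightarrow> approximates g \<psi> \<Longrightarrow> approximates (\<lambda>n. f n @ g n) (\<lambda>x. \<phi> x + \<psi> x)"
  by (auto simp: approximates_def cauchy_append intro!: tendsto_add)

lemma approximates_scale:
  "approximates f \<phi> \<Longrightarrow> approximates (\<lambda>n. scale r (f n)) (\<lambda>x. r * \<phi> x)"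
  unfolding approximates_def
  by (intro conjI allI cauchy_scale) (auto intro!: tendsto_mult)

lemma approximates_fn: "c \<in> combs \<Longrightarrow> approximates (\<lambda>_. c) (fn c)"
  by (auto simp: approximates_def cauchy_def seminorm_def)

lemma seminorm_convergent:
  assumes "\<And>n. f n \<in> combs" "cauchy f"
  shows "convergent (\<lambda>n. seminorm (f n))"
proof (rule real_Cauchy_convergent, rule metric_CauchyI)
  fix e :: real assume "0 < e"
  then obtain N where "\<And>m n. N \<le> m \<Longrightarrow> N \<le> n \<Longrightarrow> seminorm (f m @ scale (-1) (f n)) < e"
    using assms(2) unfolding cauchy_def by blast
  moreover have "dist (seminorm (f m)) (seminorm (f n)) \<le> seminorm (f m @ scale (-1) (f n))" for m n
    using abs_seminorm_diff[of "f m" "f n"] assms(1) by (simp add: dist_real_def)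
  ultimately show "\<exists>M. \<forall>m\<ge>M. \<forall>n\<ge>M. dist (seminorm (f m)) (seminorm (f n)) < e"
    by (meson le_less_trans)
qed

lemma approximates_seminorm: "approximates f \<phi> \<Longrightarrow> \<exists>l. (\<lambda>n. seminorm (f n)) \<longlonglongrightarrow> l"
  using seminorm_convergent[of f] by (auto simp: approximates_def convergent_def)

text \<open>Expand the square of the seminorm of \<open>h n - h N\<close> for a fixed large
  \<open>N\<close>. The cross term is a fixed finite combination of values of
  \<open>fn (h n)\<close> and tends to 0, so the limit of the squared seminorm of
  \<open>h n\<close>, plus that of \<open>h N\<close>, is at most \<open>e\<close>.\<close>

lemma approximates_zero:
  assumes h: "approximates h (\<lambda>_. 0)"
  shows "(\<lambda>n. seminorm (h n)) \<longlonglongrightarrow> 0"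
proof -
  note hc = approximatesD(1)[OF h]
  obtain l where l: "(\<lambda>n. seminorm (h n)) \<longlonglongrightarrow> l" using approximates_seminorm[OF h] by blast
  have "l\<^sup>2 \<le> e" if "0 < e" for e
  proof -
    have "0 < sqrt e" using that by simp
    then obtain N where N: "\<And>m n. N \<le> m \<Longrightarrow> N \<le> n \<Longrightarrow> seminorm (h m @ scale (-1) (h n)) < sqrt e"
      using approximatesD(2)[OF h] unfolding cauchy_def by blast
    have "(\<lambda>n. form (h n) (h N)) \<longlonglongrightarrow> lincomb (h N) (\<lambda>_. 0)"
      unfolding form_fn[OF hc hc] by (intro tendsto_lincomb) (rule approximatesD(3)[OF h])
    then have "(\<lambda>n. (seminorm (h n))\<^sup>2 - 2 * form (h n) (h N) + form (h N) (h N)) \<longlonglongrightarrow>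
        l\<^sup>2 - 2 * 0 + form (h N) (h N)"
      by (intro tendsto_intros l) simp
    moreover have "(seminorm (h n))\<^sup>2 - 2 * form (h n) (h N) + form (h N) (h N) \<le> e" if "N \<le> n" for n
    proof -
      have "(seminorm (h n @ scale (-1) (h N)))\<^sup>2 \<le> (sqrt e)\<^sup>2"
        using N[OF that order_refl] hc by (intro power_mono seminorm_nonneg) (auto intro: less_imp_le)
      then show ?thesis
        using \<open>0 < e\<close> hc form_commute[OF hc hc, of n N] by (simp add: seminorm_sq)
    qed
    ultimately have "l\<^sup>2 - 2 * 0 + form (h N) (h N) \<le> e" by (intro LIMSEQ_le_const2) auto
    then show ?thesis using form_nonneg[OF hc, of N] by simp
  qed
  then have "l\<^sup>2 \<le> 0" using field_le_epsilon[of "l\<^sup>2" 0] by simp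
  then show ?thesis using l by simp
qed

text \<open>By polarization, convergence of the form reduces to convergence of seminorms.\<close>

lemma form_convergent:
  assumes f: "approximates f \<phi>" and g: "approximates g \<psi>"
  shows "convergent (\<lambda>n. form (f n) (g n))"
proof -
  note fc = approximatesD(1)[OF f] and gc = approximatesD(1)[OF g]
  have eq: "form (f n) (g n) =
      ((seminorm (f n @ g n))\<^sup>2 - (seminorm (f n @ scale (-1) (g n)))\<^sup>2) / 4" for n
    using fc gc form_commute[OF fc gc, of n n] by (simp add: seminorm_sq)
  obtain s where s: "(\<lambda>n. seminorm (f n @ g n)) \<longlonglongrightarrow> s"
    using approximates_seminorm[OF approximates_add[OF f g]] by blast
  obtain t where t: "(\<lambda>n. seminorm (f n @ scale (-1) (g n))) \<longlonglongrightarrow> t"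
    using approximates_seminorm[OF approximates_add[OF f approximates_scale[OF g, of "-1"]]] by blast
  have "(\<lambda>n. form (f n) (g n)) \<longlonglongrightarrow> (s\<^sup>2 - t\<^sup>2) / 4"
    unfolding eq by (intro tendsto_divide tendsto_diff tendsto_power s t tendsto_const) simp
  then show ?thesis by (auto simp: convergent_def)
qed

lemma form_limit_unique:
  assumes f: "approximates f \<phi>" and f': "approximates f' \<phi>" and g: "approximates g \<psi>"
  shows "(\<lambda>n. form (f n) (g n) - form (f' n) (g n)) \<longlonglongrightarrow> 0"
proof -
  note fc = approximatesD(1)[OF f] and fc' = approximatesD(1)[OF f'] and gc = approximatesD(1)[OF g]
  have h: "approximates (\<lambda>n. f n @ scale (-1) (f' n)) (\<lambda>_. 0)"
    using approximates_add[OF f approximates_scale[OF f', of "-1"]] by simp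
  obtain l where "(\<lambda>n. seminorm (g n)) \<longlonglongrightarrow> l" using approximates_seminorm[OF g] by blast
  then have lim: "(\<lambda>n. seminorm (f n @ scale (-1) (f' n)) * seminorm (g n)) \<longlonglongrightarrow> 0"
    using tendsto_mult[OF approximates_zero[OF h]] by simp
  have "norm (form (f n) (g n) - form (f' n) (g n)) \<le>
      seminorm (f n @ scale (-1) (f' n)) * seminorm (g n)" for n
    using form_Cauchy_Schwarz[of "f n @ scale (-1) (f' n)" "g n"] fc fc' gc by simp
  then show ?thesis by (intro Lim_null_comparison[OF always_eventually lim] allI)
qed

text \<open>The given representatives are exchanged for the chosen ones in one argument at a time;
  each exchange changes the form by a null sequence.\<close>

lemma form_tendsto_inner:
  assumes f: "approximates f \<phi>" and g: "approximates g \<psi>"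
  shows "(\<lambda>n. form (f n) (g n)) \<longlonglongrightarrow> inner \<phi> \<psi>"
proof -
  define f' where "f' = (SOME f. approximates f \<phi>)"
  define g' where "g' = (SOME g. approximates g \<psi>)"
  have f': "approximates f' \<phi>" and g': "approximates g' \<psi>"
    using f g unfolding f'_def g'_def by (metis someI)+
  note c = approximatesD(1)[OF f] approximatesD(1)[OF g] approximatesD(1)[OF f'] approximatesD(1)[OF g']
  have "(\<lambda>n. form (f' n) (g' n)) \<longlonglongrightarrow> inner \<phi> \<psi>"
    using form_convergent[OF f' g'] unfolding inner_def f'_def g'_def
    by (simp add: convergent_LIMSEQ_iff)
  moreover have "(\<lambda>n. form (f n) (g n) - form (f' n) (g n)) \<longlonglongrightarrow> 0"
    by (rule form_limit_unique[OF f f' g])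
  moreover have "(\<lambda>n. form (g n) (f' n) - form (g' n) (f' n)) \<longlonglongrightarrow> 0"
    by (rule form_limit_unique[OF g g' f'])
  ultimately have "(\<lambda>n. (form (f n) (g n) - form (f' n) (g n)) +
      (form (g n) (f' n) - form (g' n) (f' n)) + form (f' n) (g' n)) \<longlonglongrightarrow> 0 + 0 + inner \<phi> \<psi>"
    by (intro tendsto_add)
  then show ?thesis using c by (simp add: form_commute[of "g _" "f' _"] form_commute[of "g' _" "f' _"])
qed

lemma inner_eqI:
  "approximates f \<phi> \<Longrightarrow> approximates g \<psi> \<Longrightarrow> (\<lambda>n. form (f n) (g n)) \<longlonglongrightarrow> l \<Longrightarrow> inner \<phi> \<psi> = l"
  using form_tendsto_inner LIMSEQ_unique by blast

lemma rkhs_simps [simp]: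
  "\<phi> \<in> carrier rkhs \<longleftrightarrow> (\<exists>f. approximates f \<phi>)" "zero rkhs = (\<lambda>_. 0)"
  "\<phi> \<oplus>\<^bsub>rkhs\<^esub> \<psi> = (\<lambda>x. \<phi> x + \<psi> x)" "r \<odot>\<^bsub>rkhs\<^esub> \<phi> = (\<lambda>x. r * \<phi> x)" "iprod rkhs = inner"
  by (simp_all add: rkhs_def)

lemma fn_in_rkhs: "c \<in> combs \<Longrightarrow> fn c \<in> carrier rkhs"
  using approximates_fn by auto

lemma inner_fn: "c \<in> combs \<Longrightarrow> d \<in> combs \<Longrightarrow> inner (fn c) (fn d) = form c d"
  by (rule inner_eqI[OF approximates_fn approximates_fn]) auto

lemma inner_product_space_rkhs: "inner_product_space rkhs"
proof -
  have zero: "approximates (\<lambda>_. []) (\<lambda>_. 0)"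
    by (auto simp: approximates_def cauchy_def seminorm_def form_def)
  have ag: "abelian_group rkhs"
  proof (rule abelian_groupI)
    fix \<phi> assume "\<phi> \<in> carrier rkhs"
    then obtain f where "approximates f \<phi>" by auto
    then show "\<exists>\<psi>\<in>carrier rkhs. \<psi> \<oplus>\<^bsub>rkhs\<^esub> \<phi> = \<zero>\<^bsub>rkhs\<^esub>"
      using approximates_scale[of f \<phi> "-1"] by (intro bexI[of _ "\<lambda>x. -1 * \<phi> x"]) auto
  qed (use zero in \<open>auto simp: add.assoc add.commute intro: approximates_add\<close>)
  have mod: "module real_ring rkhs"
    by (intro moduleI cring_real_ring ag)
      (auto simp: real_ring_def algebra_simps intro: approximates_scale)
  show ?thesis
  proof (intro inner_product_space.intro mod inner_product_space_axioms.intro)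
    fix \<phi> \<psi> \<theta> r assume \<phi>: "\<phi> \<in> carrier rkhs" and \<psi>: "\<psi> \<in> carrier rkhs"
    obtain f where f: "approximates f \<phi>" using \<phi> by auto
    obtain g where g: "approximates g \<psi>" using \<psi> by auto
    note fg = form_tendsto_inner[OF f g]
    show "iprod rkhs \<phi> \<psi> = iprod rkhs \<psi> \<phi>"
      using inner_eqI[OF g f, of "inner \<phi> \<psi>"] fg
      by (simp add: form_commute[OF approximatesD(1)[OF g] approximatesD(1)[OF f]])
    show "iprod rkhs (r \<odot>\<^bsub>rkhs\<^esub> \<phi>) \<psi> = r * iprod rkhs \<phi> \<psi>"
      using inner_eqI[OF approximates_scale[OF f, of r] g] tendsto_mult[OF tendsto_const fg, of r] by simp
    show "iprod rkhs (\<phi> \<oplus>\<^bsub>rkhs\<^esub> \<psi>) \<theta> = iprod rkhs \<phi> \<theta> + iprod rkhs \<psi> \<theta>" if "\<theta> \<in> carrier rkhs"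
    proof -
      obtain h where h: "approximates h \<theta>" using \<open>\<theta> \<in> carrier rkhs\<close> by auto
      show ?thesis
        using inner_eqI[OF approximates_add[OF f g] h]
          tendsto_add[OF form_tendsto_inner[OF f h] form_tendsto_inner[OF g h]] by simp
    qed
  next
    fix \<phi> assume "\<phi> \<in> carrier rkhs"
    then obtain f where f: "approximates f \<phi>" by auto
    note fc = approximatesD(1)[OF f]
    show "0 \<le> iprod rkhs \<phi> \<phi>"
      using form_tendsto_inner[OF f f] fc by (intro LIMSEQ_le_const) (auto simp: form_nonneg)
    assume "iprod rkhs \<phi> \<phi> = 0"
    then have "(\<lambda>n. form (f n) (f n)) \<longlonglongrightarrow> 0" using form_tendsto_inner[OF f f] by simp
    then have "(\<lambda>n. sqrt (form (f n) (f n))) \<longlonglongrightarrow> sqrt 0" by (rule tendsto_real_sqrt)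
    then have "(\<lambda>n. seminorm (f n)) \<longlonglongrightarrow> 0" by (simp add: seminorm_def)
    then have sn: "(\<lambda>n. seminorm (f n) * seminorm [(1, x)]) \<longlonglongrightarrow> 0" for x
      by (rule tendsto_mult_left_zero)
    \<comment> \<open>Reproducing property: evaluation at \<open>x\<close> is the form against the
      point mass \<open>[(1, x)]\<close>, to which Cauchy-Schwarz applies.\<close>
    have "\<phi> x = 0" for x
    proof (cases "x \<in> A")
      case True
      have "fn (f n) x = form (f n) [(1, x)]" for n
        using fc True by (simp add: form_fn)
      then have "norm (fn (f n) x) \<le> seminorm (f n) * seminorm [(1, x)]" for n
        using form_Cauchy_Schwarz[of "f n" "[(1, x)]"] fc True by simp
      then have "(\<lambda>n. fn (f n) x) \<longlonglongrightarrow> 0"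
        by (intro Lim_null_comparison[OF always_eventually sn[of x]] allI)
      then show ?thesis using LIMSEQ_unique[OF approximatesD(3)[OF f]] by simp
    next
      case False
      then show ?thesis using approximatesD(3)[OF f, of x] by (simp add: fn_def LIMSEQ_const_iff)
    qed
    then show "\<phi> = \<zero>\<^bsub>rkhs\<^esub>" by auto
  qed
qed

sublocale inner_product_space rkhs
  by (rule inner_product_space_rkhs)

lemma idist_fn_limit:
  assumes f: "approximates f \<phi>" and c: "c \<in> combs"
  shows "(\<lambda>n. seminorm (f n @ scale (-1) c)) \<longlonglongrightarrow> idist rkhs \<phi> (fn c)"
proof -
  note fc = approximatesD(1)[OF f]
  note fcn = approximates_fn[OF c]
  have [simp]: "\<phi> \<in> carrier rkhs" "fn c \<in> carrier rkhs" using f fcn by auto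
  have "(\<lambda>n. form (f n) (f n) - 2 * form (f n) c + form c c) \<longlonglongrightarrow>
      inner \<phi> \<phi> - 2 * inner \<phi> (fn c) + inner (fn c) (fn c)"
    by (intro tendsto_intros form_tendsto_inner f fcn form_tendsto_inner[OF f fcn])
  then have "(\<lambda>n. sqrt (form (f n) (f n) - 2 * form (f n) c + form c c)) \<longlonglongrightarrow>
      sqrt ((idist rkhs \<phi> (fn c))\<^sup>2)"
    by (intro tendsto_real_sqrt) (subst idist_sq, use f fcn in auto)
  moreover have "form (f n) (f n) - 2 * form (f n) c + form c c =
      form (f n @ scale (-1) c) (f n @ scale (-1) c)" for n
    using form_commute[OF c fc, of n] by simp
  ultimately show ?thesis by (simp add: seminorm_def)
qed

lemma idist_fn:
  assumes "c \<in> combs" "d \<in> combs"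
  shows "idist rkhs (fn c) (fn d) = seminorm (c @ scale (-1) d)"
  using idist_fn_limit[OF approximates_fn[OF assms(1)] assms(2)] by (simp add: LIMSEQ_const_iff)

lemma idist_approximant:
  assumes f: "approximates f \<phi>" and N: "\<And>m n. N \<le> m \<Longrightarrow> N \<le> n \<Longrightarrow> seminorm (f m @ scale (-1) (f n)) < e"
    and "N \<le> n"
  shows "idist rkhs \<phi> (fn (f n)) \<le> e"
  using idist_fn_limit[OF f approximatesD(1)[OF f, of n]] N \<open>N \<le> n\<close>
  by (intro LIMSEQ_le_const2) (auto intro: less_imp_le)

text \<open>Replace the \<open>n\<close>-th term of a Cauchy sequence by a combination at distance
  below \<open>1 / (n + 1)\<close>. The combinations form a Cauchy sequence, converge pointwise
  because evaluations are bounded, and their limit lies in the space by construction.\<close>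

lemma hilbert_space_rkhs: "hilbert_space rkhs"
proof (intro hilbert_space.intro inner_product_space_rkhs hilbert_space_axioms.intro)
  show "ms.mcomplete" unfolding ms.mcomplete_def
  proof (intro allI impI)
    fix \<sigma> assume \<sigma>: "ms.MCauchy \<sigma>"
    then have \<sigma>c: "\<sigma> n \<in> carrier rkhs" for n by (auto simp: ms.MCauchy_def simp del: rkhs_simps)
    have "\<exists>c\<in>combs. idist rkhs (\<sigma> n) (fn c) < inverse (real (Suc n))" for n
    proof -
      obtain f where f: "approximates f (\<sigma> n)" using \<sigma>c[of n] by auto
      have "0 < inverse (real (Suc n)) / 2" by simp
      then obtain N where "\<And>m n'. N \<le> m \<Longrightarrow> N \<le> n' \<Longrightarrow>
          seminorm (f m @ scale (-1) (f n')) < inverse (real (Suc n)) / 2"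
        using approximatesD(2)[OF f] unfolding cauchy_def by blast
      then have "idist rkhs (\<sigma> n) (fn (f N)) \<le> inverse (real (Suc n)) / 2"
        by (rule idist_approximant[OF f]) auto
      also have "\<dots> < inverse (real (Suc n))" by simp
      finally show ?thesis using approximatesD(1)[OF f] by blast
    qed
    then obtain c where c: "\<And>n. c n \<in> combs" and close: "\<And>n. idist rkhs (\<sigma> n) (fn (c n)) < inverse (real (Suc n))"
      by metis
    note fnc = fn_in_rkhs[OF c]
    have "cauchy c" unfolding cauchy_def
    proof (intro allI impI)
      fix e :: real assume "0 < e"
      then have e: "0 < e / 3" by simp
      obtain M where M: "\<And>m n. M \<le> m \<Longrightarrow> M \<le> n \<Longrightarrow> idist rkhs (\<sigma> m) (\<sigma> n) < e / 3"
        using \<sigma> e unfolding ms.MCauchy_def by blast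
      obtain N where N: "inverse (real (Suc N)) < e / 3" using reals_Archimedean[OF e] by auto
      have small: "idist rkhs (\<sigma> n) (fn (c n)) < e / 3" if "N \<le> n" for n
      proof -
        have "inverse (real (Suc n)) \<le> inverse (real (Suc N))" using that by simp
        then show ?thesis using close[of n] N by linarith
      qed
      have "seminorm (c m @ scale (-1) (c n)) < e" if "max M N \<le> m" "max M N \<le> n" for m n
      proof -
        have "seminorm (c m @ scale (-1) (c n)) = idist rkhs (fn (c m)) (fn (c n))"
          by (simp only: idist_fn c)
        also have "\<dots> \<le> idist rkhs (fn (c m)) (\<sigma> m) + idist rkhs (\<sigma> m) (fn (c n))"
          by (rule ms.triangle[OF fnc \<sigma>c fnc])
        also have "idist rkhs (\<sigma> m) (fn (c n)) \<le> idist rkhs (\<sigma> m) (\<sigma> n) + idist rkhs (\<sigma> n) (fn (c n))"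
          by (rule ms.triangle[OF \<sigma>c \<sigma>c fnc])
        finally show ?thesis
          using M[of m n] small[of m] small[of n] that ms.commute[of "fn (c m)" "\<sigma> m"] by auto
      qed
      then show "\<exists>N. \<forall>m\<ge>N. \<forall>n\<ge>N. seminorm (c m @ scale (-1) (c n)) < e" by blast
    qed
    have "convergent (\<lambda>n. fn (c n) x)" for x
    proof (cases "x \<in> A")
      case False
      then show ?thesis by (simp add: fn_def convergent_const)
    next
      case True
      have sx: "0 \<le> seminorm [(1, x)]" using True by (intro seminorm_nonneg) auto
      show ?thesis
      proof (rule real_Cauchy_convergent, rule metric_CauchyI)
        fix e :: real assume "0 < e"
        then have "0 < e / (seminorm [(1, x)] + 1)" using sx by simp
        then obtain N where N: "\<And>m n. N \<le> m \<Longrightarrow> N \<le> n \<Longrightarrow>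
            seminorm (c m @ scale (-1) (c n)) < e / (seminorm [(1, x)] + 1)"
          using \<open>cauchy c\<close> unfolding cauchy_def by blast
        have "dist (fn (c m) x) (fn (c n) x) < e" if "N \<le> m" "N \<le> n" for m n
        proof -
          have cc: "c m @ scale (-1) (c n) \<in> combs" using c by auto
          have "fn (c m) x - fn (c n) x = form (c m @ scale (-1) (c n)) [(1, x)]"
            using cc True by (subst form_fn) auto
          then have "dist (fn (c m) x) (fn (c n) x) \<le> seminorm (c m @ scale (-1) (c n)) * seminorm [(1, x)]"
            using form_Cauchy_Schwarz[OF cc, of "[(1, x)]"] True by (simp add: dist_real_def)
          also have "\<dots> \<le> seminorm (c m @ scale (-1) (c n)) * (seminorm [(1, x)] + 1)"
            using seminorm_nonneg[OF cc] by (intro mult_left_mono) auto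
          also have "\<dots> < e" using N[OF that] sx by (simp add: field_simps)
          finally show ?thesis .
        qed
        then show "\<exists>M. \<forall>m\<ge>M. \<forall>n\<ge>M. dist (fn (c m) x) (fn (c n) x) < e" by blast
      qed
    qed
    then obtain \<phi> where "\<And>x. (\<lambda>n. fn (c n) x) \<longlonglongrightarrow> \<phi> x" unfolding convergent_def by metis
    then have \<phi>: "approximates c \<phi>" using c \<open>cauchy c\<close> by (auto simp: approximates_def)
    then have \<phi>c: "\<phi> \<in> carrier rkhs" by auto
    have "\<forall>\<^sub>F n in sequentially. idist rkhs (\<sigma> n) \<phi> < e" if "0 < e" for e
    proof -
      have e: "0 < e / 2" using that by simp
      obtain M where M: "\<And>m n. M \<le> m \<Longrightarrow> M \<le> n \<Longrightarrow> seminorm (c m @ scale (-1) (c n)) < e / 2"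
        using \<open>cauchy c\<close> e unfolding cauchy_def by blast
      obtain N where N: "inverse (real (Suc N)) < e / 2" using reals_Archimedean[OF e] by auto
      have "idist rkhs (\<sigma> n) \<phi> < e" if "max M N \<le> n" for n
      proof -
        have "inverse (real (Suc n)) \<le> inverse (real (Suc N))" using that by simp
        moreover have "idist rkhs \<phi> (fn (c n)) \<le> e / 2"
          using M that by (intro idist_approximant[OF \<phi>, of M]) auto
        moreover have "idist rkhs (\<sigma> n) \<phi> \<le> idist rkhs (\<sigma> n) (fn (c n)) + idist rkhs (fn (c n)) \<phi>"
          by (rule ms.triangle[OF \<sigma>c fnc \<phi>c])
        ultimately show ?thesis using close[of n] N ms.commute[of "fn (c n)" \<phi>] by linarith
      qed
      then show ?thesis unfolding eventually_sequentially by blast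
    qed
    then show "\<exists>\<phi>. limitin ms.mtopology \<sigma> \<phi> sequentially"
      unfolding ms.limitin_metric using \<phi>c \<sigma>c by (intro exI[of _ \<phi>]) (simp del: rkhs_simps)
  qed
qed

end

subsection \<open>Relative Property T and conditionally negative definite kernels\<close>

text \<open>Elements of \<open>BijGroup\<close> are extensional, whence the restriction. Bijectivity
  comes from the action of the inverse element.\<close>

lemma group_action_restrict:
  assumes "group \<Gamma>" and cl: "\<And>g x. g \<in> carrier \<Gamma> \<Longrightarrow> x \<in> E \<Longrightarrow> a g x \<in> E"
    and one: "\<And>x. x \<in> E \<Longrightarrow> a \<one>\<^bsub>\<Gamma>\<^esub> x = x"
    and mult: "\<And>g h x. g \<in> carrier \<Gamma> \<Longrightarrow> h \<in> carrier \<Gamma> \<Longrightarrow> x \<in> E \<Longrightarrow> a (g \<otimes>\<^bsub>\<Gamma>\<^esub> h) x = a g (a h x)"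
  shows "group_action \<Gamma> E (\<lambda>g. restrict (a g) E)"
proof -
  interpret \<Gamma>: group \<Gamma> by fact
  have Bij: "restrict (a g) E \<in> Bij E" if g: "g \<in> carrier \<Gamma>" for g
  proof -
    have "bij_betw (restrict (a g) E) E E"
      using g cl one mult[of "inv\<^bsub>\<Gamma>\<^esub> g" g] mult[of g "inv\<^bsub>\<Gamma>\<^esub> g"]
      by (intro bij_betw_byWitness[where f' = "a (inv\<^bsub>\<Gamma>\<^esub> g)"]) auto
    then show ?thesis by (simp add: Bij_def)
  qed
  have "restrict (a (g \<otimes>\<^bsub>\<Gamma>\<^esub> h)) E = compose E (restrict (a g) E) (restrict (a h) E)"
    if "g \<in> carrier \<Gamma>" "h \<in> carrier \<Gamma>" for g h
    using that cl mult by (auto simp: compose_def fun_eq_iff)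
  then have "group_hom \<Gamma> (BijGroup E) (\<lambda>g. restrict (a g) E)"
    using Bij
    by (intro group_hom.intro \<Gamma>.group_axioms group_BijGroup group_hom_axioms.intro homI)
      (auto simp: BijGroup_def)
  then show ?thesis by (simp add: group_action_def)
qed

context inner_product_space
begin

lemma idist_translate:
  assumes "x \<in> carrier V" "y \<in> carrier V" "b \<in> carrier V"
  shows "idist V (x \<oplus> b) (y \<oplus> b) = idist V x y"
proof -
  have "(idist V (x \<oplus> b) (y \<oplus> b))\<^sup>2 = (idist V x y)\<^sup>2"
    using assms by (simp add: idist_sq iprod_simps iprod_commute[of b x] iprod_commute[of b y])
  then show ?thesis by (simp add: power2_eq_iff_nonneg)
qed

text \<open>The linear combination is described by its inner products, which is all that the
  expansion of squared distances requires.\<close>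

lemma exists_linear_combination:
  assumes "finite F" "\<And>x. x \<in> F \<Longrightarrow> v x \<in> carrier V"
  shows "\<exists>s\<in>carrier V. \<forall>w\<in>carrier V. iprod V s w = (\<Sum>x\<in>F. c x * iprod V (v x) w)"
  using assms
proof (induction F)
  case (insert x F)
  then obtain s where "s \<in> carrier V" "\<forall>w\<in>carrier V. iprod V s w = (\<Sum>x\<in>F. c x * iprod V (v x) w)"
    by auto
  then show ?case
    using insert by (intro bexI[of _ "c x \<odot> v x \<oplus> s"]) (auto simp: iprod_simps)
qed (auto intro!: bexI[of _ "\<zero>"])

text \<open>For coefficients of sum 0 the terms depending on one point only cancel, and the form is
  -2 times the squared norm of the combination of the vectors \<open>v x\<close>.\<close>

lemma cnd_kernel_idist_sq:
  fixes v :: "'x \<Rightarrow> _"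
  assumes v: "\<And>x. x \<in> A \<Longrightarrow> v x \<in> carrier V"
  shows "cnd_kernel A (\<lambda>x y. (idist V (v x) (v y))\<^sup>2)"
  unfolding cnd_kernel_def
proof (intro conjI ballI allI impI)
  fix F and c :: "'x \<Rightarrow> real" assume F: "finite F \<and> F \<subseteq> A \<and> sum c F = 0"
  obtain s where s: "s \<in> carrier V" "\<And>w. w \<in> carrier V \<Longrightarrow> iprod V s w = (\<Sum>x\<in>F. c x * iprod V (v x) w)"
    using exists_linear_combination[of F v c] F v by blast
  have "(\<Sum>x\<in>F. \<Sum>y\<in>F. c x * c y * (idist V (v x) (v y))\<^sup>2) =
      (\<Sum>x\<in>F. \<Sum>y\<in>F. c x * iprod V (v x) (v x) * c y + c x * (c y * iprod V (v y) (v y)) -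
        2 * (c x * (c y * iprod V (v x) (v y))))"
    using F v by (intro sum.cong refl) (auto simp: idist_sq subset_iff algebra_simps)
  also have "\<dots> = - 2 * (\<Sum>x\<in>F. \<Sum>y\<in>F. c x * (c y * iprod V (v x) (v y)))"
    using F by (simp add: sum.distrib sum_subtractf sum_distrib_left[symmetric] sum_distrib_right[symmetric])
  also have "(\<Sum>x\<in>F. \<Sum>y\<in>F. c x * (c y * iprod V (v x) (v y))) = (\<Sum>x\<in>F. c x * iprod V s (v x))"
  proof (intro sum.cong refl)
    fix x assume "x \<in> F"
    then have "iprod V s (v x) = (\<Sum>y\<in>F. c y * iprod V (v x) (v y))"
      using F v s(2)[of "v x"] iprod_commute by (auto simp: subset_iff)
    then show "(\<Sum>y\<in>F. c x * (c y * iprod V (v x) (v y))) = c x * iprod V s (v x)"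
      by (simp add: sum_distrib_left)
  qed
  also have "\<dots> = iprod V s s"
    unfolding s(2)[OF s(1)]
    using F v s(1) by (intro sum.cong refl) (auto simp: iprod_commute[OF s(1)] subset_iff)
  finally show "(\<Sum>x\<in>F. \<Sum>y\<in>F. c x * c y * (idist V (v x) (v y))\<^sup>2) \<le> 0"
    using iprod_nonneg[OF s(1)] by simp
qed (use v in \<open>simp_all add: ms.commute\<close>)

end

definition left_invariant :: "('a, 'n) monoid_scheme \<Rightarrow> ('a \<Rightarrow> 'a \<Rightarrow> 'b) \<Rightarrow> bool"
  where "left_invariant \<Gamma> \<psi> \<longleftrightarrow>
    (\<forall>g\<in>carrier \<Gamma>. \<forall>x\<in>carrier \<Gamma>. \<forall>y\<in>carrier \<Gamma>. \<psi> (g \<otimes>\<^bsub>\<Gamma>\<^esub> x) (g \<otimes>\<^bsub>\<Gamma>\<^esub> y) = \<psi> x y)"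

locale isometric_group_action = hilbert_space V + \<Gamma>: group \<Gamma>
  for V :: "'v inner_space" (structure) and \<Gamma> :: "('a, 'n) monoid_scheme" and \<alpha> +
  assumes action: "isometric_action \<Gamma> V \<alpha>"
begin

sublocale act: group_action \<Gamma> "carrier V" \<alpha>
  using action by (simp add: isometric_action_def)

abbreviation len :: "'a \<Rightarrow> real"
  where "len g \<equiv> idist V \<zero>\<^bsub>V\<^esub> (\<alpha> g \<zero>\<^bsub>V\<^esub>)"

lemma act_in [simp]: "g \<in> carrier \<Gamma> \<Longrightarrow> x \<in> carrier V \<Longrightarrow> \<alpha> g x \<in> carrier V"
  using act.element_image by blast

lemma act_idist:
  "g \<in> carrier \<Gamma> \<Longrightarrow> x \<in> carrier V \<Longrightarrow> y \<in> carrier V \<Longrightarrow> idist V (\<alpha> g x) (\<alpha> g y) = idist V x y"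
  using action by (simp add: isometric_action_def)

lemma act_one: "x \<in> carrier V \<Longrightarrow> \<alpha> \<one>\<^bsub>\<Gamma>\<^esub> x = x"
  by (simp flip: act.id_eq_one)

lemma len_one: "len \<one>\<^bsub>\<Gamma>\<^esub> = 0"
  by (simp add: act_one)

lemma len_mult:
  assumes "g \<in> carrier \<Gamma>" "h \<in> carrier \<Gamma>"
  shows "len (g \<otimes>\<^bsub>\<Gamma>\<^esub> h) \<le> len g + len h"
  using assms ms.triangle[of "\<zero>\<^bsub>V\<^esub>" "\<alpha> g \<zero>\<^bsub>V\<^esub>" "\<alpha> g (\<alpha> h \<zero>\<^bsub>V\<^esub>)"]
  by (simp add: act.composition_rule act_idist)

lemma len_inv:
  assumes "g \<in> carrier \<Gamma>"
  shows "len (inv\<^bsub>\<Gamma>\<^esub> g) = len g"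
proof -
  have "len g = idist V (\<alpha> (inv\<^bsub>\<Gamma>\<^esub> g) \<zero>\<^bsub>V\<^esub>) (\<alpha> (inv\<^bsub>\<Gamma>\<^esub> g) (\<alpha> g \<zero>\<^bsub>V\<^esub>))"
    using assms by (simp add: act_idist)
  also have "\<alpha> (inv\<^bsub>\<Gamma>\<^esub> g) (\<alpha> g \<zero>\<^bsub>V\<^esub>) = \<zero>\<^bsub>V\<^esub>"
    using assms act_one by (simp flip: act.composition_rule)
  finally show ?thesis by (simp add: ms.commute)
qed

lemma mbounded_orbit_iff:
  assumes "S \<subseteq> carrier \<Gamma>"
  shows "ms.mbounded {\<alpha> \<gamma> \<zero>\<^bsub>V\<^esub> | \<gamma>. \<gamma> \<in> S} \<longleftrightarrow> (\<exists>C. \<forall>\<gamma>\<in>S. len \<gamma> \<le> C)"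
proof
  assume "ms.mbounded {\<alpha> \<gamma> \<zero>\<^bsub>V\<^esub> | \<gamma>. \<gamma> \<in> S}"
  then obtain y B where y: "{\<alpha> \<gamma> \<zero>\<^bsub>V\<^esub> | \<gamma>. \<gamma> \<in> S} \<subseteq> ms.mcball y B"
    unfolding ms.mbounded_def by blast
  have "len \<gamma> \<le> idist V \<zero>\<^bsub>V\<^esub> y + B" if "\<gamma> \<in> S" for \<gamma>
  proof -
    have "\<alpha> \<gamma> \<zero>\<^bsub>V\<^esub> \<in> ms.mcball y B" using y that by blast
    then show ?thesis using ms.triangle[of "\<zero>\<^bsub>V\<^esub>" y "\<alpha> \<gamma> \<zero>\<^bsub>V\<^esub>"] by simp
  qed
  then show "\<exists>C. \<forall>\<gamma>\<in>S. len \<gamma> \<le> C" by blast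
next
  assume "\<exists>C. \<forall>\<gamma>\<in>S. len \<gamma> \<le> C"
  then show "ms.mbounded {\<alpha> \<gamma> \<zero>\<^bsub>V\<^esub> | \<gamma>. \<gamma> \<in> S}"
    using assms unfolding ms.mbounded_def
    by (auto simp: subset_iff intro!: exI[of _ "\<zero>\<^bsub>V\<^esub>"])
qed

lemma cnd_kernel_orbit:
  "cnd_kernel (carrier \<Gamma>) (\<lambda>x y. (idist V (\<alpha> x \<zero>\<^bsub>V\<^esub>) (\<alpha> y \<zero>\<^bsub>V\<^esub>))\<^sup>2)"
  by (intro cnd_kernel_idist_sq) simp

lemma left_invariant_orbit:
  "left_invariant \<Gamma> (\<lambda>x y. (idist V (\<alpha> x \<zero>\<^bsub>V\<^esub>) (\<alpha> y \<zero>\<^bsub>V\<^esub>))\<^sup>2)"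
  by (simp add: left_invariant_def act.composition_rule act_idist)

end

lemma rel_property_T_onI_cnd:
  fixes \<Gamma> :: "('a, 'n) monoid_scheme"
  assumes \<Gamma>: "group \<Gamma>" and S: "S \<subseteq> carrier \<Gamma>"
    and bounded: "\<And>\<psi>. cnd_kernel (carrier \<Gamma>) \<psi> \<Longrightarrow> left_invariant \<Gamma> \<psi> \<Longrightarrow> \<exists>C. \<forall>s\<in>S. \<psi> \<one>\<^bsub>\<Gamma>\<^esub> s \<le> C"
  shows "rel_property_T_on TYPE('v) \<Gamma> S"
  unfolding rel_property_T_on_def
proof (intro allI impI, elim conjE)
  fix V :: "'v inner_space" and \<alpha> assume "hilbert_space V" "isometric_action \<Gamma> V \<alpha>"
  then interpret isometric_group_action V \<Gamma> \<alpha>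
    using \<Gamma> by (simp add: isometric_group_action_def isometric_group_action_axioms_def)
  obtain C where "\<And>s. s \<in> S \<Longrightarrow> (idist V (\<alpha> \<one>\<^bsub>\<Gamma>\<^esub> \<zero>\<^bsub>V\<^esub>) (\<alpha> s \<zero>\<^bsub>V\<^esub>))\<^sup>2 \<le> C"
    using bounded[OF cnd_kernel_orbit left_invariant_orbit] by blast
  then have "len s \<le> sqrt C" if "s \<in> S" for s
    using that by (simp add: act_one real_le_rsqrt)
  then show "ms.mbounded {\<alpha> \<gamma> \<zero>\<^bsub>V\<^esub> | \<gamma>. \<gamma> \<in> S}"
    unfolding mbounded_orbit_iff[OF S] by blast
qed

text \<open>Moving the points of a combination by \<open>T\<close> preserves the form. On functions
  this is composition with \<open>T'\<close>, since \<open>k (T y) x = k y (T' x)\<close>, so it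
  passes to pointwise limits.\<close>

lemma (in reproducing_kernel) rkhs_translation:
  assumes T: "\<And>x. x \<in> A \<Longrightarrow> T x \<in> A" and T': "\<And>x. x \<in> A \<Longrightarrow> T' x \<in> A" "\<And>x. x \<in> A \<Longrightarrow> T (T' x) = x"
    and inv: "\<And>x y. x \<in> A \<Longrightarrow> y \<in> A \<Longrightarrow> k (T x) (T y) = k x y"
  defines "\<tau> \<equiv> \<lambda>\<phi> x. if x \<in> A then \<phi> (T' x) else 0"
  shows "\<phi> \<in> carrier rkhs \<Longrightarrow> \<tau> \<phi> \<in> carrier rkhs"
    and "\<phi> \<in> carrier rkhs \<Longrightarrow> \<psi> \<in> carrier rkhs \<Longrightarrow> inner (\<tau> \<phi>) (\<tau> \<psi>) = inner \<phi> \<psi>"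
proof -
  define push where "push c = map (map_prod id T) c" for c :: "(real \<times> 'a) list"
  have lin: "lincomb (push c) h = lincomb c (\<lambda>x. h (T x))" for c h
    by (simp add: push_def lincomb_def o_def)
  have pc [simp]: "push c \<in> combs" if "c \<in> combs" for c
    using that T by (auto simp: combs_def push_def)
  have form: "form (push c) (push d) = form c d" if "c \<in> combs" "d \<in> combs" for c d
    unfolding form_def lin using that inv by (intro lincomb_cong) (auto dest: combsD)
  have push_append: "push (c @ d) = push c @ push d" for c d by (simp add: push_def)
  have push_scale: "push (scale r c) = scale r (push c)" for r c by (auto simp: push_def scale_def)
  have fn: "fn (push c) = \<tau> (fn c)" if "c \<in> combs" for c
  proof
    fix x show "fn (push c) x = \<tau> (fn c) x"
    proof (cases "x \<in> A")
      case True
      have "k (T y) x = k y (T' x)" if "y \<in> A" for y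
        using inv[OF that T'(1)[OF True]] T'(2)[OF True] by simp
      then show ?thesis
        using True T' that by (auto simp: fn_def \<tau>_def lin intro!: lincomb_cong dest: combsD)
    qed (simp add: fn_def \<tau>_def)
  qed
  have appr: "approximates (\<lambda>n. push (f n)) (\<tau> \<phi>)" if f: "approximates f \<phi>" for f \<phi>
  proof -
    note fc = approximatesD(1)[OF f]
    have "seminorm (push (f m) @ scale (-1) (push (f n))) = seminorm (f m @ scale (-1) (f n))" for m n
      unfolding push_scale[symmetric] push_append[symmetric] seminorm_def
      by (subst form) (use fc in auto)
    then have "cauchy (\<lambda>n. push (f n))" using approximatesD(2)[OF f] by (simp add: cauchy_def)
    moreover have "(\<lambda>n. fn (push (f n)) x) \<longlonglongrightarrow> \<tau> \<phi> x" for x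
      using approximatesD(3)[OF f] by (simp add: fn[OF fc] \<tau>_def)
    ultimately show ?thesis using fc by (simp add: approximates_def)
  qed
  show "\<tau> \<phi> \<in> carrier rkhs" if "\<phi> \<in> carrier rkhs" using that appr by auto
  show "inner (\<tau> \<phi>) (\<tau> \<psi>) = inner \<phi> \<psi>" if \<phi>: "\<phi> \<in> carrier rkhs" and \<psi>: "\<psi> \<in> carrier rkhs"
  proof -
    obtain f where f: "approximates f \<phi>" using \<phi> by auto
    obtain g where g: "approximates g \<psi>" using \<psi> by auto
    show ?thesis
      using form_tendsto_inner[OF f g] form[OF approximatesD(1)[OF f] approximatesD(1)[OF g]]
      by (intro inner_eqI[OF appr[OF f] appr[OF g]]) simp
  qed
qed

text \<open>For \<open>\<psi> x y = |b x - b y|^2\<close> this is twice the inner product of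
  \<open>b x - b y\<close> and \<open>b x' - b y'\<close>. Giving the two ends of each pair opposite
  coefficients makes every total 0.\<close>

lemma pd_kernel_difference:
  assumes \<psi>: "cnd_kernel A \<psi>"
  shows "pd_kernel (A \<times> A) (\<lambda>(x, y) (x', y'). \<psi> x y' + \<psi> y x' - \<psi> x x' - \<psi> y y')"
  unfolding pd_kernel_def
proof (intro conjI ballI allI impI)
  fix F and c :: "'a \<times> 'a \<Rightarrow> real" assume F: "finite F \<and> F \<subseteq> A \<times> A"
  define a where "a = (\<lambda>(p, b). if b then c p else - c p)"
  define x where "x = (\<lambda>(p :: 'a \<times> 'a, b). if b then fst p else snd p)"
  have "(\<Sum>i\<in>F \<times> UNIV. \<Sum>j\<in>F \<times> UNIV. a i * a j * \<psi> (x i) (x j)) \<le> 0"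
    using F by (intro cnd_kernel_family[OF \<psi>])
      (auto simp: a_def x_def UNIV_bool sum.cartesian_product')
  also have "(\<Sum>i\<in>F \<times> UNIV. \<Sum>j\<in>F \<times> UNIV. a i * a j * \<psi> (x i) (x j)) =
      - (\<Sum>p\<in>F. \<Sum>q\<in>F. c p * c q * (\<psi> (fst p) (snd q) + \<psi> (snd p) (fst q) - \<psi> (fst p) (fst q) - \<psi> (snd p) (snd q)))"
    by (simp add: sum.cartesian_product' UNIV_bool a_def x_def algebra_simps sum.distrib sum_subtractf sum_negf)
  finally show "0 \<le> (\<Sum>p\<in>F. \<Sum>q\<in>F. c p * c q *
      (case p of (x, y) \<Rightarrow> \<lambda>(x', y'). \<psi> x y' + \<psi> y x' - \<psi> x x' - \<psi> y y') q)"
    by (simp add: case_prod_beta)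
qed (use cnd_kernel_sym[OF \<psi>] in auto)

text \<open>The Hilbert space of the affine action consists of functions of two group elements, the
  pair \<open>(x, y)\<close> standing for the difference of the points \<open>x\<close> and \<open>y\<close> of the orbit; on such
  differences the linear part of the action is the plain translation.\<close>

theorem rel_property_T_imp_cnd_bounded:
  fixes \<Gamma> :: "('a, 'n) monoid_scheme"
  assumes \<Gamma>: "group \<Gamma>" "countable (carrier \<Gamma>)" and S: "S \<subseteq> carrier \<Gamma>" and RT: "rel_property_T \<Gamma> S"
    and \<psi>: "cnd_kernel (carrier \<Gamma>) \<psi>" and inv: "left_invariant \<Gamma> \<psi>"
  shows "\<exists>C. \<forall>s\<in>S. \<psi> \<one>\<^bsub>\<Gamma>\<^esub> s \<le> C"
proof -
  interpret \<Gamma>: group \<Gamma> by fact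
  define A where "A = carrier \<Gamma> \<times> carrier \<Gamma>"
  define k where "k = (\<lambda>(x, y) (x', y'). \<psi> x y' + \<psi> y x' - \<psi> x x' - \<psi> y y')"
  interpret reproducing_kernel A k
    by standard (unfold A_def k_def, rule pd_kernel_difference[OF \<psi>])
  define T where "T g = map_prod (\<lambda>x. g \<otimes>\<^bsub>\<Gamma>\<^esub> x) (\<lambda>x. g \<otimes>\<^bsub>\<Gamma>\<^esub> x)" for g
  define \<tau> where "\<tau> g \<phi> p = (if p \<in> A then \<phi> (T (inv\<^bsub>\<Gamma>\<^esub> g) p) else 0)" for g and \<phi> :: "'a \<times> 'a \<Rightarrow> real" and p
  \<comment> \<open>The cocycle of the affine action: the vector from the base point of the orbit to
    its translate by \<open>g\<close>.\<close>
  define b where "b g = fn [(1, (g, \<one>\<^bsub>\<Gamma>\<^esub>))]" for g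
  define a where "a g \<phi> = \<tau> g \<phi> \<oplus>\<^bsub>rkhs\<^esub> b g" for g \<phi>
  have gA: "(g, \<one>\<^bsub>\<Gamma>\<^esub>) \<in> A" if "g \<in> carrier \<Gamma>" for g using that by (simp add: A_def)
  have TA [simp]: "T g p \<in> A" if "g \<in> carrier \<Gamma>" "p \<in> A" for g p
    using that by (auto simp: A_def T_def)
  have Tmult: "T (g \<otimes>\<^bsub>\<Gamma>\<^esub> h) p = T g (T h p)" if "g \<in> carrier \<Gamma>" "h \<in> carrier \<Gamma>" "p \<in> A" for g h p
    using that by (auto simp: A_def T_def \<Gamma>.m_assoc)
  have Tone: "T \<one>\<^bsub>\<Gamma>\<^esub> p = p" if "p \<in> A" for p using that by (auto simp: A_def T_def)
  have Tinv: "T g (T (inv\<^bsub>\<Gamma>\<^esub> g) p) = p" if "g \<in> carrier \<Gamma>" "p \<in> A" for g p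
    using that by (simp add: Tone flip: Tmult)
  have kT: "k (T g p) (T g q) = k p q" if "g \<in> carrier \<Gamma>" "p \<in> A" "q \<in> A" for g p q
    using that inv by (auto simp: A_def T_def k_def left_invariant_def)
  have kone: "k (\<one>\<^bsub>\<Gamma>\<^esub>, \<one>\<^bsub>\<Gamma>\<^esub>) p = 0" for p by (cases p) (simp add: k_def)
  have \<tau>: "\<tau> g \<phi> \<in> carrier rkhs" "iprod rkhs (\<tau> g \<phi>) (\<tau> g \<theta>) = iprod rkhs \<phi> \<theta>"
    if "g \<in> carrier \<Gamma>" "\<phi> \<in> carrier rkhs" "\<theta> \<in> carrier rkhs" for g \<phi> \<theta>
    using rkhs_translation(1)[of "T g" "T (inv\<^bsub>\<Gamma>\<^esub> g)" \<phi>]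
      rkhs_translation(2)[of "T g" "T (inv\<^bsub>\<Gamma>\<^esub> g)" \<phi> \<theta>] that Tinv kT
    by (simp_all add: \<tau>_def[abs_def] del: rkhs_simps(1))
  have b: "b g \<in> carrier rkhs" if "g \<in> carrier \<Gamma>" for g
    unfolding b_def using gA[OF that] by (intro fn_in_rkhs) simp
  have bval: "b g p = (if p \<in> A then k (g, \<one>\<^bsub>\<Gamma>\<^esub>) p else 0)" for g p by (simp add: b_def fn_def)
  have a: "a g \<phi> \<in> carrier rkhs" if "g \<in> carrier \<Gamma>" "\<phi> \<in> carrier rkhs" for g \<phi>
    unfolding a_def using that \<tau>(1) b by (intro M.a_closed) auto
  \<comment> \<open>The operator \<open>\<tau>\<close> puts 0 off \<open>A\<close>, so the neutral
    element acts trivially exactly because all functions in the space vanish there.\<close>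
  have off: "\<phi> p = 0" if \<phi>: "\<phi> \<in> carrier rkhs" and p: "p \<notin> A" for \<phi> p
  proof -
    obtain f where "approximates f \<phi>" using \<phi> by auto
    from approximatesD(3)[OF this, of p] show ?thesis using p by (simp add: fn_def LIMSEQ_const_iff)
  qed
  \<comment> \<open>The difference of \<open>gh\<close> and 1 is the difference of \<open>gh\<close>
    and \<open>g\<close>, which is the translate of that of \<open>h\<close> and 1, plus the
    difference of \<open>g\<close> and 1.\<close>
  have cocycle: "b (g \<otimes>\<^bsub>\<Gamma>\<^esub> h) p = b h (T (inv\<^bsub>\<Gamma>\<^esub> g) p) + b g p"
    if "g \<in> carrier \<Gamma>" "h \<in> carrier \<Gamma>" "p \<in> A" for g h p
  proof -
    have "k (h, \<one>\<^bsub>\<Gamma>\<^esub>) (T (inv\<^bsub>\<Gamma>\<^esub> g) p) = k (T g (h, \<one>\<^bsub>\<Gamma>\<^esub>)) (T g (T (inv\<^bsub>\<Gamma>\<^esub> g) p))"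
      using that by (intro kT[symmetric]) (auto simp: A_def intro: TA[unfolded A_def])
    also have "\<dots> = k (g \<otimes>\<^bsub>\<Gamma>\<^esub> h, g) p" using that by (simp add: Tinv) (simp add: T_def)
    finally show ?thesis using that by (cases p) (simp add: bval, simp add: k_def)
  qed
  define \<alpha> where "\<alpha> g = restrict (a g) (carrier rkhs)" for g
  have "group_action \<Gamma> (carrier rkhs) \<alpha>"
    unfolding \<alpha>_def[abs_def]
  proof (rule group_action_restrict[OF \<Gamma>(1) a])
    fix \<phi> assume \<phi>: "\<phi> \<in> carrier rkhs"
    show "a \<one>\<^bsub>\<Gamma>\<^esub> \<phi> = \<phi>"
      using off[OF \<phi>] kone by (auto simp: a_def \<tau>_def Tone bval fun_eq_iff)
    fix g h assume gh: "g \<in> carrier \<Gamma>" "h \<in> carrier \<Gamma>"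
    show "a (g \<otimes>\<^bsub>\<Gamma>\<^esub> h) \<phi> = a g (a h \<phi>)"
    proof
      fix p show "a (g \<otimes>\<^bsub>\<Gamma>\<^esub> h) \<phi> p = a g (a h \<phi>) p"
        using gh cocycle[OF gh, of p]
        by (cases "p \<in> A") (auto simp: a_def \<tau>_def \<Gamma>.inv_mult_group Tmult bval)
    qed
  qed
  moreover have "idist rkhs (\<alpha> g \<phi>) (\<alpha> g \<theta>) = idist rkhs \<phi> \<theta>"
    if "g \<in> carrier \<Gamma>" "\<phi> \<in> carrier rkhs" "\<theta> \<in> carrier rkhs" for g \<phi> \<theta>
  proof -
    have "idist rkhs (\<alpha> g \<phi>) (\<alpha> g \<theta>) = idist rkhs (\<tau> g \<phi>) (\<tau> g \<theta>)"
      unfolding \<alpha>_def restrict_apply'[OF that(2)] restrict_apply'[OF that(3)] a_def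
      using that b \<tau>(1) by (intro idist_translate) auto
    moreover have "(idist rkhs (\<tau> g \<phi>) (\<tau> g \<theta>))\<^sup>2 = (idist rkhs \<phi> \<theta>)\<^sup>2"
      unfolding idist_sq[OF \<tau>(1)[OF that(1,2,2)] \<tau>(1)[OF that(1,3,3)]] idist_sq[OF that(2,3)]
      using that by (simp only: \<tau>(2))
    ultimately show ?thesis by (simp add: power2_eq_iff_nonneg)
  qed
  ultimately have iso: "isometric_action \<Gamma> rkhs \<alpha>"
    unfolding isometric_action_def by blast
  interpret act: isometric_group_action rkhs \<Gamma> \<alpha>
    using iso hilbert_space_rkhs \<Gamma>
    by (simp add: isometric_group_action_def isometric_group_action_axioms_def)
  \<comment> \<open>The points of this Hilbert space are functions on pairs of group elements, so
    Property T is first transferred to that type; countability enters here.\<close>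
  have "rel_property_T_on TYPE('a \<times> 'a \<Rightarrow> real) \<Gamma> S"
    by (rule rel_property_T_all_hilbert_spaces[OF \<Gamma> S RT])
  then have "ms.mbounded {\<alpha> \<gamma> \<zero>\<^bsub>rkhs\<^esub> | \<gamma>. \<gamma> \<in> S}"
    using iso hilbert_space_rkhs unfolding rel_property_T_on_def by blast
  then obtain C where C: "\<And>s. s \<in> S \<Longrightarrow> act.len s \<le> C"
    unfolding act.mbounded_orbit_iff[OF S] by blast
  \<comment> \<open>The orbit of 0 consists of the vectors \<open>b s\<close>, of squared norm
    \<open>k (s, 1) (s, 1)\<close>, which is twice \<open>\<psi> 1 s\<close>.\<close>
  have "\<psi> \<one>\<^bsub>\<Gamma>\<^esub> s \<le> C\<^sup>2 / 2" if s: "s \<in> S" for s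
  proof -
    have sc: "s \<in> carrier \<Gamma>" using s S by auto
    have "\<alpha> s \<zero>\<^bsub>rkhs\<^esub> = a s \<zero>\<^bsub>rkhs\<^esub>" unfolding \<alpha>_def by (rule restrict_apply') (rule M.zero_closed)
    also have "\<dots> = b s" by (auto simp: a_def \<tau>_def)
    finally have "(act.len s)\<^sup>2 = iprod rkhs (b s) (b s)"
      using b[OF sc] by (simp add: idist_sq[OF M.zero_closed] del: rkhs_simps)
    also have "\<dots> = inner (b s) (b s)" by simp
    also have "\<dots> = 2 * \<psi> \<one>\<^bsub>\<Gamma>\<^esub> s"
      unfolding b_def using sc gA[OF sc] cnd_kernel_sym[OF \<psi>, of s "\<one>\<^bsub>\<Gamma>\<^esub>"] cnd_kernel_diag[OF \<psi>]
      by (subst inner_fn; simp add: form_def) (simp add: k_def)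
    finally show ?thesis using power_mono[OF C[OF s], of 2] by simp
  qed
  then show ?thesis by blast
qed

text \<open>Actions pull back along homomorphisms. This serves for the projection of the wreath
  product to \<open>G\<close> and for the embeddings of \<open>G\<close> and
  \<open>H\<close>.\<close>

lemma rel_property_T_hom_image:
  assumes \<Gamma>: "group \<Gamma>" and \<Delta>: "group \<Delta>" and f: "f \<in> hom \<Gamma> \<Delta>" and T: "rel_property_T \<Gamma> S"
  shows "rel_property_T \<Delta> (f ` S)"
  unfolding rel_property_T_def rel_property_T_on_def
proof (intro allI impI, elim conjE)
  fix V :: "(nat \<Rightarrow> real) inner_space" and \<alpha> assume V: "hilbert_space V" and \<alpha>: "isometric_action \<Delta> V \<alpha>"
  then have "\<alpha> \<in> hom \<Delta> (BijGroup (carrier V))"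
    by (simp add: isometric_action_def group_action_def group_hom_def group_hom_axioms_def)
  then have "\<alpha> \<circ> f \<in> hom \<Gamma> (BijGroup (carrier V))" by (rule hom_compose[OF f])
  then have "isometric_action \<Gamma> V (\<alpha> \<circ> f)"
    using \<alpha> f \<Gamma> by (auto simp: isometric_action_def group_action_def group_hom_def
        group_hom_axioms_def group_BijGroup hom_in_carrier)
  then have "Metric_space.mbounded (carrier V) (idist V) {(\<alpha> \<circ> f) \<gamma> \<zero>\<^bsub>V\<^esub> | \<gamma>. \<gamma> \<in> S}"
    using T V unfolding rel_property_T_def rel_property_T_on_def by blast
  moreover have "{(\<alpha> \<circ> f) \<gamma> \<zero>\<^bsub>V\<^esub> | \<gamma>. \<gamma> \<in> S} = {\<alpha> \<gamma> \<zero>\<^bsub>V\<^esub> | \<gamma>. \<gamma> \<in> f ` S}" by auto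
  ultimately show "Metric_space.mbounded (carrier V) (idist V) {\<alpha> \<gamma> \<zero>\<^bsub>V\<^esub> | \<gamma>. \<gamma> \<in> f ` S}" by simp
qed

subsection \<open>Energy of finite configurations\<close>

definition pair_sum :: "('a \<Rightarrow> 'a \<Rightarrow> real) \<Rightarrow> 'a multiset \<Rightarrow> 'a multiset \<Rightarrow> real"
  where "pair_sum \<psi> u v = (\<Sum>x\<in>#u. \<Sum>y\<in>#v. \<psi> x y)"

text \<open>For \<open>\<psi> x y = |b x - b y|^2\<close> and configurations of equal size, this is
  the squared distance between the sum of \<open>b\<close> over \<open>u\<close> and the sum of
  \<open>b\<close> over \<open>v\<close>.\<close>

definition energy :: "('a \<Rightarrow> 'a \<Rightarrow> real) \<Rightarrow> 'a multiset \<Rightarrow> 'a multiset \<Rightarrow> real"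
  where "energy \<psi> u v = pair_sum \<psi> u v - pair_sum \<psi> u u / 2 - pair_sum \<psi> v v / 2"

lemma sum_mset_count:
  fixes f :: "'a \<Rightarrow> real"
  assumes "finite U" "set_mset u \<subseteq> U"
  shows "(\<Sum>x\<in>#u. f x) = (\<Sum>x\<in>U. real (count u x) * f x)"
  using assms(2)
proof (induction u)
  case (add a u)
  have "(\<Sum>x\<in>U. real (count (add_mset a u) x) * f x) =
      (\<Sum>x\<in>U. real (count u x) * f x + (if x = a then f a else 0))"
    by (intro sum.cong refl) (auto simp: algebra_simps)
  then show ?case using add assms(1) by (simp add: sum.distrib)
qed simp

lemma sum_mset_nonnegI: "(\<And>x. x \<in># u \<Longrightarrow> (0::real) \<le> f x) \<Longrightarrow> 0 \<le> (\<Sum>x\<in>#u. f x)"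
  by (induction u) auto

lemma pair_sum_add [simp]:
  "pair_sum \<psi> (u + u') v = pair_sum \<psi> u v + pair_sum \<psi> u' v"
  "pair_sum \<psi> v (u + u') = pair_sum \<psi> v u + pair_sum \<psi> v u'"
  by (simp_all add: pair_sum_def sum_mset.distrib)

lemma pair_sum_commute:
  assumes "\<And>x y. x \<in> A \<Longrightarrow> y \<in> A \<Longrightarrow> \<psi> x y = \<psi> y x" "set_mset u \<subseteq> A" "set_mset v \<subseteq> A"
  shows "pair_sum \<psi> u v = pair_sum \<psi> v u"
proof -
  have "pair_sum \<psi> u v = (\<Sum>x\<in>#u. \<Sum>y\<in>#v. \<psi> y x)"
    unfolding pair_sum_def using assms
    by (intro arg_cong[of _ _ sum_mset] image_mset_cong) (auto simp: subset_iff)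
  also have "\<dots> = pair_sum \<psi> v u"
    unfolding pair_sum_def by (rule sum_mset.swap)
  finally show ?thesis .
qed

lemma energy_single: "\<psi> x x = 0 \<Longrightarrow> \<psi> y y = 0 \<Longrightarrow> energy \<psi> {#x#} {#y#} = \<psi> x y"
  by (simp add: energy_def pair_sum_def)

lemma energy_self: "energy \<psi> u u = 0"
  by (simp add: energy_def)

lemma energy_image:
  assumes "\<And>x y. x \<in> A \<Longrightarrow> y \<in> A \<Longrightarrow> \<psi> (f x) (f y) = \<psi> x y" "set_mset u \<subseteq> A" "set_mset v \<subseteq> A"
  shows "energy \<psi> (image_mset f u) (image_mset f v) = energy \<psi> u v"
proof -
  have "pair_sum \<psi> (image_mset f u) (image_mset f v) = pair_sum \<psi> u v"
    if "set_mset u \<subseteq> A" "set_mset v \<subseteq> A" for u v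
    unfolding pair_sum_def image_mset.compositionality o_def using that assms(1)
    by (intro arg_cong[of _ _ sum_mset] image_mset_cong) (auto simp: subset_iff)
  then show ?thesis using assms by (simp add: energy_def)
qed

context
  fixes A :: "'a set" and \<psi> :: "'a \<Rightarrow> 'a \<Rightarrow> real"
  assumes \<psi>: "cnd_kernel A \<psi>"
begin

lemma pair_commute: "set_mset u \<subseteq> A \<Longrightarrow> set_mset v \<subseteq> A \<Longrightarrow> pair_sum \<psi> u v = pair_sum \<psi> v u"
  by (rule pair_sum_commute[of A]) (auto intro: cnd_kernel_sym[OF \<psi>])

lemma energy_translate:
  assumes "set_mset u \<subseteq> A" "set_mset v \<subseteq> A" "set_mset w \<subseteq> A"
  shows "energy \<psi> (u + w) (v + w) = energy \<psi> u v"
  using pair_commute[of u w]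
    pair_commute[of v w] assms
  by (simp add: energy_def field_simps)

text \<open>Coefficients of sum 0 on configurations of size \<open>m\<close> induce coefficients
  \<open>d\<close> on points, of sum \<open>m * 0\<close>. The self-energies drop out, and the form
  of the energy becomes the form of \<open>\<psi>\<close> with the coefficients
  \<open>d\<close>.\<close>

lemma cnd_kernel_energy: "cnd_kernel {u. set_mset u \<subseteq> A \<and> size u = m} (energy \<psi>)"
  unfolding cnd_kernel_def
proof (intro conjI ballI allI impI)
  fix u v assume "u \<in> {u. set_mset u \<subseteq> A \<and> size u = m}" "v \<in> {u. set_mset u \<subseteq> A \<and> size u = m}"
  then show "energy \<psi> u v = energy \<psi> v u"
    using pair_commute[of u v] by (simp add: energy_def)
next
  fix F and c :: "'a multiset \<Rightarrow> real"
  assume F: "finite F \<and> F \<subseteq> {u. set_mset u \<subseteq> A \<and> size u = m} \<and> sum c F = 0"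
  define U where "U = (\<Union>u\<in>F. set_mset u)"
  define d where "d x = (\<Sum>u\<in>F. c u * real (count u x))" for x
  have U: "finite U" "U \<subseteq> A" "\<And>u. u \<in> F \<Longrightarrow> set_mset u \<subseteq> U" using F by (auto simp: U_def)
  have "sum d U = (\<Sum>u\<in>F. c u * (\<Sum>x\<in>U. real (count u x) * 1))"
    unfolding d_def by (subst sum.swap) (simp add: sum_distrib_left)
  also have "\<dots> = (\<Sum>u\<in>F. c u * real m)"
  proof (intro sum.cong refl)
    fix u assume "u \<in> F"
    then show "c u * (\<Sum>x\<in>U. real (count u x) * 1) = c u * real m"
      using F sum_mset_count[OF U(1) U(3), of u "\<lambda>_. 1"] by auto
  qed
  also have "\<dots> = 0" using F by (simp flip: sum_distrib_right)
  finally have d0: "sum d U = 0" .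
  have pair: "pair_sum \<psi> u v = (\<Sum>x\<in>U. \<Sum>y\<in>U. real (count u x) * real (count v y) * \<psi> x y)"
    if "u \<in> F" "v \<in> F" for u v
    unfolding pair_sum_def sum_mset_count[OF U(1) U(3)[OF that(1)]] sum_mset_count[OF U(1) U(3)[OF that(2)]]
    by (simp add: sum_distrib_left mult.assoc)
  have "(\<Sum>u\<in>F. \<Sum>v\<in>F. c u * c v * energy \<psi> u v) = (\<Sum>u\<in>F. \<Sum>v\<in>F. c u * c v * pair_sum \<psi> u v -
      c u * pair_sum \<psi> u u / 2 * c v - c u * (c v * pair_sum \<psi> v v / 2))"
    by (intro sum.cong refl) (simp add: energy_def algebra_simps)
  also have "\<dots> = (\<Sum>u\<in>F. \<Sum>v\<in>F. c u * c v * pair_sum \<psi> u v) -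
      (\<Sum>u\<in>F. c u * pair_sum \<psi> u u / 2 * (\<Sum>v\<in>F. c v)) - (\<Sum>u\<in>F. c u) * (\<Sum>v\<in>F. c v * pair_sum \<psi> v v / 2)"
    by (simp only: sum_subtractf sum_product) (simp only: sum_distrib_left)
  also have "\<dots> = (\<Sum>u\<in>F. \<Sum>v\<in>F. c u * c v * pair_sum \<psi> u v)"
    using F by simp
  also have "\<dots> = (\<Sum>u\<in>F. \<Sum>v\<in>F. \<Sum>x\<in>U. \<Sum>y\<in>U. (c u * real (count u x)) * (c v * real (count v y)) * \<psi> x y)"
    by (intro sum.cong refl) (simp add: pair sum_distrib_left mult_ac)
  also have "\<dots> = (\<Sum>u\<in>F. \<Sum>x\<in>U. \<Sum>v\<in>F. \<Sum>y\<in>U. (c u * real (count u x)) * (c v * real (count v y)) * \<psi> x y)"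
    by (intro sum.cong refl sum.swap)
  also have "\<dots> = (\<Sum>x\<in>U. \<Sum>u\<in>F. \<Sum>y\<in>U. \<Sum>v\<in>F. (c u * real (count u x)) * (c v * real (count v y)) * \<psi> x y)"
    by (subst sum.swap, intro sum.cong refl sum.swap)
  also have "\<dots> = (\<Sum>x\<in>U. \<Sum>y\<in>U. \<Sum>u\<in>F. \<Sum>v\<in>F. (c u * real (count u x)) * (c v * real (count v y)) * \<psi> x y)"
    by (intro sum.cong refl sum.swap)
  also have "\<dots> = (\<Sum>x\<in>U. \<Sum>y\<in>U. d x * d y * \<psi> x y)"
    unfolding d_def sum_product by (simp add: sum_distrib_right)
  also have "\<dots> \<le> 0" by (rule cnd_kernelD[OF \<psi> U(1,2) d0])
  finally show "(\<Sum>u\<in>F. \<Sum>v\<in>F. c u * c v * energy \<psi> u v) \<le> 0" .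
qed (simp add: energy_self)

lemma energy_nonneg:
  assumes "set_mset u \<subseteq> A" "set_mset v \<subseteq> A" "size u = size v"
  shows "0 \<le> energy \<psi> u v"
  using cnd_kernel_nonneg[OF cnd_kernel_energy[of "size v"], of u v] assms by simp

lemma energy_le:
  assumes u: "set_mset u \<subseteq> B" and v: "set_mset v \<subseteq> B" and B: "B \<subseteq> A"
    and R: "\<And>x y. x \<in> B \<Longrightarrow> y \<in> B \<Longrightarrow> \<psi> x y \<le> R"
  shows "energy \<psi> u v \<le> real (size u) * real (size v) * R"
proof -
  have nonneg: "0 \<le> pair_sum \<psi> w w" if "set_mset w \<subseteq> B" for w
    unfolding pair_sum_def using that B cnd_kernel_nonneg[OF \<psi>]
    by (intro sum_mset_nonnegI) (auto simp: subset_iff)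
  have "pair_sum \<psi> u v \<le> (\<Sum>x\<in>#u. \<Sum>y\<in>#v. R)"
    unfolding pair_sum_def using u v R by (intro sum_mset_mono) (auto simp: subset_iff)
  then show ?thesis
    using nonneg[OF u] nonneg[OF v] by (simp add: energy_def mult.assoc)
qed

end

text \<open>The correlation of the characters of the field attached to \<open>u\<close> and
  \<open>v\<close>, up to the normalisation of \<open>t\<close>. Integrating over the uniform phase
  gives 0 for different sizes; the Gaussian part gives the exponential.\<close>

definition gauss_kernel :: "('a \<Rightarrow> 'a \<Rightarrow> real) \<Rightarrow> real \<Rightarrow> 'a multiset \<Rightarrow> 'a multiset \<Rightarrow> real"
  where "gauss_kernel \<psi> t u v = (if size u = size v then exp (- t * energy \<psi> u v) else 0)"

lemma pd_kernel_gauss: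
  assumes "cnd_kernel A \<psi>" "0 \<le> t"
  shows "pd_kernel {u. set_mset u \<subseteq> A} (gauss_kernel \<psi> t)"
proof -
  have "pd_kernel {u \<in> {u. set_mset u \<subseteq> A}. size u = m} (\<lambda>u v. exp (- t * energy \<psi> u v))" for m
    using Schoenberg[OF cnd_kernel_energy[OF assms(1)] assms(2), of m] by simp
  then show ?thesis
    unfolding gauss_kernel_def[abs_def] by (rule pd_kernel_classes)
qed

subsection \<open>Averaging over the lamps\<close>

text \<open>The correlation of the characters of \<open>u\<close> and \<open>v\<close> weighted by
  the product of \<open>cos^2 (\<zeta> x / 2)\<close> over \<open>D\<close>. Each factor equals
  \<open>(1 + exp (i \<zeta> x)) (1 + exp (- i \<zeta> x)) / 4\<close>; expanding the products,
  \<open>P\<close> and \<open>N\<close> record where the exponential is chosen.\<close>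

definition lamp_kernel :: "('a multiset \<Rightarrow> 'a multiset \<Rightarrow> real) \<Rightarrow> 'a set \<Rightarrow> 'a multiset \<Rightarrow> 'a multiset \<Rightarrow> real"
  where "lamp_kernel \<kappa> D u v =
    (\<Sum>P\<in>Pow D. \<Sum>N\<in>Pow D. \<kappa> (u + mset_set P) (v + mset_set N)) / 4 ^ card D"

lemma sum_Pow_insert:
  fixes f :: "'a set \<Rightarrow> real"
  assumes "finite D" "x \<notin> D"
  shows "(\<Sum>P\<in>Pow (insert x D). f P) = (\<Sum>P\<in>Pow D. f P + f (insert x P))"
proof -
  have "inj_on (insert x) (Pow D)" using assms(2) by (auto simp: inj_on_def)
  moreover have "Pow D \<inter> insert x ` Pow D = {}" using assms(2) by auto
  ultimately show ?thesis
    using assms(1) by (simp add: Pow_insert sum.union_disjoint sum.reindex sum.distrib)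
qed

lemma mset_set_insert_Pow:
  "finite D \<Longrightarrow> x \<notin> D \<Longrightarrow> P \<in> Pow D \<Longrightarrow> mset_set (insert x P) = add_mset x (mset_set P)"
  by (intro mset_set.insert) (auto intro: finite_subset)

lemma lamp_kernel_insert:
  assumes D: "finite D" "x \<notin> D"
  shows "lamp_kernel \<kappa> (insert x D) u v = (lamp_kernel \<kappa> D u v + lamp_kernel \<kappa> D u (add_mset x v) +
    lamp_kernel \<kappa> D (add_mset x u) v + lamp_kernel \<kappa> D (add_mset x u) (add_mset x v)) / 4"
  unfolding lamp_kernel_def sum_Pow_insert[OF D]
  using D by (simp add: mset_set_insert_Pow sum.distrib add_divide_distrib divide_divide_eq_left)

lemma lamp_kernel_image:
  assumes f: "inj_on f A" and \<kappa>: "\<And>u v. set_mset u \<subseteq> A \<Longrightarrow> set_mset v \<subseteq> A \<Longrightarrow> \<kappa> (image_mset f u) (image_mset f v) = \<kappa> u v"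
    and D: "finite D" "D \<subseteq> A" and u: "set_mset u \<subseteq> A" "set_mset v \<subseteq> A"
  shows "lamp_kernel \<kappa> (f ` D) (image_mset f u) (image_mset f v) = lamp_kernel \<kappa> D u v"
proof -
  have fD: "inj_on f D" using f D(2) by (rule inj_on_subset)
  have re: "(\<Sum>P\<in>Pow (f ` D). h P) = (\<Sum>P\<in>Pow D. h (f ` P))" for h :: "_ \<Rightarrow> real"
    using inj_on_image_Pow[OF fD] by (simp add: sum.reindex flip: image_Pow_surj)
  have im: "mset_set (f ` P) = image_mset f (mset_set P)" if "P \<in> Pow D" for P
    using that fD by (intro image_mset_mset_set[symmetric]) (auto intro: inj_on_subset)
  have sub: "set_mset (mset_set P) \<subseteq> A" if "P \<in> Pow D" for P
    using that D finite_subset[of P D] by auto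
  have "(\<Sum>P\<in>Pow (f ` D). \<Sum>N\<in>Pow (f ` D). \<kappa> (image_mset f u + mset_set P) (image_mset f v + mset_set N)) =
      (\<Sum>P\<in>Pow D. \<Sum>N\<in>Pow D. \<kappa> (u + mset_set P) (v + mset_set N))"
    unfolding re
  proof (intro sum.cong refl)
    fix P N assume "P \<in> Pow D" "N \<in> Pow D"
    then show "\<kappa> (image_mset f u + mset_set (f ` P)) (image_mset f v + mset_set (f ` N)) =
        \<kappa> (u + mset_set P) (v + mset_set N)"
      using \<kappa>[of "u + mset_set P" "v + mset_set N"] sub[of P] sub[of N] u im[of P] im[of N] by simp
  qed
  then show ?thesis using fD by (simp add: lamp_kernel_def card_image)
qed

text \<open>The average over the subsets realises the lamp at \<open>x\<close> as the product by
  \<open>(1 + W) (1 + W\<^sup>-\<^sup>1) / 4\<close>, where the operator \<open>W\<close> adds \<open>x\<close> to a configuration, whenever the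
  two lamp values differ.  Since \<open>(1 + W) (1 + W\<^sup>-\<^sup>1) / 4 + (1 - W) (1 - W\<^sup>-\<^sup>1) / 4 = 1\<close>, this is
  a sum of two positive definite terms, the second one restricted to equal lamp values.\<close>

lemma pd_kernel_lamp:
  fixes \<kappa> :: "'a multiset \<Rightarrow> 'a multiset \<Rightarrow> real"
  assumes pd: "pd_kernel {u. set_mset u \<subseteq> A} \<kappa>"
    and tr: "\<And>u v w. set_mset u \<subseteq> A \<Longrightarrow> set_mset v \<subseteq> A \<Longrightarrow> set_mset w \<subseteq> A \<Longrightarrow> \<kappa> (u + w) (v + w) = \<kappa> u v"
    and F: "finite F" "F \<subseteq> A"
  shows "pd_kernel {(l :: 'a \<Rightarrow> 'h, u). set_mset u \<subseteq> A}
    (\<lambda>s s'. lamp_kernel \<kappa> {x\<in>F. fst s x \<noteq> fst s' x} (snd s) (snd s'))"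
  using F
proof (induction F)
  case empty
  have "pd_kernel {(l :: 'a \<Rightarrow> 'h, u). set_mset u \<subseteq> A} (\<lambda>s s'. \<kappa> (snd s) (snd s'))"
    by (rule pd_kernel_pullback[OF pd]) auto
  then show ?case by (simp add: lamp_kernel_def)
next
  case (insert x F)
  define B where "B = {(l :: 'a \<Rightarrow> 'h, u). set_mset u \<subseteq> A}"
  define k where "k s s' = lamp_kernel \<kappa> {x\<in>F. fst s x \<noteq> fst s' x} (snd s) (snd s')" for s s' :: "('a \<Rightarrow> 'h) \<times> 'a multiset"
  define T where "T b s = (fst s, if b then add_mset x (snd s) else snd s)" for b and s :: "('a \<Rightarrow> 'h) \<times> 'a multiset"
  have pdk: "pd_kernel B k" using insert unfolding B_def k_def[abs_def] by auto
  have T: "T b s \<in> B" if "s \<in> B" for b s using that insert by (auto simp: B_def T_def)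
  \<comment> \<open>The value \<open>e = 1\<close> stands for the term with \<open>1 + W\<close>,
    the value \<open>e = -1\<close> for the term with \<open>1 - W\<close>.\<close>
  define p where "p e s s' = (\<Sum>i\<in>UNIV. \<Sum>j\<in>UNIV. (if i then e else 1) * (if j then e else 1) * k (T i s) (T j s'))" for e :: real and s s'
  have pdp: "pd_kernel B (p e)" for e
    unfolding p_def[abs_def] by (rule pd_kernel_combination[OF pdk _ T]) auto
  have "pd_kernel {s \<in> B. fst s x = c} (p (-1))" for c
    by (rule pd_kernel_subset[OF pdp]) auto
  then have "pd_kernel B (\<lambda>s s'. 1/4 * p 1 s s' + 1/4 * (if fst s x = fst s' x then p (-1) s s' else 0))"
    by (intro pd_kernel_add pd_kernel_scale pdp pd_kernel_classes) auto
  moreover have "1/4 * p 1 s s' + 1/4 * (if fst s x = fst s' x then p (-1) s s' else 0) =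
      lamp_kernel \<kappa> {y\<in>insert x F. fst s y \<noteq> fst s' y} (snd s) (snd s')" if s: "s \<in> B" "s' \<in> B" for s s'
  proof -
    define D where "D = {y\<in>F. fst s y \<noteq> fst s' y}"
    have D: "finite D" "x \<notin> D" "D \<subseteq> A" using insert by (auto simp: D_def)
    have k: "k (T i s) (T j s') = lamp_kernel \<kappa> D (snd (T i s)) (snd (T j s'))" for i j
      by (simp add: k_def T_def D_def)
    show ?thesis
    proof (cases "fst s x = fst s' x")
      case True
      have sub: "set_mset (mset_set P) \<subseteq> A" if "P \<in> Pow D" for P
        using that D finite_subset[of P D] by auto
      \<comment> \<open>Adding \<open>x\<close> on both sides changes nothing, which expresses that
        \<open>W\<close> is unitary. In the sum of the two terms the mixed contributions cancel and
        the four others add up to the kernel without the lamp.\<close>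
      have "\<kappa> (add_mset x (snd s + mset_set P)) (add_mset x (snd s' + mset_set N)) =
          \<kappa> (snd s + mset_set P) (snd s' + mset_set N)" if "P \<in> Pow D" "N \<in> Pow D" for P N
        using tr[of "snd s + mset_set P" "snd s' + mset_set N" "{#x#}"] s sub[OF that(1)] sub[OF that(2)] insert
        by (auto simp: B_def)
      then have "lamp_kernel \<kappa> D (add_mset x (snd s)) (add_mset x (snd s')) = lamp_kernel \<kappa> D (snd s) (snd s')"
        by (simp add: lamp_kernel_def)
      moreover have "{y\<in>insert x F. fst s y \<noteq> fst s' y} = D" using True by (auto simp: D_def)
      ultimately show ?thesis
        using True by (simp add: p_def UNIV_bool k) (simp add: T_def field_simps)
    next
      case False
      then have "{y\<in>insert x F. fst s y \<noteq> fst s' y} = insert x D" by (auto simp: D_def)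
      then show ?thesis
        using False lamp_kernel_insert[OF D(1,2), of \<kappa> "snd s" "snd s'"]
        by (simp add: p_def UNIV_bool k) (simp add: T_def field_simps)
    qed
  qed
  ultimately show ?case unfolding B_def by (subst (asm) pd_kernel_cong) auto
qed

subsection \<open>Kernels on wreath products\<close>

text \<open>Sums over all lamps have no common finite range, but on finitely many elements only
  finitely many lamps occur; \<open>k'\<close> may depend on \<open>F\<close>.\<close>

lemma cnd_kernel_finite:
  assumes "\<And>F. finite F \<Longrightarrow> F \<subseteq> A \<Longrightarrow> \<exists>k'. cnd_kernel F k' \<and> (\<forall>x\<in>F. \<forall>y\<in>F. k x y = k' x y)"
  shows "cnd_kernel A k"
  unfolding cnd_kernel_def
proof (intro conjI ballI allI impI)
  fix x y assume "x \<in> A" "y \<in> A"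
  then obtain k' where "cnd_kernel {x, y} k'" "\<forall>a\<in>{x, y}. \<forall>b\<in>{x, y}. k a b = k' a b"
    using assms[of "{x, y}"] by auto
  then show "k x y = k y x" using cnd_kernel_sym[of "{x, y}" k' x y] by auto
next
  fix x assume "x \<in> A"
  then obtain k' where "cnd_kernel {x} k'" "\<forall>a\<in>{x}. \<forall>b\<in>{x}. k a b = k' a b"
    using assms[of "{x}"] by auto
  then show "k x x = 0" using cnd_kernel_diag[of "{x}" k' x] by auto
next
  fix F and c :: "'a \<Rightarrow> real" assume F: "finite F \<and> F \<subseteq> A \<and> sum c F = 0"
  then obtain k' where k': "cnd_kernel F k'" "\<forall>x\<in>F. \<forall>y\<in>F. k x y = k' x y"
    using assms[of F] by auto
  then have "(\<Sum>x\<in>F. \<Sum>y\<in>F. c x * c y * k x y) = (\<Sum>x\<in>F. \<Sum>y\<in>F. c x * c y * k' x y)"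
    by (intro sum.cong refl) auto
  then show "(\<Sum>x\<in>F. \<Sum>y\<in>F. c x * c y * k x y) \<le> 0"
    using cnd_kernelD[OF k'(1) _ order_refl] F by simp
qed

section \<open>Differences of lamp configurations under left translation\<close>

locale wreath = H: group H + G: group G
  for H :: "('h, 'm) monoid_scheme" and G :: "('g, 'n) monoid_scheme"
begin

abbreviation "B \<equiv> base_group H G"
abbreviation "W \<equiv> wreath_product H G"

sublocale B: group B
  by (simp add: H.group_axioms)

sublocale W: group W
  by (rule group_wreath_product[OF H.group_axioms G.group_axioms])

lemma W_carrier: "carrier W = carrier B \<times> carrier G"
  by (simp add: wreath_product_def)

lemma W_mult: "(w, g) \<otimes>\<^bsub>W\<^esub> (w', g') = (w \<otimes>\<^bsub>B\<^esub> shift G g w', g \<otimes>\<^bsub>G\<^esub> g')"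
  by (simp add: wreath_product_def)

lemma W_one: "\<one>\<^bsub>W\<^esub> = (\<one>\<^bsub>B\<^esub>, \<one>\<^bsub>G\<^esub>)"
  by (simp add: wreath_product_def)

lemma base_in: "w \<in> carrier B \<Longrightarrow> x \<in> carrier G \<Longrightarrow> w x \<in> carrier H"
  by (auto simp: carrier_base_group[OF H.group_axioms])

lemma finite_Supp: "w \<in> carrier B \<Longrightarrow> finite (Supp H G w)"
  by (simp add: carrier_base_group[OF H.group_axioms])

lemma mult_shift_at:
  assumes "g \<in> carrier G" "x \<in> carrier G"
  shows "(w \<otimes>\<^bsub>B\<^esub> shift G g l) (g \<otimes>\<^bsub>G\<^esub> x) = w (g \<otimes>\<^bsub>G\<^esub> x) \<otimes>\<^bsub>H\<^esub> l x"
  using assms by (simp add: shift_def flip: G.m_assoc)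

definition lamp_diff :: "('g \<Rightarrow> 'h) \<Rightarrow> ('g \<Rightarrow> 'h) \<Rightarrow> 'g set"
  where "lamp_diff l l' = {x \<in> carrier G. l x \<noteq> l' x}"

lemma lamp_diff_subset: "lamp_diff l l' \<subseteq> Supp H G l \<union> Supp H G l'"
  by (auto simp: lamp_diff_def Supp_def)

lemma finite_lamp_diff: "l \<in> carrier B \<Longrightarrow> l' \<in> carrier B \<Longrightarrow> finite (lamp_diff l l')"
  by (rule finite_subset[OF lamp_diff_subset]) (simp add: finite_Supp)

lemma lamp_diff_one: "lamp_diff \<one>\<^bsub>B\<^esub> w = Supp H G w"
  by (auto simp: lamp_diff_def Supp_def)

lemma lamp_diff_translate:
  assumes g: "g \<in> carrier G" and w: "w \<in> carrier B" "l \<in> carrier B" "l' \<in> carrier B"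
  shows "lamp_diff (w \<otimes>\<^bsub>B\<^esub> shift G g l) (w \<otimes>\<^bsub>B\<^esub> shift G g l') = (\<lambda>x. g \<otimes>\<^bsub>G\<^esub> x) ` lamp_diff l l'"
proof -
  have iff: "g \<otimes>\<^bsub>G\<^esub> x \<in> lamp_diff (w \<otimes>\<^bsub>B\<^esub> shift G g l) (w \<otimes>\<^bsub>B\<^esub> shift G g l') \<longleftrightarrow> x \<in> lamp_diff l l'"
    if "x \<in> carrier G" for x
    using that g w base_in by (simp add: lamp_diff_def mult_shift_at del: mult_sum_group)
  show ?thesis
  proof (intro equalityI subsetI)
    fix y assume y: "y \<in> lamp_diff (w \<otimes>\<^bsub>B\<^esub> shift G g l) (w \<otimes>\<^bsub>B\<^esub> shift G g l')"
    then have yc: "y \<in> carrier G" by (simp add: lamp_diff_def)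
    then have "g \<otimes>\<^bsub>G\<^esub> (inv\<^bsub>G\<^esub> g \<otimes>\<^bsub>G\<^esub> y) = y" using g by (simp flip: G.m_assoc)
    moreover from this have "inv\<^bsub>G\<^esub> g \<otimes>\<^bsub>G\<^esub> y \<in> lamp_diff l l'"
      using iff[of "inv\<^bsub>G\<^esub> g \<otimes>\<^bsub>G\<^esub> y"] y yc g by simp
    ultimately show "y \<in> (\<lambda>x. g \<otimes>\<^bsub>G\<^esub> x) ` lamp_diff l l'" by (metis imageI)
  next
    fix y assume "y \<in> (\<lambda>x. g \<otimes>\<^bsub>G\<^esub> x) ` lamp_diff l l'"
    then obtain x where x: "x \<in> lamp_diff l l'" "y = g \<otimes>\<^bsub>G\<^esub> x" by blast
    then have "x \<in> carrier G" by (simp add: lamp_diff_def)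
    then show "y \<in> lamp_diff (w \<otimes>\<^bsub>B\<^esub> shift G g l) (w \<otimes>\<^bsub>B\<^esub> shift G g l')"
      using iff x by blast
  qed
qed

text \<open>The sets of differing lamps vary with the pair of elements; placing them all in one
  finite set allows kernels to be built lamp by lamp.\<close>

lemma finite_common_support:
  assumes "finite F" "F \<subseteq> carrier W"
  obtains E where "finite E" "E \<subseteq> carrier G"
    "\<And>s s'. s \<in> F \<Longrightarrow> s' \<in> F \<Longrightarrow> lamp_diff (fst s) (fst s') = {x \<in> E. fst s x \<noteq> fst s' x}"
proof
  show "finite (\<Union>s\<in>F. Supp H G (fst s))"
    using assms by (auto simp: W_carrier finite_Supp)
  show "(\<Union>s\<in>F. Supp H G (fst s)) \<subseteq> carrier G" by (auto simp: Supp_def)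
  show "lamp_diff (fst s) (fst s') = {x \<in> \<Union>s\<in>F. Supp H G (fst s). fst s x \<noteq> fst s' x}"
    if "s \<in> F" "s' \<in> F" for s s'
    using that lamp_diff_subset[of "fst s" "fst s'"] by (fastforce simp: lamp_diff_def Supp_def)
qed

definition lampwise :: "('h \<Rightarrow> 'h \<Rightarrow> real) \<Rightarrow> ('g \<Rightarrow> 'h) \<times> 'g \<Rightarrow> ('g \<Rightarrow> 'h) \<times> 'g \<Rightarrow> real"
  where "lampwise q s s' = (\<Sum>x\<in>lamp_diff (fst s) (fst s'). q (fst s x) (fst s' x))"

text \<open>As \<open>q\<close> vanishes on the diagonal, the sum over the differing lamps may be
  taken over a fixed finite set of lamps, where it is a sum of pullbacks of
  \<open>q\<close>.\<close>

lemma cnd_kernel_lampwise: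
  assumes q: "cnd_kernel (carrier H) q"
  shows "cnd_kernel (carrier W) (lampwise q)"
proof (rule cnd_kernel_finite)
  fix F assume F: "finite F" "F \<subseteq> carrier W"
  obtain E where E: "finite E" "E \<subseteq> carrier G"
    and diff: "\<And>s s'. s \<in> F \<Longrightarrow> s' \<in> F \<Longrightarrow> lamp_diff (fst s) (fst s') = {x \<in> E. fst s x \<noteq> fst s' x}"
    using finite_common_support[OF F] by blast
  have in_H: "fst s x \<in> carrier H" if "s \<in> F" "x \<in> E" for s x
  proof -
    have "s \<in> carrier W" "x \<in> carrier G" using that F E by auto
    then show ?thesis using base_in by (simp add: W_carrier mem_Times_iff)
  qed
  have "cnd_kernel F (\<lambda>s s'. \<Sum>x\<in>E. q (fst s x) (fst s' x))"
    by (intro cnd_kernel_sum cnd_kernel_pullback[OF q] in_H)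
  moreover have "lampwise q s s' = (\<Sum>x\<in>E. q (fst s x) (fst s' x))" if "s \<in> F" "s' \<in> F" for s s'
    unfolding lampwise_def diff[OF that] using E that in_H cnd_kernel_diag[OF q]
    by (intro sum.mono_neutral_left) auto
  ultimately show "\<exists>k'. cnd_kernel F k' \<and> (\<forall>s\<in>F. \<forall>s'\<in>F. lampwise q s s' = k' s s')" by blast
qed

lemma left_invariant_lampwise:
  assumes "left_invariant H q"
  shows "left_invariant W (lampwise q)"
  unfolding left_invariant_def
proof (intro ballI)
  fix s t t' assume "s \<in> carrier W" "t \<in> carrier W" "t' \<in> carrier W"
  then obtain w g l h l' h' where s: "s = (w, g)" "w \<in> carrier B" "g \<in> carrier G"
    and t: "t = (l, h)" "l \<in> carrier B" "h \<in> carrier G" and t': "t' = (l', h')" "l' \<in> carrier B" "h' \<in> carrier G"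
    by (auto simp: W_carrier)
  have inj: "inj_on (\<lambda>x. g \<otimes>\<^bsub>G\<^esub> x) (lamp_diff l l')"
    using s by (auto simp: inj_on_def lamp_diff_def)
  have "(\<Sum>x\<in>lamp_diff l l'. q ((w \<otimes>\<^bsub>B\<^esub> shift G g l) (g \<otimes>\<^bsub>G\<^esub> x)) ((w \<otimes>\<^bsub>B\<^esub> shift G g l') (g \<otimes>\<^bsub>G\<^esub> x))) =
      (\<Sum>x\<in>lamp_diff l l'. q (l x) (l' x))"
  proof (intro sum.cong refl)
    fix x assume "x \<in> lamp_diff l l'"
    then have x: "x \<in> carrier G" by (simp add: lamp_diff_def)
    show "q ((w \<otimes>\<^bsub>B\<^esub> shift G g l) (g \<otimes>\<^bsub>G\<^esub> x)) ((w \<otimes>\<^bsub>B\<^esub> shift G g l') (g \<otimes>\<^bsub>G\<^esub> x)) = q (l x) (l' x)"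
      unfolding mult_shift_at[OF s(3) x]
      using assms s t t' x base_in by (simp add: left_invariant_def)
  qed
  then show "lampwise q (s \<otimes>\<^bsub>W\<^esub> t) (s \<otimes>\<^bsub>W\<^esub> t') = lampwise q t t'"
    unfolding lampwise_def s t t' W_mult fst_conv lamp_diff_translate[OF s(3,2) t(2) t'(2)]
    by (subst sum.reindex[OF inj]) (simp only: o_def)
qed

lemma lampwise_one: "lampwise q \<one>\<^bsub>W\<^esub> (w, g) = (\<Sum>x\<in>Supp H G w. q \<one>\<^bsub>H\<^esub> (w x))"
  unfolding lampwise_def W_one fst_conv lamp_diff_one
  by (intro sum.cong refl) (simp add: Supp_def)

text \<open>The sum over the configurations of fewer than \<open>M\<close> copies of the position stands for a
  state concentrated on values of the field at that position close to 0.\<close>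

definition wreath_kernel ::
    "('g multiset \<Rightarrow> 'g multiset \<Rightarrow> real) \<Rightarrow> nat \<Rightarrow> ('g \<Rightarrow> 'h) \<times> 'g \<Rightarrow> ('g \<Rightarrow> 'h) \<times> 'g \<Rightarrow> real"
  where "wreath_kernel \<kappa> M s s' = (\<Sum>i<M. \<Sum>j<M. lamp_kernel \<kappa> (lamp_diff (fst s) (fst s'))
    (replicate_mset i (snd s)) (replicate_mset j (snd s'))) / real M"

lemma pd_kernel_wreath:
  assumes pd: "pd_kernel {u. set_mset u \<subseteq> carrier G} \<kappa>"
    and tr: "\<And>u v w. set_mset u \<subseteq> carrier G \<Longrightarrow> set_mset v \<subseteq> carrier G \<Longrightarrow> set_mset w \<subseteq> carrier G \<Longrightarrow>
      \<kappa> (u + w) (v + w) = \<kappa> u v"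
  shows "pd_kernel (carrier W) (wreath_kernel \<kappa> M)"
proof (rule pd_kernel_finite)
  fix F assume F: "finite F" "F \<subseteq> carrier W"
  obtain E where E: "finite E" "E \<subseteq> carrier G"
    and diff: "\<And>s s'. s \<in> F \<Longrightarrow> s' \<in> F \<Longrightarrow> lamp_diff (fst s) (fst s') = {x \<in> E. fst s x \<noteq> fst s' x}"
    using finite_common_support[OF F] by blast
  define k where "k s s' = lamp_kernel \<kappa> {x\<in>E. fst s x \<noteq> fst s' x} (snd s) (snd s')"
    for s s' :: "('g \<Rightarrow> 'h) \<times> 'g multiset"
  define T where "T i s = (fst s, replicate_mset i (snd s))" for i and s :: "('g \<Rightarrow> 'h) \<times> 'g"
  have "pd_kernel {(l :: 'g \<Rightarrow> 'h, u). set_mset u \<subseteq> carrier G} k"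
    unfolding k_def[abs_def] by (rule pd_kernel_lamp[OF pd tr E])
  then have "pd_kernel F (\<lambda>s s'. \<Sum>i\<in>{..<M}. \<Sum>j\<in>{..<M}. 1 * 1 * k (T i s) (T j s'))"
    using F by (intro pd_kernel_combination) (auto simp: T_def W_carrier subset_iff split: if_splits)
  then have "pd_kernel F (\<lambda>s s'. (1 / real M) * (\<Sum>i\<in>{..<M}. \<Sum>j\<in>{..<M}. 1 * 1 * k (T i s) (T j s')))"
    by (rule pd_kernel_scale) simp
  then show "pd_kernel F (wreath_kernel \<kappa> M)"
    by (subst (asm) pd_kernel_cong[where k' = "wreath_kernel \<kappa> M"])
      (simp_all add: wreath_kernel_def k_def T_def diff)
qed

lemma left_invariant_wreath_kernel:
  assumes \<kappa>: "\<And>g u v. g \<in> carrier G \<Longrightarrow> set_mset u \<subseteq> carrier G \<Longrightarrow> set_mset v \<subseteq> carrier G \<Longrightarrow>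
    \<kappa> (image_mset (\<lambda>x. g \<otimes>\<^bsub>G\<^esub> x) u) (image_mset (\<lambda>x. g \<otimes>\<^bsub>G\<^esub> x) v) = \<kappa> u v"
  shows "left_invariant W (wreath_kernel \<kappa> M)"
  unfolding left_invariant_def
proof (intro ballI)
  fix s t t' assume "s \<in> carrier W" "t \<in> carrier W" "t' \<in> carrier W"
  then obtain w g l h l' h' where s: "s = (w, g)" "w \<in> carrier B" "g \<in> carrier G"
    and t: "t = (l, h)" "l \<in> carrier B" "h \<in> carrier G" and t': "t' = (l', h')" "l' \<in> carrier B" "h' \<in> carrier G"
    by (auto simp: W_carrier)
  have inj: "inj_on (\<lambda>x. g \<otimes>\<^bsub>G\<^esub> x) (carrier G)" using s by (auto simp: inj_on_def)
  have "lamp_kernel \<kappa> ((\<lambda>x. g \<otimes>\<^bsub>G\<^esub> x) ` lamp_diff l l') (image_mset (\<lambda>x. g \<otimes>\<^bsub>G\<^esub> x) (replicate_mset i h))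
      (image_mset (\<lambda>x. g \<otimes>\<^bsub>G\<^esub> x) (replicate_mset j h')) =
      lamp_kernel \<kappa> (lamp_diff l l') (replicate_mset i h) (replicate_mset j h')" for i j
    using t t' \<kappa> s by (intro lamp_kernel_image[OF inj] finite_lamp_diff) (auto simp: lamp_diff_def subset_iff)
  then show "wreath_kernel \<kappa> M (s \<otimes>\<^bsub>W\<^esub> t) (s \<otimes>\<^bsub>W\<^esub> t') = wreath_kernel \<kappa> M t t'"
    unfolding wreath_kernel_def s t t' W_mult fst_conv snd_conv lamp_diff_translate[OF s(3,2) t(2) t'(2)]
    by simp
qed

lemma wreath_kernel_one:
  "wreath_kernel \<kappa> M \<one>\<^bsub>W\<^esub> (w, g) = (\<Sum>P\<in>Pow (Supp H G w). \<Sum>N\<in>Pow (Supp H G w). \<Sum>i<M. \<Sum>j<M.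
    \<kappa> (replicate_mset i \<one>\<^bsub>G\<^esub> + mset_set P) (replicate_mset j g + mset_set N)) / (4 ^ card (Supp H G w) * real M)"
proof -
  let ?f = "\<lambda>P N i j. \<kappa> (replicate_mset i \<one>\<^bsub>G\<^esub> + mset_set P) (replicate_mset j g + mset_set N)"
  let ?D = "Pow (Supp H G w)"
  have "(\<Sum>i<M. \<Sum>j<M. \<Sum>P\<in>?D. \<Sum>N\<in>?D. ?f P N i j) = (\<Sum>i<M. \<Sum>P\<in>?D. \<Sum>j<M. \<Sum>N\<in>?D. ?f P N i j)"
    by (intro sum.cong refl sum.swap)
  also have "\<dots> = (\<Sum>P\<in>?D. \<Sum>i<M. \<Sum>j<M. \<Sum>N\<in>?D. ?f P N i j)" by (rule sum.swap)
  also have "\<dots> = (\<Sum>P\<in>?D. \<Sum>i<M. \<Sum>N\<in>?D. \<Sum>j<M. ?f P N i j)"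
    by (intro sum.cong refl sum.swap)
  also have "\<dots> = (\<Sum>P\<in>?D. \<Sum>N\<in>?D. \<Sum>i<M. \<Sum>j<M. ?f P N i j)"
    by (intro sum.cong refl sum.swap)
  finally show ?thesis
    by (simp add: wreath_kernel_def lamp_kernel_def W_one lamp_diff_one del: one_sum_group
        flip: sum_divide_distrib)
qed

text \<open>With \<open>M\<close> copies and variance \<open>t = M\<^sup>-\<^sup>3\<close> the kernel differs from 1 by a term of order
  \<open>1 / M\<close> at every element; \<open>M = 4 ^ n\<close> makes the series with coefficients \<open>2 ^ n\<close> converge.\<close>

definition support_kernel ::
    "('g \<Rightarrow> 'g \<Rightarrow> real) \<Rightarrow> nat \<Rightarrow> ('g \<Rightarrow> 'h) \<times> 'g \<Rightarrow> ('g \<Rightarrow> 'h) \<times> 'g \<Rightarrow> real"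
  where "support_kernel q n = wreath_kernel (gauss_kernel q (1 / 64 ^ n)) (4 ^ n)"

lemma set_mset_replicate_subset: "g \<in> A \<Longrightarrow> set_mset (replicate_mset i g) \<subseteq> A"
  by (auto split: if_splits)

section \<open>Kernels detecting the positions of lit lamps\<close>

context
  fixes q :: "'g \<Rightarrow> 'g \<Rightarrow> real"
  assumes q: "cnd_kernel (carrier G) q" and q_inv: "left_invariant G q"
begin

lemma pd_kernel_support: "pd_kernel (carrier W) (support_kernel q n)"
  unfolding support_kernel_def
  by (intro pd_kernel_wreath pd_kernel_gauss q) (simp_all add: gauss_kernel_def energy_translate[OF q])

lemma left_invariant_support: "left_invariant W (support_kernel q n)"
  unfolding support_kernel_def
proof (rule left_invariant_wreath_kernel)
  fix g u v assume "g \<in> carrier G" "set_mset u \<subseteq> carrier G" "set_mset v \<subseteq> carrier G"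
  moreover from this have "energy q (image_mset (\<lambda>x. g \<otimes>\<^bsub>G\<^esub> x) u) (image_mset (\<lambda>x. g \<otimes>\<^bsub>G\<^esub> x) v) = energy q u v"
    using q_inv by (intro energy_image[of "carrier G"]) (auto simp: left_invariant_def)
  ultimately show "gauss_kernel q (1 / 64 ^ n) (image_mset (\<lambda>x. g \<otimes>\<^bsub>G\<^esub> x) u) (image_mset (\<lambda>x. g \<otimes>\<^bsub>G\<^esub> x) v) =
      gauss_kernel q (1 / 64 ^ n) u v"
    by (simp add: gauss_kernel_def)
qed

text \<open>Without lit lamps only equal numbers of copies correlate, so there are \<open>M\<close>
  terms equal to 1; this fixes the normalisation by \<open>M\<close>.\<close>

lemma support_kernel_self:
  assumes "s \<in> carrier W"
  shows "support_kernel q n s s = 1"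
proof -
  have "lamp_diff (fst s) (fst s) = {}" by (simp add: lamp_diff_def)
  then have "support_kernel q n s s = (\<Sum>i<4 ^ n. \<Sum>j<(4::nat) ^ n. if i = j then 1 else 0) / real (4 ^ n)"
    by (auto simp: support_kernel_def wreath_kernel_def lamp_kernel_def gauss_kernel_def energy_self
        intro!: sum.cong)
  then show ?thesis by simp
qed

text \<open>Group the subsets \<open>P\<close> in pairs, with and without \<open>z\<close>. Against
  a fixed \<open>N\<close>, each member of a pair meets at most one number \<open>j\<close> of
  copies of matching size, so a pair contributes at most two exponentials. Their energies cannot
  both be small: by the parallelogram inequality one is at least \<open>q 1 z / 4\<close>. Each pair
  thus contributes at most \<open>1 + e\<close> in place of 2, whatever the other lamps are.\<close>

lemma support_kernel_far:
  assumes w: "w \<in> carrier B" and z: "z \<in> Supp H G w"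
  shows "support_kernel q n \<one>\<^bsub>W\<^esub> (w, \<one>\<^bsub>G\<^esub>) \<le> (1 + exp (- (q \<one>\<^bsub>G\<^esub> z / 64 ^ n) / 4)) / 2"
proof -
  define M where "M = (4::nat) ^ n"
  define t where "t = 1 / (64::real) ^ n"
  define \<kappa> where "\<kappa> = gauss_kernel q t"
  define e where "e = exp (- (t * q \<one>\<^bsub>G\<^esub> z) / 4)"
  define D where "D = Supp H G w - {z}"
  have t: "0 < t" and M: "0 < M" by (simp_all add: t_def M_def)
  have D: "finite D" "z \<notin> D" "insert z D = Supp H G w" "D \<subseteq> carrier G" and zG: "z \<in> carrier G"
    using finite_Supp[OF w] z by (auto simp: D_def Supp_def)
  have e0: "0 \<le> e" by (simp add: e_def)
  define X where "X i P = replicate_mset i \<one>\<^bsub>G\<^esub> + mset_set P" for i P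
  have Xc: "set_mset (X i P) \<subseteq> carrier G" if "P \<subseteq> insert z D" for i P
  proof -
    have "finite P" "P \<subseteq> carrier G" using that D zG by (auto intro: finite_subset[of P "insert z D"])
    then show ?thesis using set_mset_replicate_subset[OF G.one_closed, of i] by (simp add: X_def)
  qed
  have \<kappa>1: "\<kappa> u v \<le> 1" if "set_mset u \<subseteq> carrier G" "set_mset v \<subseteq> carrier G" for u v
    using energy_nonneg[OF q that] t by (simp add: \<kappa>_def gauss_kernel_def)
  \<comment> \<open>The size condition singles out one \<open>j\<close>. The case distinction guards
    the truncated subtraction, and a \<open>j\<close> outside the range contributes 0.\<close>
  have row: "(\<Sum>j<M. \<kappa> u (X j N)) \<le> (if card N \<le> size u then \<kappa> u (X (size u - card N) N) else 0)"
    for u N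
  proof -
    have "\<kappa> u (X j N) = (if j = size u - card N then if card N \<le> size u then \<kappa> u (X (size u - card N) N) else 0 else 0)" for j
      by (auto simp: \<kappa>_def gauss_kernel_def X_def)
    then have "(\<Sum>j<M. \<kappa> u (X j N)) = (if size u - card N < M then if card N \<le> size u then \<kappa> u (X (size u - card N) N) else 0 else 0)"
      by (subst sum.cong[OF refl, of _ _ "\<lambda>j. if j = size u - card N then if card N \<le> size u then \<kappa> u (X (size u - card N) N) else 0 else 0"]) (auto simp: sum.delta)
    also have "\<dots> \<le> (if card N \<le> size u then \<kappa> u (X (size u - card N) N) else 0)"
      by (simp add: \<kappa>_def gauss_kernel_def)
    finally show ?thesis .
  qed
  have pair: "(\<Sum>j<M. \<kappa> u (X j N) + \<kappa> (add_mset z u) (X j N)) \<le> 1 + e"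
    if u: "set_mset u \<subseteq> carrier G" and N: "N \<subseteq> insert z D" for u N
  proof -
    have sum_le: "(\<Sum>j<M. \<kappa> u (X j N) + \<kappa> (add_mset z u) (X j N)) \<le>
      (if card N \<le> size u then \<kappa> u (X (size u - card N) N) else 0) +
      (if card N \<le> Suc (size u) then \<kappa> (add_mset z u) (X (Suc (size u) - card N) N) else 0)"
      unfolding sum.distrib by (rule add_mono[OF row row[of "add_mset z u", unfolded size_add_mset]])
    show ?thesis
    proof (cases "card N \<le> size u")
      \<comment> \<open>Here \<open>N\<close> is too large to match \<open>u\<close>, so at most the
        exponential for \<open>add_mset z u\<close> is left.\<close>
      case False
      then show ?thesis using sum_le \<kappa>1[of "add_mset z u" "X (Suc (size u) - card N) N"] u Xc[OF N] zG e0
        by (auto split: if_splits)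
    next
      case True
      define v where "v = X (size u - card N) N"
      have v: "set_mset v \<subseteq> carrier G" "size v = size u" using True Xc[OF N] by (auto simp: v_def X_def)
      have v': "X (Suc (size u) - card N) N = add_mset \<one>\<^bsub>G\<^esub> v"
        using True by (simp add: v_def X_def Suc_diff_le)
      define E1 where "E1 = energy q u v"
      define E2 where "E2 = energy q (add_mset z u) (add_mset \<one>\<^bsub>G\<^esub> v)"
      have E: "0 \<le> E1" "0 \<le> E2"
        using u v zG by (auto simp: E1_def E2_def intro!: energy_nonneg[OF q])
      \<comment> \<open>The outer configurations differ by one point moved from \<open>z\<close> to
        1, which has energy \<open>q 1 z\<close>. The intermediate one is at energy
        \<open>E2\<close> from the first and, after cancelling the point 1, at energy
        \<open>E1\<close> from the second.\<close>
      have "energy q (add_mset z u) (add_mset \<one>\<^bsub>G\<^esub> u) \<le> 2 * energy q (add_mset z u) (add_mset \<one>\<^bsub>G\<^esub> v) + 2 * energy q (add_mset \<one>\<^bsub>G\<^esub> v) (add_mset \<one>\<^bsub>G\<^esub> u)"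
        using u v zG by (intro cnd_kernel_triangle[OF cnd_kernel_energy[OF q, of "Suc (size u)"]]) auto
      moreover have "energy q (add_mset z u) (add_mset \<one>\<^bsub>G\<^esub> u) = q \<one>\<^bsub>G\<^esub> z"
        using energy_translate[OF q, of "{#z#}" "{#\<one>\<^bsub>G\<^esub>#}" u] u zG cnd_kernel_sym[OF q, of z "\<one>\<^bsub>G\<^esub>"]
        by (simp add: energy_single cnd_kernel_diag[OF q])
      moreover have "energy q (add_mset \<one>\<^bsub>G\<^esub> v) (add_mset \<one>\<^bsub>G\<^esub> u) = E1"
        using energy_translate[OF q, of u v "{#\<one>\<^bsub>G\<^esub>#}"] u v
          cnd_kernel_sym[OF cnd_kernel_energy[OF q, of "Suc (size u)"], of "add_mset \<one>\<^bsub>G\<^esub> u" "add_mset \<one>\<^bsub>G\<^esub> v"]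
        by (simp add: E1_def)
      ultimately have sum: "q \<one>\<^bsub>G\<^esub> z \<le> 2 * E1 + 2 * E2" by (simp add: E2_def)
      have "exp (- t * E1) + exp (- t * E2) \<le> 1 + e"
      proof (cases "q \<one>\<^bsub>G\<^esub> z / 4 \<le> E1")
        case True
        then have "t * (q \<one>\<^bsub>G\<^esub> z / 4) \<le> t * E1" using t by (intro mult_left_mono) auto
        then have "exp (- t * E1) \<le> e" by (simp add: e_def)
        moreover have "exp (- t * E2) \<le> 1" using t E by simp
        ultimately show ?thesis by linarith
      next
        case False
        then have "t * (q \<one>\<^bsub>G\<^esub> z / 4) \<le> t * E2" using t sum by (intro mult_left_mono) auto
        then have "exp (- t * E2) \<le> e" by (simp add: e_def)
        moreover have "exp (- t * E1) \<le> 1" using t E by simp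
        ultimately show ?thesis by linarith
      qed
      then show ?thesis
        using sum_le True v v' by (simp add: \<kappa>_def gauss_kernel_def E1_def E2_def flip: v_def)
    qed
  qed
  have "(\<Sum>P\<in>Pow (insert z D). \<Sum>N\<in>Pow (insert z D). \<Sum>i<M. \<Sum>j<M. \<kappa> (X i P) (X j N)) =
      (\<Sum>P\<in>Pow D. \<Sum>N\<in>Pow (insert z D). \<Sum>i<M. \<Sum>j<M. \<kappa> (X i P) (X j N) + \<kappa> (add_mset z (X i P)) (X j N))"
    unfolding sum_Pow_insert[OF D(1,2)]
    using D by (intro sum.cong refl) (simp add: X_def mset_set_insert_Pow sum.distrib sum_Pow_insert)
  also have "\<dots> \<le> (\<Sum>P\<in>Pow D. \<Sum>N\<in>Pow (insert z D). \<Sum>i<M. 1 + e)"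
    using Xc by (intro sum_mono pair) auto
  \<comment> \<open>There are \<open>2 ^ card D\<close> pairs and twice as many sets
    \<open>N\<close>, hence half of \<open>4 ^ card (insert z D)\<close> combinations.\<close>
  also have "\<dots> = 4 ^ card (insert z D) * real M * ((1 + e) / 2)"
  proof -
    have "(4::real) ^ card D = 2 ^ card D * 2 ^ card D" by (simp flip: power_mult_distrib)
    then show ?thesis using D(1,2) by (simp add: card_Pow field_simps)
  qed
  finally have "support_kernel q n \<one>\<^bsub>W\<^esub> (w, \<one>\<^bsub>G\<^esub>) \<le> (1 + e) / 2"
    unfolding support_kernel_def wreath_kernel_one D(3) X_def \<kappa>_def t_def M_def
    using M by (simp add: divide_le_eq mult_ac)
  then show ?thesis by (simp add: e_def t_def)
qed

text \<open>For each choice of \<open>P\<close> and \<open>N\<close>, all but \<open>2 * d\<close>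
  of the numbers \<open>i\<close> have a partner \<open>j\<close> of matching size. The energy of
  such a match is at most \<open>R\<close> times the square of \<open>M * (1 + d)\<close>, and
  \<open>t * M^2 = 1 / M\<close>, so each match falls short of 1 by \<open>O(1 / M)\<close>.\<close>

lemma support_kernel_near:
  assumes w: "w \<in> carrier B" and g: "g \<in> carrier G"
  shows "\<exists>C. \<forall>n. 1 - support_kernel q n \<one>\<^bsub>W\<^esub> (w, g) \<le> C / 4 ^ n"
proof -
  define D where "D = Supp H G w"
  define d where "d = card D"
  define A where "A = {\<one>\<^bsub>G\<^esub>, g} \<union> D"
  have D: "finite D" "D \<subseteq> carrier G" using finite_Supp[OF w] by (auto simp: D_def Supp_def)
  have A: "finite A" "A \<subseteq> carrier G" using D g by (auto simp: A_def)
  define R where "R = Max ((\<lambda>(x, y). q x y) ` (A \<times> A))"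
  have R: "q x y \<le> R" if "x \<in> A" "y \<in> A" for x y
    unfolding R_def using that A by (intro Max_ge) auto
  have R0: "0 \<le> R" using R[of "\<one>\<^bsub>G\<^esub>" "\<one>\<^bsub>G\<^esub>"] cnd_kernel_diag[OF q, of "\<one>\<^bsub>G\<^esub>"] by (simp add: A_def)
  have "1 - support_kernel q n \<one>\<^bsub>W\<^esub> (w, g) \<le> (2 * d + (real (1 + d))\<^sup>2 * R) / 4 ^ n" for n
  proof -
    define M where "M = (4::nat) ^ n"
    define t where "t = 1 / (64::real) ^ n"
    define \<kappa> where "\<kappa> = gauss_kernel q t"
    define \<epsilon> where "\<epsilon> = (real (1 + d))\<^sup>2 * R / M"
    have M: "0 < M" by (simp add: M_def)
    have t: "0 < t" by (simp add: t_def)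
    have tM: "t * (real M)\<^sup>2 = 1 / M"
    proof -
      have "(64::real) ^ n = 4 ^ n * 4 ^ n * 4 ^ n" by (simp flip: power_mult_distrib)
      then show ?thesis by (simp add: t_def M_def power2_eq_square)
    qed
    have \<epsilon>0: "0 \<le> \<epsilon>" using R0 by (simp add: \<epsilon>_def)
    have cell: "(\<Sum>i<M. \<Sum>j<M. \<kappa> (replicate_mset i \<one>\<^bsub>G\<^esub> + mset_set P) (replicate_mset j g + mset_set N)) \<ge>
        real M - 2 * d - M * \<epsilon>" if P: "P \<subseteq> D" and N: "N \<subseteq> D" for P N
    proof -
      have fin: "finite P" "finite N" and card: "card P \<le> d" "card N \<le> d"
        using P N D by (auto simp: d_def intro: finite_subset card_mono)
      have nonneg: "0 \<le> \<kappa> u v" for u v by (simp add: \<kappa>_def gauss_kernel_def)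
      \<comment> \<open>The partner is \<open>j = i + card P - card N\<close>. Keeping
        \<open>i\<close> at distance \<open>d\<close> from both ends of the range ensures that
        \<open>j\<close> lies in the range and that the subtraction is not truncated.\<close>
      have row: "(if d \<le> i \<and> i + d < M then 1 else 0) - \<epsilon> \<le>
          (\<Sum>j<M. \<kappa> (replicate_mset i \<one>\<^bsub>G\<^esub> + mset_set P) (replicate_mset j g + mset_set N))" if "i < M" for i
      proof (cases "d \<le> i \<and> i + d < M")
        case True
        define j where "j = i + card P - card N"
        define u where "u = replicate_mset i \<one>\<^bsub>G\<^esub> + mset_set P"
        define v where "v = replicate_mset j g + mset_set N"
        have j: "j < M" "size u = size v" using True card by (auto simp: j_def u_def v_def)
        have size: "real (size u) \<le> real M * real (1 + d)"
        proof -
          have "size u \<le> M + d" using that card by (simp add: u_def)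
          also have "\<dots> \<le> M * (1 + d)" using M by (simp add: algebra_simps)
          finally show ?thesis by (metis of_nat_le_iff of_nat_mult)
        qed
        have "energy q u v \<le> real (size u) * real (size v) * R"
          using P N fin R A by (intro energy_le[OF q, of _ A]) (auto simp: u_def v_def A_def split: if_splits)
        also have "\<dots> \<le> (real M * real (1 + d)) * (real M * real (1 + d)) * R"
          using size size[unfolded j(2)] R0 by (intro mult_right_mono mult_mono) auto
        finally have "t * energy q u v \<le> t * ((real M * real (1 + d)) * (real M * real (1 + d)) * R)"
          using t by (intro mult_left_mono) auto
        also have "\<dots> = (t * (real M)\<^sup>2) * (real (1 + d))\<^sup>2 * R" by (simp add: power2_eq_square algebra_simps)
        also have "\<dots> = \<epsilon>" by (simp add: tM \<epsilon>_def)
        finally have "1 - \<epsilon> \<le> exp (- t * energy q u v)"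
          using exp_ge_add_one_self[of "- t * energy q u v"] by simp
        also have "\<dots> = \<kappa> u v" using j by (simp add: \<kappa>_def gauss_kernel_def)
        also have "\<dots> \<le> (\<Sum>j<M. \<kappa> u (replicate_mset j g + mset_set N))"
          unfolding v_def using j nonneg by (intro member_le_sum) auto
        finally show ?thesis using True by (simp add: u_def)
      next
        case False
        have "0 \<le> (\<Sum>j<M. \<kappa> (replicate_mset i \<one>\<^bsub>G\<^esub> + mset_set P) (replicate_mset j g + mset_set N))"
          using nonneg by (intro sum_nonneg)
        then show ?thesis using False \<epsilon>0 by auto
      qed
      have "{d..<M - d} \<subseteq> {i \<in> {..<M}. d \<le> i \<and> i + d < M}" by auto
      then have "M - d - d \<le> card {i \<in> {..<M}. d \<le> i \<and> i + d < M}"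
        using card_mono[of "{i \<in> {..<M}. d \<le> i \<and> i + d < M}" "{d..<M - d}"] by simp
      then have "real M - 2 * d \<le> real (card {i \<in> {..<M}. d \<le> i \<and> i + d < M})" by linarith
      also have "\<dots> = (\<Sum>i<M. if d \<le> i \<and> i + d < M then 1 else 0)"
        by (subst sum.inter_filter[symmetric]) auto
      finally have "real M - 2 * d - M * \<epsilon> \<le> (\<Sum>i<M. (if d \<le> i \<and> i + d < M then 1 else 0) - \<epsilon>)"
        by (simp add: sum_subtractf)
      also have "\<dots> \<le> (\<Sum>i<M. \<Sum>j<M. \<kappa> (replicate_mset i \<one>\<^bsub>G\<^esub> + mset_set P) (replicate_mset j g + mset_set N))"
        using row by (intro sum_mono) auto
      finally show ?thesis .
    qed
    have "4 ^ d * (real M - 2 * d - M * \<epsilon>) = (\<Sum>P\<in>Pow D. \<Sum>N\<in>Pow D. real M - 2 * d - M * \<epsilon>)"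
      using D by (simp add: card_Pow d_def flip: power_mult_distrib mult.assoc)
    also have "\<dots> \<le> (\<Sum>P\<in>Pow D. \<Sum>N\<in>Pow D. \<Sum>i<M. \<Sum>j<M.
        \<kappa> (replicate_mset i \<one>\<^bsub>G\<^esub> + mset_set P) (replicate_mset j g + mset_set N))"
      by (intro sum_mono cell) auto
    finally have "(4 ^ d * (real M - 2 * d - M * \<epsilon>)) / (4 ^ d * real M) \<le> support_kernel q n \<one>\<^bsub>W\<^esub> (w, g)"
      unfolding support_kernel_def wreath_kernel_one D_def[symmetric] d_def[symmetric] \<kappa>_def t_def M_def
      by (rule divide_right_mono) simp
    then have "(real M - 2 * d - M * \<epsilon>) / M \<le> support_kernel q n \<one>\<^bsub>W\<^esub> (w, g)" by simp
    moreover have "(real M - 2 * d - M * \<epsilon>) / M = 1 - 2 * d / M - \<epsilon>"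
      using M by (simp add: field_simps)
    moreover have "2 * d / M + \<epsilon> = (2 * d + (real (1 + d))\<^sup>2 * R) / 4 ^ n"
      by (simp add: \<epsilon>_def M_def add_divide_distrib)
    ultimately show ?thesis by linarith
  qed
  then show ?thesis by blast
qed

text \<open>The kernel is the series of \<open>2 ^ n * (1 - support_kernel q n)\<close>. At a fixed
  element the differences are \<open>O(1 / 4 ^ n)\<close>, so it converges; the growing weights make
  it large as soon as one difference of high index stays away from 0.\<close>

lemma exists_support_detecting_kernel:
  "\<exists>Q. cnd_kernel (carrier W) Q \<and> left_invariant W Q \<and>
    (\<forall>C. \<exists>C'. \<forall>w\<in>carrier B. Q \<one>\<^bsub>W\<^esub> (w, \<one>\<^bsub>G\<^esub>) \<le> C \<longrightarrow> (\<forall>z\<in>Supp H G w. q \<one>\<^bsub>G\<^esub> z \<le> C'))"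
proof -
  define f where "f n s s' = 2 ^ n * (1 - support_kernel q n s s')" for n s s'
  have f: "cnd_kernel (carrier W) (f n)" for n
    unfolding f_def[abs_def]
    by (intro cnd_kernel_scale cnd_kernel_one_minus_pd pd_kernel_support support_kernel_self) auto
  have finv: "f n (a \<otimes>\<^bsub>W\<^esub> s) (a \<otimes>\<^bsub>W\<^esub> s') = f n s s'"
    if "a \<in> carrier W" "s \<in> carrier W" "s' \<in> carrier W" for n a s s'
    using left_invariant_support that by (simp add: f_def left_invariant_def)
  have f0: "0 \<le> f n s s'" if "s \<in> carrier W" "s' \<in> carrier W" for n s s'
    using cnd_kernel_nonneg[OF f that] .
  have summable1: "summable (\<lambda>n. f n \<one>\<^bsub>W\<^esub> s)" if s: "s \<in> carrier W" for s
  proof -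
    obtain w g where wg: "s = (w, g)" "w \<in> carrier B" "g \<in> carrier G" using s by (auto simp: W_carrier)
    obtain C where C: "\<And>n. 1 - support_kernel q n \<one>\<^bsub>W\<^esub> s \<le> C / 4 ^ n"
      using support_kernel_near[OF wg(2,3)] wg(1) by blast
    have le: "f n \<one>\<^bsub>W\<^esub> s \<le> C * (1 / 2) ^ n" for n
    proof -
      have "f n \<one>\<^bsub>W\<^esub> s \<le> 2 ^ n * (C / 4 ^ n)" unfolding f_def using C by (intro mult_left_mono) auto
      also have "(4::real) ^ n = 2 ^ n * 2 ^ n" by (simp flip: power_mult_distrib)
      finally show ?thesis by (simp add: power_divide)
    qed
    show ?thesis
      by (rule summable_comparison_test'[of "\<lambda>n. C * (1 / 2) ^ n" 0])
        (use le f0[OF W.one_closed s] in \<open>auto intro!: summable_mult summable_geometric\<close>)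
  qed
  have summable: "summable (\<lambda>n. f n s s')" if "s \<in> carrier W" "s' \<in> carrier W" for s s'
  proof -
    \<comment> \<open>The estimate is available at the neutral element only; left invariance carries
      it to all pairs.\<close>
    have "f n s s' = f n \<one>\<^bsub>W\<^esub> (inv\<^bsub>W\<^esub> s \<otimes>\<^bsub>W\<^esub> s')" for n
      using finv[of s "\<one>\<^bsub>W\<^esub>" "inv\<^bsub>W\<^esub> s \<otimes>\<^bsub>W\<^esub> s'" n] that by (simp flip: W.m_assoc)
    then show ?thesis using summable1 that by simp
  qed
  define Q where "Q s s' = (\<Sum>n. f n s s')" for s s'
  have "cnd_kernel (carrier W) Q"
  proof (rule cnd_kernel_limit)
    show "cnd_kernel (carrier W) (\<lambda>s s'. \<Sum>n<m. f n s s')" for m by (intro cnd_kernel_sum f)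
    show "(\<lambda>m. \<Sum>n<m. f n s s') \<longlonglongrightarrow> Q s s'" if "s \<in> carrier W" "s' \<in> carrier W" for s s'
      unfolding Q_def using summable_LIMSEQ[OF summable[OF that]] .
  qed
  moreover have "left_invariant W Q"
    unfolding left_invariant_def Q_def using finv by simp
  moreover have "\<exists>C'. \<forall>w\<in>carrier B. Q \<one>\<^bsub>W\<^esub> (w, \<one>\<^bsub>G\<^esub>) \<le> C \<longrightarrow> (\<forall>z\<in>Supp H G w. q \<one>\<^bsub>G\<^esub> z \<le> C')" for C
  proof -
    \<comment> \<open>If a lit lamp has \<open>q 1 z > 4 * 64 ^ n\<close>, the exponent in
      \<open>support_kernel_far\<close> is below -1 and the kernel is at most 3/4. The
      \<open>n\<close>-th term is then at least \<open>2 ^ n / 4\<close>, which exceeds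
      \<open>C\<close>.\<close>
    obtain n where n: "4 * C < 2 ^ n" using real_arch_pow[of 2 "4 * C"] by auto
    have "q \<one>\<^bsub>G\<^esub> z \<le> 4 * 64 ^ n"
      if w: "w \<in> carrier B" and C: "Q \<one>\<^bsub>W\<^esub> (w, \<one>\<^bsub>G\<^esub>) \<le> C" and z: "z \<in> Supp H G w" for w z
    proof (rule ccontr)
      assume "\<not> ?thesis"
      then have "1 \<le> q \<one>\<^bsub>G\<^esub> z / 64 ^ n / 4" by (simp add: field_simps)
      then have "exp (- (q \<one>\<^bsub>G\<^esub> z / 64 ^ n) / 4) \<le> exp (- 1)" by simp
      also have "\<dots> \<le> (1/2 :: real)"
        using exp_ge_add_one_self[of 1] by (simp add: exp_minus field_simps)
      finally have "1/4 \<le> 1 - support_kernel q n \<one>\<^bsub>W\<^esub> (w, \<one>\<^bsub>G\<^esub>)"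
        using support_kernel_far[OF w z, of n] by simp
      then have "2 ^ n * (1/4) \<le> f n \<one>\<^bsub>W\<^esub> (w, \<one>\<^bsub>G\<^esub>)"
        unfolding f_def by (intro mult_left_mono) auto
      also have "\<dots> \<le> Q \<one>\<^bsub>W\<^esub> (w, \<one>\<^bsub>G\<^esub>)"
      proof -
        have s: "(w, \<one>\<^bsub>G\<^esub>) \<in> carrier W" using w by (simp add: W_carrier)
        show ?thesis
          unfolding Q_def using sum_le_suminf[OF summable1[OF s], of "{n}"] f0[OF W.one_closed s] by simp
      qed
      finally show False using C n by simp
    qed
    then show ?thesis by blast
  qed
  ultimately show ?thesis by blast
qed

end

text \<open>Deducing bounds on kernels from Property T of the wreath product rests on its
  countability. A base element is given by a finite subset of \<open>G\<close> and a function on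
  it.\<close>

lemma countable_W:
  assumes H: "countable (carrier H)" and G: "countable (carrier G)"
  shows "countable (carrier W)"
proof -
  let ?ext = "\<lambda>F f. \<lambda>x\<in>carrier G. if x \<in> F then f x else \<one>\<^bsub>H\<^esub>"
  have "carrier B \<subseteq> (\<Union>F\<in>{F. F \<subseteq> carrier G \<and> finite F}. ?ext F ` (F \<rightarrow>\<^sub>E carrier H))"
  proof
    fix w assume w: "w \<in> carrier B"
    have "w = ?ext (Supp H G w) (restrict w (Supp H G w))"
    proof
      fix x show "w x = ?ext (Supp H G w) (restrict w (Supp H G w)) x"
        using w by (auto simp: carrier_base_group[OF H.group_axioms] Supp_def PiE_iff extensional_def)
    qed
    moreover have "restrict w (Supp H G w) \<in> Supp H G w \<rightarrow>\<^sub>E carrier H"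
      using w by (auto simp: carrier_base_group[OF H.group_axioms] Supp_def)
    moreover have "Supp H G w \<in> {F. F \<subseteq> carrier G \<and> finite F}"
      using finite_Supp[OF w] by (auto simp: Supp_def)
    ultimately show "w \<in> (\<Union>F\<in>{F. F \<subseteq> carrier G \<and> finite F}. ?ext F ` (F \<rightarrow>\<^sub>E carrier H))"
      by blast
  qed
  moreover have "countable (\<Union>F\<in>{F. F \<subseteq> carrier G \<and> finite F}. ?ext F ` (F \<rightarrow>\<^sub>E carrier H))"
    using H by (intro countable_UN countable_image countable_PiE)
      (auto intro: countable_subset[OF _ countable_Collect_finite_subset[OF G]])
  ultimately have "countable (carrier B)" by (rule countable_subset)
  then show ?thesis using G by (simp add: W_carrier)
qed

section \<open>Homomorphisms linking the two groups to the wreath product\<close>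

lemma snd_hom: "snd \<in> hom W G"
  by (auto simp: hom_def W_carrier W_mult)

definition lamp_at :: "'g \<Rightarrow> 'h \<Rightarrow> 'g \<Rightarrow> 'h"
  where "lamp_at z h = (\<lambda>x\<in>carrier G. if x = z then h else \<one>\<^bsub>H\<^esub>)"

lemma lamp_at_in: "h \<in> carrier H \<Longrightarrow> lamp_at z h \<in> carrier B"
  using finite_subset[of "Supp H G (lamp_at z h)" "{z}"]
  by (auto simp: carrier_base_group[OF H.group_axioms] lamp_at_def Supp_def)

lemma shift_one: "g \<in> carrier G \<Longrightarrow> shift G g \<one>\<^bsub>B\<^esub> = \<one>\<^bsub>B\<^esub>"
  by (auto simp: shift_def)

lemma shift_by_one: "w \<in> carrier B \<Longrightarrow> shift G \<one>\<^bsub>G\<^esub> w = w"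
  by (auto simp: carrier_base_group[OF H.group_axioms] shift_def PiE_iff extensional_def)

lemma position_hom: "(\<lambda>g. (\<one>\<^bsub>B\<^esub>, g)) \<in> hom G W"
  by (rule homI) (auto simp: W_carrier W_mult shift_one simp del: one_sum_group mult_sum_group)

lemma lamp_hom: "(\<lambda>h. (lamp_at \<one>\<^bsub>G\<^esub> h, \<one>\<^bsub>G\<^esub>)) \<in> hom H W"
proof (rule homI)
  fix h k assume hk: "h \<in> carrier H" "k \<in> carrier H"
  have "lamp_at \<one>\<^bsub>G\<^esub> (h \<otimes>\<^bsub>H\<^esub> k) = lamp_at \<one>\<^bsub>G\<^esub> h \<otimes>\<^bsub>B\<^esub> lamp_at \<one>\<^bsub>G\<^esub> k"
    using hk by (auto simp: lamp_at_def)
  then show "(lamp_at \<one>\<^bsub>G\<^esub> (h \<otimes>\<^bsub>H\<^esub> k), \<one>\<^bsub>G\<^esub>) = (lamp_at \<one>\<^bsub>G\<^esub> h, \<one>\<^bsub>G\<^esub>) \<otimes>\<^bsub>W\<^esub> (lamp_at \<one>\<^bsub>G\<^esub> k, \<one>\<^bsub>G\<^esub>)"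
    using hk by (simp add: W_mult shift_by_one lamp_at_in del: mult_sum_group)
qed (simp add: W_carrier lamp_at_in)

lemma lamp_at_conjugate:
  assumes z: "z \<in> carrier G" and h: "h \<in> carrier H"
  shows "(lamp_at z h, \<one>\<^bsub>G\<^esub>) =
    (\<one>\<^bsub>B\<^esub>, z) \<otimes>\<^bsub>W\<^esub> (lamp_at \<one>\<^bsub>G\<^esub> h, \<one>\<^bsub>G\<^esub>) \<otimes>\<^bsub>W\<^esub> inv\<^bsub>W\<^esub> (\<one>\<^bsub>B\<^esub>, z)"
proof -
  interpret pos: group_hom G W "\<lambda>g. (\<one>\<^bsub>B\<^esub>, g)"
    using position_hom by unfold_locales
  have "inv\<^bsub>G\<^esub> z \<otimes>\<^bsub>G\<^esub> x = \<one>\<^bsub>G\<^esub> \<longleftrightarrow> x = z" if "x \<in> carrier G" for x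
    using z that by (metis G.inv_closed G.inv_equality G.inv_inv G.l_inv)
  then have shift: "shift G z (lamp_at \<one>\<^bsub>G\<^esub> h) = lamp_at z h"
    using z by (auto simp: shift_def lamp_at_def)
  show ?thesis
    unfolding pos.hom_inv[OF z, symmetric] using shift z h lamp_at_in[OF h, of z] by (simp add: W_mult shift_one del: pos.hom_inv mult_sum_group one_sum_group)
qed

text \<open>The lampwise kernel is a sum of nonnegative terms, so it bounds the term of each lamp.
  Values at unlit lamps are collected too, because \<open>supported_power\<close> asks for values in
  \<open>Y\<close> on all of \<open>Z\<close>.\<close>

lemma cnd_bounded_imp_lamps:
  assumes X: "X \<subseteq> carrier W" and
    bounded: "\<And>\<psi>. cnd_kernel (carrier W) \<psi> \<Longrightarrow> left_invariant W \<psi> \<Longrightarrow> \<exists>C. \<forall>s\<in>X. \<psi> \<one>\<^bsub>W\<^esub> s \<le> C"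
  shows "rel_property_T H (insert \<one>\<^bsub>H\<^esub> {w x | w g x. (w, g) \<in> X \<and> x \<in> carrier G})" (is "rel_property_T H ?Y")
  unfolding rel_property_T_def
proof (rule rel_property_T_onI_cnd[OF H.group_axioms])
  show "?Y \<subseteq> carrier H" using X base_in by (auto simp: W_carrier)
  fix q assume q: "cnd_kernel (carrier H) q" "left_invariant H q"
  obtain C where C: "\<And>s. s \<in> X \<Longrightarrow> lampwise q \<one>\<^bsub>W\<^esub> s \<le> C"
    using bounded[OF cnd_kernel_lampwise left_invariant_lampwise, OF q] by blast
  have "q \<one>\<^bsub>H\<^esub> (w x) \<le> max 0 C" if wX: "(w, g) \<in> X" and x: "x \<in> carrier G" for w g x
  proof (cases "w x = \<one>\<^bsub>H\<^esub>")
    case True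
    then show ?thesis using cnd_kernel_diag[OF q(1)] by simp
  next
    case False
    have w: "w \<in> carrier B" using X wX by (auto simp: W_carrier)
    have "q \<one>\<^bsub>H\<^esub> (w x) \<le> (\<Sum>x\<in>Supp H G w. q \<one>\<^bsub>H\<^esub> (w x))"
      using False x w by (intro member_le_sum[of x] finite_Supp cnd_kernel_nonneg[OF q(1)])
        (auto simp: Supp_def base_in)
    also have "\<dots> \<le> C" using C[OF wX] by (simp add: lampwise_one)
    finally show ?thesis by simp
  qed
  then have "\<forall>y\<in>?Y. q \<one>\<^bsub>H\<^esub> y \<le> max 0 C" using cnd_kernel_diag[OF q(1)] by auto
  then show "\<exists>C. \<forall>y\<in>?Y. q \<one>\<^bsub>H\<^esub> y \<le> C" by blast
qed

lemma cnd_bounded_imp_card_Supp: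
  assumes bounded: "\<And>\<psi>. cnd_kernel (carrier W) \<psi> \<Longrightarrow> left_invariant W \<psi> \<Longrightarrow> \<exists>C. \<forall>s\<in>X. \<psi> \<one>\<^bsub>W\<^esub> s \<le> C"
  shows "bdd_above ((\<lambda>(w, g). card (Supp H G w)) ` X)"
proof -
  define q where "q x y = 1 - (if x = y then 1 else 0 :: real)" for x y :: 'h
  have q: "cnd_kernel (carrier H) q" unfolding q_def[abs_def]
    by (intro cnd_kernel_one_minus_pd pd_kernel_classes pd_kernel_one) auto
  have "left_invariant H q" by (simp add: left_invariant_def q_def)
  then obtain C where C: "\<And>s. s \<in> X \<Longrightarrow> lampwise q \<one>\<^bsub>W\<^esub> s \<le> C"
    using bounded[OF cnd_kernel_lampwise[OF q] left_invariant_lampwise] by blast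
  have "card (Supp H G w) \<le> nat \<lceil>C\<rceil>" if "(w, g) \<in> X" for w g
  proof -
    have "lampwise q \<one>\<^bsub>W\<^esub> (w, g) = (\<Sum>x\<in>Supp H G w. 1)"
      unfolding lampwise_one by (intro sum.cong refl) (auto simp: Supp_def q_def)
    then have "real (card (Supp H G w)) \<le> C" using C[OF that] by simp
    then show ?thesis by linarith
  qed
  then show ?thesis by (intro bdd_aboveI[of _ "nat \<lceil>C\<rceil>"]) auto
qed

lemma cnd_bounded_imp_positions:
  assumes X: "X \<subseteq> carrier W" and G: "countable (carrier G)"
    and TX: "rel_property_T G (snd ` X)"
    and bounded: "\<And>\<psi>. cnd_kernel (carrier W) \<psi> \<Longrightarrow> left_invariant W \<psi> \<Longrightarrow> \<exists>C. \<forall>s\<in>X. \<psi> \<one>\<^bsub>W\<^esub> s \<le> C"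
  shows "rel_property_T G (snd ` X \<union> (\<Union>s\<in>X. Supp H G (fst s)))"
  unfolding rel_property_T_def
proof (rule rel_property_T_onI_cnd[OF G.group_axioms])
  have sX: "snd ` X \<subseteq> carrier G" using X by (auto simp: W_carrier)
  then show "snd ` X \<union> (\<Union>s\<in>X. Supp H G (fst s)) \<subseteq> carrier G" by (auto simp: Supp_def)
  fix q assume q: "cnd_kernel (carrier G) q" "left_invariant G q"
  note G_bounded = rel_property_T_imp_cnd_bounded[OF G.group_axioms G sX TX]
  obtain Cs where Cs: "\<And>g. g \<in> snd ` X \<Longrightarrow> q \<one>\<^bsub>G\<^esub> g \<le> Cs" using G_bounded[OF q] by blast
  obtain Q where Q: "cnd_kernel (carrier W) Q" "left_invariant W Q"
    and detect: "\<And>C. \<exists>C'. \<forall>w\<in>carrier B. Q \<one>\<^bsub>W\<^esub> (w, \<one>\<^bsub>G\<^esub>) \<le> C \<longrightarrow> (\<forall>z\<in>Supp H G w. q \<one>\<^bsub>G\<^esub> z \<le> C')"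
    using exists_support_detecting_kernel[OF q] by blast
  obtain C1 where C1: "\<And>s. s \<in> X \<Longrightarrow> Q \<one>\<^bsub>W\<^esub> s \<le> C1" using bounded[OF Q] by blast
  define r where "r x y = Q (\<one>\<^bsub>B\<^esub>, x) (\<one>\<^bsub>B\<^esub>, y)" for x y
  have pos: "(\<one>\<^bsub>B\<^esub>, x) \<in> carrier W" if "x \<in> carrier G" for x
    using that B.one_closed by (simp add: W_carrier del: one_sum_group)
  have "cnd_kernel (carrier G) r"
    unfolding r_def[abs_def] by (rule cnd_kernel_pullback[OF Q(1) pos])
  moreover have "left_invariant G r"
    unfolding left_invariant_def r_def
  proof (intro ballI)
    fix g x y assume g: "g \<in> carrier G" "x \<in> carrier G" "y \<in> carrier G"
    have "Q (\<one>\<^bsub>B\<^esub>, g \<otimes>\<^bsub>G\<^esub> x) (\<one>\<^bsub>B\<^esub>, g \<otimes>\<^bsub>G\<^esub> y) = Q ((\<one>\<^bsub>B\<^esub>, g) \<otimes>\<^bsub>W\<^esub> (\<one>\<^bsub>B\<^esub>, x)) ((\<one>\<^bsub>B\<^esub>, g) \<otimes>\<^bsub>W\<^esub> (\<one>\<^bsub>B\<^esub>, y))"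
      using g hom_mult[OF position_hom] by simp
    then show "Q (\<one>\<^bsub>B\<^esub>, g \<otimes>\<^bsub>G\<^esub> x) (\<one>\<^bsub>B\<^esub>, g \<otimes>\<^bsub>G\<^esub> y) = Q (\<one>\<^bsub>B\<^esub>, x) (\<one>\<^bsub>B\<^esub>, y)"
      using Q(2) pos g by (simp add: left_invariant_def del: one_sum_group)
  qed
  ultimately obtain C2 where C2: "\<And>g. g \<in> snd ` X \<Longrightarrow> r \<one>\<^bsub>G\<^esub> g \<le> C2" using G_bounded by blast
  obtain C' where C': "\<And>w z. w \<in> carrier B \<Longrightarrow> Q \<one>\<^bsub>W\<^esub> (w, \<one>\<^bsub>G\<^esub>) \<le> 2 * C1 + 2 * C2 \<Longrightarrow> z \<in> Supp H G w \<Longrightarrow> q \<one>\<^bsub>G\<^esub> z \<le> C'"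
    using detect by meson
  have "q \<one>\<^bsub>G\<^esub> z \<le> C'" if wX: "(w, g) \<in> X" and z: "z \<in> Supp H G w" for w g z
  proof -
    have w: "w \<in> carrier B" "g \<in> carrier G" using X wX by (auto simp: W_carrier)
    have w1: "(w, \<one>\<^bsub>G\<^esub>) \<in> carrier W" "(w, g) \<in> carrier W" using w by (simp_all add: W_carrier)
    have split: "(w, \<one>\<^bsub>G\<^esub>) \<otimes>\<^bsub>W\<^esub> (\<one>\<^bsub>B\<^esub>, h) = (w, h)" if "h \<in> carrier G" for h
      using that w by (simp add: W_mult shift_one del: mult_sum_group one_sum_group)
    \<comment> \<open>Both arguments are left translates by \<open>(w, 1)\<close> of elements of
      \<open>G\<close>.\<close>
    have "Q (w, \<one>\<^bsub>G\<^esub>) (w, g) = r \<one>\<^bsub>G\<^esub> g"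
      using Q(2) w1 pos[OF w(2)] pos[OF G.one_closed] split[OF w(2)] split[OF G.one_closed]
      unfolding r_def left_invariant_def by metis
    then have "Q (w, g) (w, \<one>\<^bsub>G\<^esub>) \<le> C2"
      using C2[of g] wX cnd_kernel_sym[OF Q(1) w1] by force
    then have "Q \<one>\<^bsub>W\<^esub> (w, \<one>\<^bsub>G\<^esub>) \<le> 2 * C1 + 2 * C2"
      using cnd_kernel_triangle[OF Q(1) W.one_closed w1(2,1)] C1[OF wX] by linarith
    then show ?thesis using C' w(1) z by blast
  qed
  moreover have "q \<one>\<^bsub>G\<^esub> g \<le> Cs" if "(w, g) \<in> X" for w g using that Cs by force
  ultimately have "\<forall>z\<in>snd ` X \<union> (\<Union>s\<in>X. Supp H G (fst s)). q \<one>\<^bsub>G\<^esub> z \<le> max Cs C'"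
    by (fastforce simp: le_max_iff_disj)
  then show "\<exists>C. \<forall>z\<in>snd ` X \<union> (\<Union>s\<in>X. Supp H G (fst s)). q \<one>\<^bsub>G\<^esub> z \<le> C" by blast
qed

text \<open>Displacements of 0 are subadditive. Setting one lamp costs at most
  \<open>2 * c + d\<close>: go to \<open>z\<close>, switch, come back. With at most \<open>N\<close>
  lit lamps and a final move of cost \<open>c\<close>, the total is bounded uniformly on
  \<open>X\<close>.\<close>

lemma rel_property_T_wreathI:
  assumes Y: "Y \<subseteq> carrier H" and Z: "Z \<subseteq> carrier G" and X: "X \<subseteq> supported_power H G Y Z \<times> Z"
    and TY: "rel_property_T H Y" and TZ: "rel_property_T G Z"
    and bdd: "bdd_above ((\<lambda>(w, g). card (Supp H G w)) ` X)"
  shows "rel_property_T W X"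
  unfolding rel_property_T_def rel_property_T_on_def
proof (intro allI impI, elim conjE)
  fix V :: "(nat \<Rightarrow> real) inner_space" and \<alpha> assume V: "hilbert_space V" and \<alpha>: "isometric_action W V \<alpha>"
  then interpret isometric_group_action V W \<alpha>
    using W.group_axioms by (simp add: isometric_group_action_def isometric_group_action_axioms_def)
  have bound: "\<exists>C\<ge>0. \<forall>s\<in>S. len s \<le> C" if S: "S \<subseteq> carrier W" "rel_property_T W S" for S
  proof -
    have "ms.mbounded {\<alpha> \<gamma> \<zero>\<^bsub>V\<^esub> | \<gamma>. \<gamma> \<in> S}"
      using S V \<alpha> unfolding rel_property_T_def rel_property_T_on_def by blast
    then obtain C where "\<forall>s\<in>S. len s \<le> C" unfolding mbounded_orbit_iff[OF S(1)] by blast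
    then have "\<forall>s\<in>S. len s \<le> max 0 C" by (simp add: le_max_iff_disj)
    then show ?thesis by (intro exI[of _ "max 0 C"]) simp
  qed
  have posW: "(\<one>\<^bsub>B\<^esub>, g) \<in> carrier W" if "g \<in> carrier G" for g
    using hom_in_carrier[OF position_hom that] .
  have lampW: "(lamp_at \<one>\<^bsub>G\<^esub> h, \<one>\<^bsub>G\<^esub>) \<in> carrier W" if "h \<in> carrier H" for h
    using hom_in_carrier[OF lamp_hom that] .
  obtain c where c: "0 \<le> c" "\<And>z. z \<in> Z \<Longrightarrow> len (\<one>\<^bsub>B\<^esub>, z) \<le> c"
    using bound[OF _ rel_property_T_hom_image[OF G.group_axioms W.group_axioms position_hom TZ]] posW Z by blast
  obtain d where d: "0 \<le> d" "\<And>y. y \<in> Y \<Longrightarrow> len (lamp_at \<one>\<^bsub>G\<^esub> y, \<one>\<^bsub>G\<^esub>) \<le> d"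
    using bound[OF _ rel_property_T_hom_image[OF H.group_axioms W.group_axioms lamp_hom TY]] lampW Y by blast
  have lamp: "len (lamp_at z y, \<one>\<^bsub>G\<^esub>) \<le> 2 * c + d" if "z \<in> Z" "y \<in> Y" for z y
  proof -
    have zy: "z \<in> carrier G" "y \<in> carrier H" using that Y Z by auto
    have "len (lamp_at z y, \<one>\<^bsub>G\<^esub>) \<le> len ((\<one>\<^bsub>B\<^esub>, z) \<otimes>\<^bsub>W\<^esub> (lamp_at \<one>\<^bsub>G\<^esub> y, \<one>\<^bsub>G\<^esub>)) + len (inv\<^bsub>W\<^esub> (\<one>\<^bsub>B\<^esub>, z))"
      unfolding lamp_at_conjugate[OF zy]
      by (rule len_mult[OF W.m_closed[OF posW[OF zy(1)] lampW[OF zy(2)]] W.inv_closed[OF posW[OF zy(1)]]])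
    also have "len ((\<one>\<^bsub>B\<^esub>, z) \<otimes>\<^bsub>W\<^esub> (lamp_at \<one>\<^bsub>G\<^esub> y, \<one>\<^bsub>G\<^esub>)) \<le> len (\<one>\<^bsub>B\<^esub>, z) + len (lamp_at \<one>\<^bsub>G\<^esub> y, \<one>\<^bsub>G\<^esub>)"
      by (rule len_mult[OF posW[OF zy(1)] lampW[OF zy(2)]])
    also have "len (inv\<^bsub>W\<^esub> (\<one>\<^bsub>B\<^esub>, z)) = len (\<one>\<^bsub>B\<^esub>, z)" by (rule len_inv[OF posW[OF zy(1)]])
    finally show ?thesis using c(2)[OF that(1)] d(2)[OF that(2)] by linarith
  qed
  have word: "len (w, \<one>\<^bsub>G\<^esub>) \<le> real n * (2 * c + d)"
    if "w \<in> carrier B" "Supp H G w \<subseteq> Z" "\<forall>x\<in>Supp H G w. w x \<in> Y" "card (Supp H G w) = n" for w n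
    using that
  proof (induction n arbitrary: w)
    case 0
    then have "Supp H G w = {}" using finite_Supp by simp
    then have "w = \<one>\<^bsub>B\<^esub>"
      using 0 by (auto simp: carrier_base_group[OF H.group_axioms] Supp_def PiE_iff extensional_def fun_eq_iff)
    then have "len (w, \<one>\<^bsub>G\<^esub>) = 0" using len_one by (simp only: W_one)
    then show ?case by simp
  next
    case (Suc n)
    then obtain z where z: "z \<in> Supp H G w" by (metis card_eq_0_iff ex_in_conv nat.distinct(1))
    then have zG: "z \<in> carrier G" by (simp add: Supp_def)
    \<comment> \<open>Switching off one lit lamp leaves \<open>n\<close> of them, and the removed
      lamp is split off as a left factor.\<close>
    define w' where "w' = w(z := \<one>\<^bsub>H\<^esub>)"
    have S: "Supp H G w' = Supp H G w - {z}" by (auto simp: w'_def Supp_def)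
    have w': "w' \<in> carrier B"
      using Suc.prems(1) S zG
      by (auto simp: carrier_base_group[OF H.group_axioms] w'_def PiE_iff extensional_def)
    have yz: "w z \<in> Y" "z \<in> Z" using Suc.prems z by auto
    then have lz: "lamp_at z (w z) \<in> carrier B" using Y lamp_at_in by auto
    have "w = lamp_at z (w z) \<otimes>\<^bsub>B\<^esub> w'"
      using Suc.prems(1) zG base_in[of w] by (auto simp: fun_eq_iff lamp_at_def w'_def
          carrier_base_group[OF H.group_axioms] PiE_iff extensional_def)
    then have "(w, \<one>\<^bsub>G\<^esub>) = (lamp_at z (w z), \<one>\<^bsub>G\<^esub>) \<otimes>\<^bsub>W\<^esub> (w', \<one>\<^bsub>G\<^esub>)"
      using w' by (simp add: W_mult shift_by_one del: mult_sum_group)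
    then have "len (w, \<one>\<^bsub>G\<^esub>) \<le> len (lamp_at z (w z), \<one>\<^bsub>G\<^esub>) + len (w', \<one>\<^bsub>G\<^esub>)"
      using len_mult[of "(lamp_at z (w z), \<one>\<^bsub>G\<^esub>)" "(w', \<one>\<^bsub>G\<^esub>)"] w' lz by (simp add: W_carrier)
    also have "len (w', \<one>\<^bsub>G\<^esub>) \<le> real n * (2 * c + d)"
    proof (rule Suc.IH[OF w'])
      show "Supp H G w' \<subseteq> Z" "\<forall>x\<in>Supp H G w'. w' x \<in> Y"
        using Suc.prems S by (auto simp: w'_def)
      show "card (Supp H G w') = n" using Suc.prems S z finite_Supp[OF Suc.prems(1)] by simp
    qed
    also have "len (lamp_at z (w z), \<one>\<^bsub>G\<^esub>) \<le> 2 * c + d" using lamp yz by blast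
    finally show ?case by (simp add: algebra_simps)
  qed
  obtain N where N: "\<And>w g. (w, g) \<in> X \<Longrightarrow> card (Supp H G w) \<le> N"
    using bdd by (force simp: bdd_above_def)
  have XW: "X \<subseteq> carrier W" using X Z by (auto simp: W_carrier supported_power_def)
  have "len s \<le> real N * (2 * c + d) + c" if s: "s \<in> X" for s
  proof -
    obtain w g where wg: "s = (w, g)" by (cases s)
    then have w: "w \<in> carrier B" "Supp H G w \<subseteq> Z" "\<forall>x\<in>Z. w x \<in> Y" and g: "g \<in> Z" "g \<in> carrier G"
      using X Z s by (auto simp: supported_power_def)
    have "(w, g) = (w, \<one>\<^bsub>G\<^esub>) \<otimes>\<^bsub>W\<^esub> (\<one>\<^bsub>B\<^esub>, g)"
      using w(1) g by (simp add: W_mult shift_one del: mult_sum_group one_sum_group)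
    then have "len s \<le> len (w, \<one>\<^bsub>G\<^esub>) + len (\<one>\<^bsub>B\<^esub>, g)"
      using len_mult[of "(w, \<one>\<^bsub>G\<^esub>)" "(\<one>\<^bsub>B\<^esub>, g)"] w(1) posW[OF g(2)] wg
      by (simp add: W_carrier del: one_sum_group)
    also have "len (w, \<one>\<^bsub>G\<^esub>) \<le> real (card (Supp H G w)) * (2 * c + d)"
      using w by (intro word) auto
    also have "\<dots> \<le> real N * (2 * c + d)"
      using N[of w g] s wg c d by (intro mult_right_mono) auto
    finally show ?thesis using c(2)[OF g(1)] by linarith
  qed
  then show "ms.mbounded {\<alpha> \<gamma> \<zero>\<^bsub>V\<^esub> | \<gamma>. \<gamma> \<in> X}"
    unfolding mbounded_orbit_iff[OF XW] by blast
qed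

end

theorem theorem1p3:
  fixes H :: "('h, 'm) monoid_scheme" and G :: "('g, 'n) monoid_scheme"
    and X :: "(('g \<Rightarrow> 'h) \<times> 'g) set"
  assumes "group H" and "countable (carrier H)"
    and "group G" and "countable (carrier G)"
    and "X \<subseteq> carrier (wreath_product H G)"
  shows "rel_property_T (wreath_product H G) X \<longleftrightarrow>
    (\<exists>Y Z. Y \<subseteq> carrier H \<and> Z \<subseteq> carrier G \<and>
      X \<subseteq> supported_power H G Y Z \<times> Z \<and>
      rel_property_T H Y \<and> rel_property_T G Z \<and>
      bdd_above ((\<lambda>(w, g). card (Supp H G w)) ` X))"
proof
  interpret wreath H G
    using assms by (simp add: wreath_def)
  note X = assms(5)
  {
    assume T: "rel_property_T W X"
    note bounded = rel_property_T_imp_cnd_bounded[OF W.group_axioms countable_W[OF assms(2,4)] X T]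
    define Y where "Y = insert \<one>\<^bsub>H\<^esub> {w x | w g x. (w, g) \<in> X \<and> x \<in> carrier G}"
    \<comment> \<open>One and the same \<open>Z\<close> has to contain the positions and the
      supports.\<close>
    define Z where "Z = snd ` X \<union> (\<Union>s\<in>X. Supp H G (fst s))"
    have YZ: "Y \<subseteq> carrier H" "Z \<subseteq> carrier G"
      using X base_in by (auto simp: W_carrier Y_def Z_def Supp_def)
    have "X \<subseteq> supported_power H G Y Z \<times> Z"
    proof
      fix s assume s: "s \<in> X"
      then obtain w g where wg: "s = (w, g)" "w \<in> carrier B" using X by (auto simp: W_carrier)
      have "w x \<in> Y" if "x \<in> Z" for x
      proof -
        have "x \<in> carrier G" using that YZ(2) by blast
        then show ?thesis using s wg unfolding Y_def by blast
      qed
      moreover have "Supp H G w \<subseteq> Z" "g \<in> Z" using s wg by (force simp: Z_def)+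
      ultimately show "s \<in> supported_power H G Y Z \<times> Z" using wg by (simp add: supported_power_def)
    qed
    moreover have "rel_property_T H Y" unfolding Y_def by (rule cnd_bounded_imp_lamps[OF X]) (erule (1) bounded)
    moreover have "rel_property_T G Z" unfolding Z_def
      by (rule cnd_bounded_imp_positions[OF X assms(4)
            rel_property_T_hom_image[OF W.group_axioms G.group_axioms snd_hom T]])
        (erule (1) bounded)
    moreover have "bdd_above ((\<lambda>(w, g). card (Supp H G w)) ` X)"
      by (rule cnd_bounded_imp_card_Supp) (erule (1) bounded)
    ultimately show "\<exists>Y Z. Y \<subseteq> carrier H \<and> Z \<subseteq> carrier G \<and> X \<subseteq> supported_power H G Y Z \<times> Z \<and>
        rel_property_T H Y \<and> rel_property_T G Z \<and> bdd_above ((\<lambda>(w, g). card (Supp H G w)) ` X)"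
      using YZ by blast
  next
    assume "\<exists>Y Z. Y \<subseteq> carrier H \<and> Z \<subseteq> carrier G \<and> X \<subseteq> supported_power H G Y Z \<times> Z \<and>
        rel_property_T H Y \<and> rel_property_T G Z \<and> bdd_above ((\<lambda>(w, g). card (Supp H G w)) ` X)"
    then show "rel_property_T W X" using rel_property_T_wreathI by blast
  }
qed

end
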